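(* Let $(M,\omega)$ be a compact K\"ahler manifold without boundary of complex dimension $n$, let $\chi$ be another Hermitian metric on $M$, and let $F\in C^\infty(M,\mathbb{R})$. Assume that $$\chi-\frac{n-1}{n e^{F}}\,\omega>0 .$$ Then there exist a constant $C$ depending only on $M,\omega,\chi,F$ and a positive constant $\lambda$ depending only on $\omega$ and $\chi$ such that, whenever $\varphi\in\mathcal{H}_\chi$ is a solution of Donaldson's equation $$\omega\wedge\chi_\varphi^{\,n-1}=e^{F}\chi_\varphi^{\,n}\quad\text{on } M,$$ one has $$|\nabla\varphi|_\omega^2\le C\,e^{\lambda(\varphi-\inf_M\varphi)}\quad\text{on } M .$$
   Context: Metrics are identified with their associated real positive $(1,1)$-forms: in local holomorphic coordinates $\omega=\sqrt{-1}\,g_{i\bar j}\,dz^i\wedge d\bar z^j$ and $\chi=\sqrt{-1}\,\chi_{i\bar j}\,dz^i\wedge d\bar z^j$. The form $\omega$ is closed (K\"ahler); $\chi$ is only assumed Hermitian (not necessarily closed). For real $\varphi$ put $\chi_\varphi:=\chi+\sqrt{-1}\,\partial\bar\partial\varphi$, and $\mathcal{H}_\chi:=\{\varphi\in C^\infty(M,\mathbb{R}):\chi_\varphi>0\}$. The inequality "$>0$" for a real $(1,1)$-form means positive definite at every point. $|\nabla\varphi|^2_\omega:=g^{k\bar l}\varphi_k\varphi_{\bar l}$, where $(g^{k\bar l})$ is the inverse of $(g_{k\bar l})$ and $\varphi_k=\partial\varphi/\partial z^k$, $\varphi_{\bar l}=\partial\varphi/\partial\bar z^l$. *)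

theory Defs
  imports "HOL-Analysis.Analysis"
begin

section \<open>Smooth and holomorphic maps\<close>

text \<open>Continuous differentiability of order \<open>k\<close> on an open set, via iterated directional derivatives.\<close>

primrec Ck_on :: "nat \<Rightarrow> ('a::real_normed_vector \<Rightarrow> 'b::real_normed_vector) \<Rightarrow> 'a set \<Rightarrow> bool" where
  "Ck_on 0 f S \<longleftrightarrow> continuous_on S f"
| "Ck_on (Suc k) f S \<longleftrightarrow>
     (\<forall>x\<in>S. f differentiable (at x)) \<and> (\<forall>v. Ck_on k (\<lambda>x. frechet_derivative f (at x) v) S)"

definition smooth_on :: "('a::real_normed_vector \<Rightarrow> 'b::real_normed_vector) \<Rightarrow> 'a set \<Rightarrow> bool" where
  "smooth_on f S \<longleftrightarrow> (\<forall>k. Ck_on k f S)"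

definition holomorphic_map_on :: "(complex^'n::finite \<Rightarrow> complex^'m::finite) \<Rightarrow> (complex^'n) set \<Rightarrow> bool" where
  "holomorphic_map_on f S \<longleftrightarrow>
     (\<forall>z\<in>S. \<exists>D. (f has_derivative D) (at z) \<and> (\<forall>a v. D (a *s v) = a *s D v))"

text \<open>The Wirtinger derivatives \<open>\<partial>/\<partial>z\<^sup>k\<close> and \<open>\<partial>/\<partial>\<bar>z\<^sup>k\<close>: the real coordinates are given by
  \<open>z\<^sup>k = x\<^sup>k + \<i> y\<^sup>k\<close>, so \<open>\<partial>/\<partial>x\<^sup>k\<close> and \<open>\<partial>/\<partial>y\<^sup>k\<close> are the derivatives in the directions
  \<open>axis k 1\<close> and \<open>axis k \<i>\<close>.\<close>

definition d_dz :: "'n::finite \<Rightarrow> (complex^'n \<Rightarrow> complex) \<Rightarrow> complex^'n \<Rightarrow> complex" where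
  "d_dz k f z = (frechet_derivative f (at z) (axis k 1) - \<i> * frechet_derivative f (at z) (axis k \<i>)) / 2"

definition d_dzbar :: "'n::finite \<Rightarrow> (complex^'n \<Rightarrow> complex) \<Rightarrow> complex^'n \<Rightarrow> complex" where
  "d_dzbar k f z = (frechet_derivative f (at z) (axis k 1) + \<i> * frechet_derivative f (at z) (axis k \<i>)) / 2"

section \<open>Exterior algebra\<close>

text \<open>A complex-valued \<open>k\<close>-form on a real vector space is a function of a sequence of vectors
  that depends on the entries \<open>0, \<dots>, k - 1\<close> only; the degree is passed explicitly to the operations.\<close>

type_synonym 'v form = "(nat \<Rightarrow> 'v) \<Rightarrow> complex"

definition wedge :: "nat \<Rightarrow> nat \<Rightarrow> 'v form \<Rightarrow> 'v form \<Rightarrow> 'v form" where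
  "wedge k l \<alpha> \<beta> v =
     (\<Sum>\<sigma> | \<sigma> permutes {..<k+l}. of_int (sign \<sigma>) * \<alpha> (\<lambda>i. v (\<sigma> i)) * \<beta> (\<lambda>i. v (\<sigma> (k + i))))
       / (fact k * fact l)"

text \<open>The \<open>m\<close>-th exterior power of a form of degree 2.\<close>

primrec wedge_power2 :: "'v form \<Rightarrow> nat \<Rightarrow> 'v form" where
  "wedge_power2 \<alpha> 0 = (\<lambda>v. 1)"
| "wedge_power2 \<alpha> (Suc m) = wedge 2 (2 * m) \<alpha> (wedge_power2 \<alpha> m)"

text \<open>The exterior derivative of a field of \<open>k\<close>-forms on an open subset of a normed space
  (evaluated on constant vector fields, so that no bracket terms occur).\<close>

definition ext_deriv :: "nat \<Rightarrow> ('v::real_normed_vector \<Rightarrow> 'v form) \<Rightarrow> 'v \<Rightarrow> 'v form" where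
  "ext_deriv k \<eta> z v =
     (\<Sum>i\<le>k. (-1) ^ i * frechet_derivative (\<lambda>y. \<eta> y (\<lambda>j. if j < i then v j else v (Suc j))) (at z) (v i))"

definition dz :: "'n::finite \<Rightarrow> (complex^'n) form" where
  "dz i v = v 0 $ i"

definition dzbar :: "'n::finite \<Rightarrow> (complex^'n) form" where
  "dzbar i v = cnj (v 0 $ i)"

text \<open>The (1,1)-form \<open>\<i> h\<^bsub>i\<bar>j\<^esub> dz\<^sup>i \<and> d\<bar>z\<^sup>j\<close> at a point; it is real iff the coefficient matrix is Hermitian.\<close>

definition form11 :: "complex^'n^'n::finite \<Rightarrow> (complex^'n) form" where
  "form11 h v = (\<Sum>i\<in>UNIV. \<Sum>j\<in>UNIV. \<i> * h $ i $ j * wedge 1 1 (dz i) (dzbar j) v)"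

definition hermitian_matrix :: "complex^'n^'n::finite \<Rightarrow> bool" where
  "hermitian_matrix h \<longleftrightarrow> (\<forall>i j. h $ i $ j = cnj (h $ j $ i))"

text \<open>For Hermitian \<open>h\<close> the sum below is real.\<close>

definition pos_def :: "complex^'n^'n::finite \<Rightarrow> bool" where
  "pos_def h \<longleftrightarrow> hermitian_matrix h \<and>
     (\<forall>v. v \<noteq> 0 \<longrightarrow> 0 < Re (\<Sum>i\<in>UNIV. \<Sum>j\<in>UNIV. h $ i $ j * v $ i * cnj (v $ j)))"

section \<open>Complex manifolds\<close>

text \<open>A chart is a pair of its domain and its coordinate map (irrelevant outside the domain).
  The complex dimension is \<open>CARD('n)\<close>.\<close>

type_synonym ('a, 'n) chart = "'a set \<times> ('a \<Rightarrow> complex^'n)"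

abbreviation cdom :: "('a, 'n) chart \<Rightarrow> 'a set" where "cdom c \<equiv> fst c"
abbreviation cmap :: "('a, 'n) chart \<Rightarrow> 'a \<Rightarrow> complex^'n" where "cmap c \<equiv> snd c"

definition cimg :: "('a, 'n) chart \<Rightarrow> (complex^'n) set" where
  "cimg c = cmap c ` cdom c"

definition cinv :: "('a, 'n) chart \<Rightarrow> complex^'n \<Rightarrow> 'a" where
  "cinv c = inv_into (cdom c) (cmap c)"

definition transition :: "('a, 'n) chart \<Rightarrow> ('a, 'n) chart \<Rightarrow> complex^'n \<Rightarrow> complex^'n" where
  "transition c d = (\<lambda>z. cmap d (cinv c z))"

text \<open>\<open>A\<close> is a holomorphic atlas of \<open>X\<close>, not necessarily a maximal one. Charts map onto open subsets
  of complex Euclidean space, so there is no boundary.\<close>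

definition complex_manifold :: "'a topology \<Rightarrow> ('a, 'n::finite) chart set \<Rightarrow> bool" where
  "complex_manifold X A \<longleftrightarrow>
     Hausdorff_space X \<and> second_countable X \<and>
     (\<forall>c\<in>A. openin X (cdom c) \<and> open (cimg c) \<and>
        homeomorphic_map (subtopology X (cdom c)) (top_of_set (cimg c)) (cmap c)) \<and>
     topspace X = (\<Union>c\<in>A. cdom c) \<and>
     (\<forall>c\<in>A. \<forall>d\<in>A. holomorphic_map_on (transition c d) (cmap c ` (cdom c \<inter> cdom d)))"

definition in_chart :: "('a, 'n) chart \<Rightarrow> ('a \<Rightarrow> real) \<Rightarrow> complex^'n \<Rightarrow> real" where
  "in_chart c u = (\<lambda>z. u (cinv c z))"

definition smooth_fun :: "('a, 'n::finite) chart set \<Rightarrow> ('a \<Rightarrow> real) \<Rightarrow> bool" where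
  "smooth_fun A u \<longleftrightarrow> (\<forall>c\<in>A. smooth_on (in_chart c u) (cimg c))"

section \<open>Real (1,1)-forms and metrics\<close>

text \<open>A (1,1)-form is given by its coefficient matrices in the charts: \<open>h c z $ i $ j\<close> is
  \<open>h\<^bsub>i\<bar>j\<^esub>\<close> in the chart \<open>c\<close> at the point with coordinates \<open>z\<close>.\<close>

type_synonym ('a, 'n) coeffs = "('a, 'n) chart \<Rightarrow> complex^'n \<Rightarrow> complex^'n^'n"

text \<open>The last condition says that the local forms are pullbacks of each other under the coordinate
  changes, i.e. that they define one form on the manifold.\<close>

definition real_form11 :: "('a, 'n::finite) chart set \<Rightarrow> ('a, 'n) coeffs \<Rightarrow> bool" where
  "real_form11 A h \<longleftrightarrow>
     (\<forall>c\<in>A. \<forall>i j. smooth_on (\<lambda>z. h c z $ i $ j) (cimg c)) \<and>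
     (\<forall>c\<in>A. \<forall>z\<in>cimg c. hermitian_matrix (h c z)) \<and>
     (\<forall>c\<in>A. \<forall>d\<in>A. \<forall>z\<in>cmap c ` (cdom c \<inter> cdom d). \<forall>v.
        form11 (h d (transition c d z)) (\<lambda>i. frechet_derivative (transition c d) (at z) (v i)) =
        form11 (h c z) v)"

definition positive11 :: "('a, 'n::finite) chart set \<Rightarrow> ('a, 'n) coeffs \<Rightarrow> bool" where
  "positive11 A h \<longleftrightarrow> (\<forall>c\<in>A. \<forall>z\<in>cimg c. pos_def (h c z))"

definition hermitian_metric :: "('a, 'n::finite) chart set \<Rightarrow> ('a, 'n) coeffs \<Rightarrow> bool" where
  "hermitian_metric A h \<longleftrightarrow> real_form11 A h \<and> positive11 A h"

definition closed11 :: "('a, 'n::finite) chart set \<Rightarrow> ('a, 'n) coeffs \<Rightarrow> bool" where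
  "closed11 A h \<longleftrightarrow> (\<forall>c\<in>A. \<forall>z\<in>cimg c. \<forall>v. ext_deriv 2 (\<lambda>y. form11 (h c y)) z v = 0)"

definition compact_kaehler_manifold ::
    "'a topology \<Rightarrow> ('a, 'n::finite) chart set \<Rightarrow> ('a, 'n) coeffs \<Rightarrow> bool" where
  "compact_kaehler_manifold X A \<omega> \<longleftrightarrow>
     complex_manifold X A \<and> compact_space X \<and> hermitian_metric A \<omega> \<and> closed11 A \<omega>"

text \<open>Coefficients of \<open>h + \<i>\<partial>\<bar>\<partial>u\<close>, where \<open>\<partial>\<bar>\<partial>u = u\<^bsub>i\<bar>j\<^esub> dz\<^sup>i \<and> d\<bar>z\<^sup>j\<close>. The vector binder of the library
  reserves the Greek letter chi, hence the ASCII name of the background metric.\<close>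

definition perturb :: "('a, 'n::finite) coeffs \<Rightarrow> ('a \<Rightarrow> real) \<Rightarrow> ('a, 'n) coeffs" where
  "perturb chi u c z =
     (\<chi> i j. chi c z $ i $ j + d_dz i (d_dzbar j (\<lambda>y. complex_of_real (in_chart c u y))) z)"

definition potentials :: "('a, 'n::finite) chart set \<Rightarrow> ('a, 'n) coeffs \<Rightarrow> ('a \<Rightarrow> real) set" where
  "potentials A chi = {u. smooth_fun A u \<and> positive11 A (perturb chi u)}"

text \<open>The square norm \<open>g\<^bsup>k\<bar>l\<^esup> u\<^sub>k u\<^bsub>\<bar>l\<^esub>\<close> of the gradient in the chart \<open>c\<close>. With the index convention
  \<open>g\<^bsup>k\<bar>l\<^esup> g\<^bsub>j\<bar>l\<^esub> = \<delta>\<^sub>j\<^sup>k\<close> (the one for which the expression is independent of the chart), the matrix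
  of the \<open>g\<^bsup>k\<bar>l\<^esup>\<close> is the inverse of the transpose of the matrix of the \<open>g\<^bsub>k\<bar>l\<^esub>\<close>. The sum is real.\<close>

definition grad_sq :: "('a, 'n::finite) coeffs \<Rightarrow> ('a \<Rightarrow> real) \<Rightarrow> ('a, 'n) chart \<Rightarrow> complex^'n \<Rightarrow> real" where
  "grad_sq g u c z =
     (let f = (\<lambda>y. complex_of_real (in_chart c u y)); G = matrix_inv (transpose (g c z))
      in Re (\<Sum>k\<in>UNIV. \<Sum>l\<in>UNIV. G $ k $ l * d_dz k f z * d_dzbar l f z))"

text \<open>Donaldson's equation \<open>\<omega> \<and> \<chi>\<^sub>u\<^sup>n\<^sup>-\<^sup>1 = e\<^sup>F \<chi>\<^sub>u\<^sup>n\<close> as an identity of \<open>2n\<close>-forms.\<close>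

definition donaldson_eq ::
    "('a, 'n::finite) chart set \<Rightarrow> ('a, 'n) coeffs \<Rightarrow> ('a, 'n) coeffs \<Rightarrow> ('a \<Rightarrow> real) \<Rightarrow> ('a \<Rightarrow> real) \<Rightarrow> bool" where
  "donaldson_eq A \<omega> chi F u \<longleftrightarrow>
     (\<forall>c\<in>A. \<forall>z\<in>cimg c. \<forall>v.
        wedge 2 (2 * (CARD('n) - 1)) (form11 (\<omega> c z))
          (wedge_power2 (form11 (perturb chi u c z)) (CARD('n) - 1)) v =
        complex_of_real (exp (in_chart c F z)) *
          wedge_power2 (form11 (perturb chi u c z)) CARD('n) v)"

end

theory Submission
  imports Defs
begin

text \<open>At a maximum point of \<open>|\<nabla>\<phi>|\<^sup>2 e\<^bsup>-\<lambda>t + 1/t\<^esup>\<close> with \<open>t = \<phi> - inf \<phi> + 1\<close>, replace \<open>|\<nabla>\<phi>|\<^sup>2\<close> by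
  \<open>|\<partial>\<^sub>V \<phi>|\<^sup>2 / g(V, V)\<close>, where \<open>V\<close> is constant in a chart and equals the normalized gradient at the point: this
  function is smaller and touches the original one, so no normal coordinates and no curvature identities
  are needed. Applying the linearized operator, the term coming from \<open>1/t\<close> forces one eigenvalue of \<open>\<chi>\<^sub>\<phi>\<close> to be
  large if the gradient is large, and then the cone condition gives a contradiction, for \<open>\<lambda>\<close> large depending
  on \<open>F\<close>. The dependence on \<open>F\<close> is removed by bounding the oscillation of \<open>\<phi>\<close> on each component: by the
  gradient estimate \<open>\<phi>\<close> is close to its minimum on a ball of definite size, and since
  \<open>tr\<^sub>\<omega> \<i>\<partial>\<bar>\<partial>\<phi> \<ge> - tr\<^sub>\<omega> \<chi>\<close>, comparison with the barriers \<open>exp (- \<alpha> |y - z|\<^sup>2)\<close> along a chain of coordinate balls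
  shows that the maximum of \<open>\<phi>\<close> is not much larger. So the gradient is bounded, and \<open>\<lambda> = 1\<close> will do.\<close>

section \<open>Directional derivatives\<close>

text \<open>The reciprocals \<mu> of the eigenvalues of \<open>\<chi>\<^sub>\<phi>\<close> relative
  to \<omega> have the prescribed sum n e^F, whereas the eigenvalues themselves have no upper bound.
  So every error term has to be controlled by \<Sum> \<mu> and \<Sum> \<mu>^2. The linearized
  operator has the weights \<mu>^2; with these weights the third derivatives of \<phi> at the
  maximum point combine into derivatives of \<omega>, \<chi> and F. The summand 1/t is chosen for
  its convexity: its second derivative 2/t^3 produces the good term (2/t^3) \<Sum> \<mu>^2
  |\<partial> \<phi>|^2. The price is a factor t^3 in the bound at the maximum point, which the
  decaying exponential absorbs. The cone condition controls only n - 1 directions, so it becomes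
  effective after one \<mu> is known to be small. The threshold for \<lambda> then involves the
  margin in the cone condition and the derivatives of F, which is why the oscillation bound must
  follow. The manifold may be disconnected, so minima, maxima and comparisons are taken on
  components; the resulting gradient bound no longer mentions an infimum.\<close>

definition dd :: "'a::real_normed_vector \<Rightarrow> ('a \<Rightarrow> 'b::real_normed_vector) \<Rightarrow> 'a \<Rightarrow> 'b" where
  "dd a u x = frechet_derivative u (at x) a"

lemma Ck_on_Suc_dd:
  "Ck_on (Suc k) u S \<longleftrightarrow> (\<forall>x\<in>S. u differentiable (at x)) \<and> (\<forall>v. Ck_on k (dd v u) S)"
  by (simp add: dd_def[abs_def])

lemma smooth_on_dd: "smooth_on u S \<Longrightarrow> smooth_on (dd a u) S"
  unfolding smooth_on_def using Ck_on_Suc_dd by blast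

lemma smooth_on_imp_differentiable: "smooth_on u S \<Longrightarrow> x \<in> S \<Longrightarrow> u differentiable (at x)"
  unfolding smooth_on_def using Ck_on_Suc_dd by blast

lemma smooth_on_imp_continuous_on: "smooth_on u S \<Longrightarrow> continuous_on S u"
  unfolding smooth_on_def by (metis Ck_on.simps(1))

lemma has_derivative_dd: "u differentiable (at x) \<Longrightarrow> (u has_derivative (\<lambda>a. dd a u x)) (at x)"
  unfolding dd_def by (simp add: frechet_derivative_works[symmetric])

lemma dd_eqI: "(u has_derivative D) (at x) \<Longrightarrow> dd a u x = D a"
  unfolding dd_def by (metis frechet_derivative_at)

text \<open>This holds even where no derivative exists: \<open>frechet_derivative\<close> chooses
  among candidates, and functions that agree near \<open>x\<close> have the same candidates.\<close>

lemma dd_cong: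
  assumes "open S" "x \<in> S" "\<And>y. y \<in> S \<Longrightarrow> u y = v y"
  shows "dd a u x = dd a v x"
proof -
  have "(u has_derivative D) (at x) \<longleftrightarrow> (v has_derivative D) (at x)" for D
    using has_derivative_transform_within_open[OF _ assms(1,2)] assms(3) by metis
  then show ?thesis unfolding dd_def frechet_derivative_def by presburger
qed

lemma differentiable_cong_open:
  assumes "open S" "x \<in> S" "\<And>y. y \<in> S \<Longrightarrow> u y = v y"
  shows "u differentiable (at x) \<longleftrightarrow> v differentiable (at x)"
  unfolding differentiable_def
  using has_derivative_transform_within_open[OF _ assms(1,2)] assms(3) by metis

lemma Ck_on_cong:
  assumes "open S" "\<And>y. y \<in> S \<Longrightarrow> u y = v y"
  shows "Ck_on k u S \<longleftrightarrow> Ck_on k v S"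
  using assms(2)
proof (induction k arbitrary: u v)
  case 0 then show ?case by (simp cong: continuous_on_cong)
next
  case (Suc k)
  have "Ck_on k (dd a u) S \<longleftrightarrow> Ck_on k (dd a v) S" for a
    by (rule Suc.IH) (rule dd_cong[OF assms(1)], auto intro: Suc.prems)
  moreover have "\<forall>x\<in>S. u differentiable (at x) \<longleftrightarrow> v differentiable (at x)"
    using differentiable_cong_open[OF assms(1)] Suc.prems by blast
  ultimately show ?case unfolding Ck_on_Suc_dd by auto
qed

lemma smooth_on_cong:
  "open S \<Longrightarrow> (\<And>y. y \<in> S \<Longrightarrow> u y = v y) \<Longrightarrow> smooth_on u S \<longleftrightarrow> smooth_on v S"
  unfolding smooth_on_def using Ck_on_cong by blast

lemma dd_bounded_linear:
  assumes "bounded_linear L" "u differentiable (at x)"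
  shows "dd a (\<lambda>y. L (u y)) x = L (dd a u x)"
  by (rule dd_eqI[OF bounded_linear.has_derivative[OF assms(1) has_derivative_dd[OF assms(2)]]])

lemma dd_add:
  assumes "u differentiable (at x)" "v differentiable (at x)"
  shows "dd a (\<lambda>y. u y + v y) x = dd a u x + dd a v x"
  by (rule dd_eqI[OF has_derivative_add[OF has_derivative_dd has_derivative_dd, OF assms]])

lemma dd_const [simp]: "dd a (\<lambda>y. c) x = 0"
  using dd_eqI[OF has_derivative_const] .

lemma dd_sum:
  assumes "\<And>i. i \<in> I \<Longrightarrow> u i differentiable (at x)"
  shows "dd a (\<lambda>y. \<Sum>i\<in>I. u i y) x = (\<Sum>i\<in>I. dd a (u i) x)"
  by (rule dd_eqI[OF has_derivative_sum[OF has_derivative_dd]]) (rule assms)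

lemma Ck_on_bounded_linear:
  assumes "open S" "bounded_linear L" "Ck_on k u S"
  shows "Ck_on k (\<lambda>y. L (u y)) S"
  using assms(3)
proof (induction k arbitrary: u)
  case 0 then show ?case by (simp add: bounded_linear.continuous_on[OF assms(2)])
next
  case (Suc k)
  have d: "\<forall>x\<in>S. u differentiable (at x)" and c: "\<And>a. Ck_on k (dd a u) S"
    using Suc.prems unfolding Ck_on_Suc_dd by auto
  have "Ck_on k (dd a (\<lambda>y. L (u y))) S" for a
    using Suc.IH[OF c, of a] Ck_on_cong[OF assms(1), of "dd a (\<lambda>y. L (u y))" "\<lambda>y. L (dd a u y)"]
      dd_bounded_linear[OF assms(2)] d by blast
  moreover have "\<forall>x\<in>S. (\<lambda>y. L (u y)) differentiable (at x)"
    using d bounded_linear.has_derivative[OF assms(2)] unfolding differentiable_def by blast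
  ultimately show ?case unfolding Ck_on_Suc_dd by blast
qed

lemma smooth_on_bounded_linear:
  "open S \<Longrightarrow> bounded_linear L \<Longrightarrow> smooth_on u S \<Longrightarrow> smooth_on (\<lambda>y. L (u y)) S"
  unfolding smooth_on_def using Ck_on_bounded_linear by blast

lemma Ck_on_add:
  assumes "open S" "Ck_on k u S" "Ck_on k v S"
  shows "Ck_on k (\<lambda>y. u y + v y) S"
  using assms(2,3)
proof (induction k arbitrary: u v)
  case 0 then show ?case by (simp add: continuous_on_add)
next
  case (Suc k)
  have d: "\<forall>x\<in>S. u differentiable (at x)" "\<forall>x\<in>S. v differentiable (at x)"
    and c: "\<And>a. Ck_on k (dd a u) S" "\<And>a. Ck_on k (dd a v) S"
    using Suc.prems unfolding Ck_on_Suc_dd by auto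
  have "Ck_on k (dd a (\<lambda>y. u y + v y)) S" for a
    using Suc.IH[OF c, of a a] Ck_on_cong[OF assms(1), of "dd a (\<lambda>y. u y + v y)" "\<lambda>y. dd a u y + dd a v y"]
      dd_add d by blast
  then show ?case unfolding Ck_on_Suc_dd using d by auto
qed

lemma Ck_on_const: "Ck_on k (\<lambda>y::'a::real_normed_vector. c) S"
proof (induction k arbitrary: c)
  case (Suc k)
  have "dd a (\<lambda>y::'a. c) = (\<lambda>y. 0)" for a by auto
  then show ?case using Suc.IH unfolding Ck_on_Suc_dd by simp
qed simp

lemma smooth_on_add:
  "open S \<Longrightarrow> smooth_on u S \<Longrightarrow> smooth_on v S \<Longrightarrow> smooth_on (\<lambda>y. u y + v y) S"
  unfolding smooth_on_def using Ck_on_add by blast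

lemma smooth_on_const: "smooth_on (\<lambda>y. c) S"
  unfolding smooth_on_def using Ck_on_const by blast

lemma smooth_on_sum:
  "open S \<Longrightarrow> (\<And>i. i \<in> I \<Longrightarrow> smooth_on (u i) S) \<Longrightarrow> smooth_on (\<lambda>y. \<Sum>i\<in>I. u i y) S"
  by (induction I rule: infinite_finite_induct) (auto intro: smooth_on_add smooth_on_const)

lemma dd_add_dir: "u differentiable (at x) \<Longrightarrow> dd (a + b) u x = dd a u x + dd b u x"
  using linear_add[OF has_derivative_linear[OF has_derivative_dd]] .

lemma dd_scaleR_dir: "u differentiable (at x) \<Longrightarrow> dd (r *\<^sub>R a) u x = r *\<^sub>R dd a u x"
  using linear_scale[OF has_derivative_linear[OF has_derivative_dd]] .

lemma dd_sum_dir: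
  "u differentiable (at x) \<Longrightarrow> dd (\<Sum>i\<in>I. a i) u x = (\<Sum>i\<in>I. dd (a i) u x)"
  using linear_sum[OF has_derivative_linear[OF has_derivative_dd]] .

lemma dd_line:
  fixes u :: "'a::real_normed_vector \<Rightarrow> 'b::real_normed_vector"
  assumes "u differentiable (at (x + s *\<^sub>R a))"
  shows "((\<lambda>s. u (x + s *\<^sub>R a)) has_vector_derivative dd a u (x + s *\<^sub>R a)) (at s)"
proof -
  have "((\<lambda>s. x + s *\<^sub>R a) has_derivative (\<lambda>h. h *\<^sub>R a)) (at s)"
    by (auto intro!: derivative_eq_intros)
  from has_derivative_compose[OF this has_derivative_dd[OF assms]]
  show ?thesis unfolding has_vector_derivative_def by (simp add: dd_scaleR_dir[OF assms])
qed

lemma dd_line_real: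
  fixes u :: "'a::real_normed_vector \<Rightarrow> real"
  assumes "u differentiable (at (x + s *\<^sub>R a))"
  shows "((\<lambda>s. u (x + s *\<^sub>R a)) has_real_derivative dd a u (x + s *\<^sub>R a)) (at s)"
  using dd_line[OF assms] by (simp add: has_real_derivative_iff_has_vector_derivative)

text \<open>The mean value theorem is applied in direction \<open>a\<close> to an increment in
  direction \<open>b\<close>, and then in direction \<open>b\<close>. The left side is symmetric in
  \<open>a\<close> and \<open>b\<close> but the right side is not, which is what
  \<open>dd_commute\<close> exploits.\<close>

lemma second_difference_mvt:
  fixes u :: "'a::real_normed_vector \<Rightarrow> real"
  assumes "smooth_on u S" "0 < t"
    and S: "\<And>p q. \<bar>p\<bar> \<le> t \<Longrightarrow> \<bar>q\<bar> \<le> t \<Longrightarrow> x + p *\<^sub>R a + q *\<^sub>R b \<in> S"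
  shows "\<exists>p q. 0 < p \<and> p < t \<and> 0 < q \<and> q < t \<and>
    u (x + t *\<^sub>R a + t *\<^sub>R b) - u (x + t *\<^sub>R a) - u (x + t *\<^sub>R b) + u x
      = t^2 * dd b (dd a u) (x + p *\<^sub>R a + q *\<^sub>R b)"
proof -
  have du: "u differentiable (at (x + p *\<^sub>R a + q *\<^sub>R b))" "dd a u differentiable (at (x + p *\<^sub>R a + q *\<^sub>R b))"
    if "\<bar>p\<bar> \<le> t" "\<bar>q\<bar> \<le> t" for p q
    using smooth_on_imp_differentiable[OF assms(1) S[OF that]]
      smooth_on_imp_differentiable[OF smooth_on_dd[OF assms(1)] S[OF that]] by auto
  let ?f = "\<lambda>p. u (x + t *\<^sub>R b + p *\<^sub>R a) - u (x + p *\<^sub>R a)"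
  have "\<exists>p. 0 < p \<and> p < t \<and> ?f t - ?f 0 = (t - 0) * (dd a u (x + t *\<^sub>R b + p *\<^sub>R a) - dd a u (x + p *\<^sub>R a))"
  proof (rule MVT2[OF assms(2)])
    fix p assume p: "0 \<le> p" "p \<le> t"
    have "u differentiable (at (x + t *\<^sub>R b + p *\<^sub>R a))" "u differentiable (at (x + p *\<^sub>R a))"
      using du(1)[of p t] du(1)[of p 0] p assms(2) by (auto simp: add_ac)
    then show "(?f has_real_derivative dd a u (x + t *\<^sub>R b + p *\<^sub>R a) - dd a u (x + p *\<^sub>R a)) (at p)"
      by (intro DERIV_diff dd_line_real)
  qed
  then obtain p where p: "0 < p" "p < t"
    "?f t - ?f 0 = t * (dd a u (x + t *\<^sub>R b + p *\<^sub>R a) - dd a u (x + p *\<^sub>R a))" by auto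
  let ?g = "\<lambda>q. dd a u (x + p *\<^sub>R a + q *\<^sub>R b)"
  have "\<exists>q. 0 < q \<and> q < t \<and> ?g t - ?g 0 = (t - 0) * (dd b (dd a u) (x + p *\<^sub>R a + q *\<^sub>R b))"
  proof (rule MVT2[OF assms(2)])
    fix q assume "0 \<le> q" "q \<le> t"
    then have "dd a u differentiable (at (x + p *\<^sub>R a + q *\<^sub>R b))" using du(2)[of p q] p by auto
    then show "(?g has_real_derivative dd b (dd a u) (x + p *\<^sub>R a + q *\<^sub>R b)) (at q)"
      by (rule dd_line_real)
  qed
  then obtain q where q: "0 < q" "q < t" "?g t - ?g 0 = t * dd b (dd a u) (x + p *\<^sub>R a + q *\<^sub>R b)" by auto
  have "?f t - ?f 0 = t * (t * dd b (dd a u) (x + p *\<^sub>R a + q *\<^sub>R b))"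
    using p(3) q(3) by (simp add: add_ac)
  then show ?thesis using p q
    by (intro exI[of _ p] exI[of _ q]) (auto simp: power2_eq_square add_ac algebra_simps)
qed

lemma dd_commute:
  fixes u :: "'a::real_normed_vector \<Rightarrow> real"
  assumes "open S" "smooth_on u S" "x \<in> S"
  shows "dd a (dd b u) x = dd b (dd a u) x"
proof (rule ccontr)
  assume neq: "dd a (dd b u) x \<noteq> dd b (dd a u) x"
  define e where "e = \<bar>dd a (dd b u) x - dd b (dd a u) x\<bar> / 2"
  have e: "e > 0" using neq by (auto simp: e_def)
  have cont: "isCont (dd a (dd b u)) x" "isCont (dd b (dd a u)) x"
    using assms smooth_on_imp_continuous_on[OF smooth_on_dd[OF smooth_on_dd[OF assms(2)]]]
      continuous_on_eq_continuous_at by blast+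
  obtain d1 where d1: "d1 > 0" "\<And>y. dist y x < d1 \<Longrightarrow> dist (dd a (dd b u) y) (dd a (dd b u) x) < e"
    using cont(1) e unfolding continuous_at_eps_delta by blast
  obtain d2 where d2: "d2 > 0" "\<And>y. dist y x < d2 \<Longrightarrow> dist (dd b (dd a u) y) (dd b (dd a u) x) < e"
    using cont(2) e unfolding continuous_at_eps_delta by blast
  obtain d3 where d3: "d3 > 0" "ball x d3 \<subseteq> S" using assms by (meson openE)
  define d where "d = min d1 (min d2 d3)"
  \<comment> \<open>The parallelogram with sides \<open>t *\<^sub>R a\<close> and
    \<open>t *\<^sub>R b\<close> stays within \<open>d / 2\<close> of \<open>x\<close>; the summand
    1 keeps the denominator positive when both directions vanish.\<close>
  define t where "t = d / (2 * (norm a + norm b + 1))"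
  have dpos: "d > 0" using d1 d2 d3 by (auto simp: d_def)
  have t: "t > 0" unfolding t_def using dpos by (intro divide_pos_pos) (auto simp: add_nonneg_pos)
  have near: "dist (x + p *\<^sub>R a + q *\<^sub>R b) x < d" if "\<bar>p\<bar> \<le> t" "\<bar>q\<bar> \<le> t" for p q
  proof -
    have "dist (x + p *\<^sub>R a + q *\<^sub>R b) x = norm (p *\<^sub>R a + q *\<^sub>R b)" by (simp add: dist_norm)
    also have "\<dots> \<le> \<bar>p\<bar> * norm a + \<bar>q\<bar> * norm b" by (metis norm_scaleR norm_triangle_ineq)
    also have "\<dots> \<le> t * norm a + t * norm b" using that by (intro add_mono mult_right_mono) auto
    also have "\<dots> \<le> t * (norm a + norm b + 1)" using t by (simp add: algebra_simps)
    also have "\<dots> = d / 2" unfolding t_def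
      by (simp add: field_simps add_nonneg_eq_0_iff)
    finally show ?thesis using dpos by simp
  qed
  have S: "x + p *\<^sub>R a + q *\<^sub>R b \<in> S" if "\<bar>p\<bar> \<le> t" "\<bar>q\<bar> \<le> t" for p q
    using near[OF that] d3 by (auto simp: d_def mem_ball dist_commute subset_iff)
  obtain p q where pq: "0 < p" "p < t" "0 < q" "q < t"
    "u (x + t *\<^sub>R a + t *\<^sub>R b) - u (x + t *\<^sub>R a) - u (x + t *\<^sub>R b) + u x
      = t^2 * dd b (dd a u) (x + p *\<^sub>R a + q *\<^sub>R b)"
    using second_difference_mvt[OF assms(2) t, of x a b] S by blast
  have S': "x + p *\<^sub>R b + q *\<^sub>R a \<in> S" if "\<bar>p\<bar> \<le> t" "\<bar>q\<bar> \<le> t" for p q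
    using S[OF that(2,1)] by (simp add: add_ac)
  obtain p' q' where pq': "0 < p'" "p' < t" "0 < q'" "q' < t"
    "u (x + t *\<^sub>R b + t *\<^sub>R a) - u (x + t *\<^sub>R b) - u (x + t *\<^sub>R a) + u x
      = t^2 * dd a (dd b u) (x + p' *\<^sub>R b + q' *\<^sub>R a)"
    using second_difference_mvt[OF assms(2) t, of x b a] S' by blast
  have eq: "dd a (dd b u) (x + p' *\<^sub>R b + q' *\<^sub>R a) = dd b (dd a u) (x + p *\<^sub>R a + q *\<^sub>R b)"
  proof -
    have "u (x + t *\<^sub>R b + t *\<^sub>R a) = u (x + t *\<^sub>R a + t *\<^sub>R b)" by (simp add: add_ac)
    then have "t^2 * dd a (dd b u) (x + p' *\<^sub>R b + q' *\<^sub>R a) = t^2 * dd b (dd a u) (x + p *\<^sub>R a + q *\<^sub>R b)"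
      using pq(5) pq'(5) by linarith
    then show ?thesis using t by simp
  qed
  have "dist (dd a (dd b u) (x + p' *\<^sub>R b + q' *\<^sub>R a)) (dd a (dd b u) x) < e"
    using near[of q' p'] pq' by (intro d1) (auto simp: d_def add_ac)
  moreover have "dist (dd b (dd a u) (x + p *\<^sub>R a + q *\<^sub>R b)) (dd b (dd a u) x) < e"
    using near[of p q] pq by (intro d2) (auto simp: d_def)
  ultimately show False unfolding eq using dist_triangle2[of "dd a (dd b u) x" "dd b (dd a u) x"
      "dd b (dd a u) (x + p *\<^sub>R a + q *\<^sub>R b)"] by (simp add: e_def dist_real_def abs_minus_commute)
qed

text \<open>A positive \<open>c\<close> would make \<open>P'\<close> positive just to the right of
  0, so that \<open>P\<close> would exceed \<open>P 0\<close> there.\<close>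

lemma second_derivative_test:
  fixes P P' :: "real \<Rightarrow> real"
  assumes "0 < d" and P: "\<And>s. \<bar>s\<bar> < d \<Longrightarrow> (P has_real_derivative P' s) (at s)"
    and P'': "(P' has_real_derivative c) (at 0)"
    and max: "\<And>s. \<bar>s\<bar> < d \<Longrightarrow> P s \<le> P 0"
  shows "P' 0 = 0" "c \<le> 0"
proof -
  show z: "P' 0 = 0"
    using DERIV_local_max[OF P[of 0] assms(1)] assms(1) max by auto
  show "c \<le> 0"
  proof (rule ccontr)
    assume "\<not> c \<le> 0"
    then obtain e where e: "e > 0" "\<And>h. 0 < h \<Longrightarrow> h < e \<Longrightarrow> P' 0 < P' (0 + h)"
      using DERIV_pos_inc_right[OF P''] by auto
    define h where "h = min e d / 2"
    have h: "0 < h" "h < e" "h < d" using e assms(1) by (auto simp: h_def min_def)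
    have "\<exists>z. 0 < z \<and> z < h \<and> P h - P 0 = (h - 0) * P' z"
      by (rule MVT2[OF h(1)]) (use h in \<open>auto intro: P\<close>)
    then obtain z where "0 < z" "z < h" "P h - P 0 = h * P' z" by auto
    moreover from this have "P' z > 0" using e(2)[of z] h z by auto
    ultimately have "P h - P 0 > 0" using h by simp
    then show False using max[of h] h by auto
  qed
qed

text \<open>Compactness bounds each of the finitely many basis directions, and linearity in the
  direction gives one constant for all vectors.\<close>

lemma smooth_on_dd_bound:
  fixes u :: "'a::euclidean_space \<Rightarrow> 'b::real_normed_vector"
  assumes "smooth_on u S" "compact K" "K \<subseteq> S"
  shows "\<exists>C\<ge>0. \<forall>y\<in>K. \<forall>a. norm (dd a u y) \<le> C * norm a"
proof -
  have "\<exists>B. \<forall>y\<in>K. norm (dd b u y) \<le> B" for b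
  proof -
    have "compact (dd b u ` K)"
      using smooth_on_imp_continuous_on[OF smooth_on_dd[OF assms(1)]] assms(2,3)
      by (meson compact_continuous_image continuous_on_subset)
    then show ?thesis using compact_imp_bounded by (fastforce simp: bounded_iff)
  qed
  then obtain B where B: "\<And>b y. y \<in> K \<Longrightarrow> norm (dd b u y) \<le> B b" by metis
  show ?thesis
  proof (intro exI[of _ "\<Sum>b\<in>Basis. \<bar>B b\<bar>"] conjI ballI allI)
    show "0 \<le> (\<Sum>b\<in>(Basis::'a set). \<bar>B b\<bar>)" by (simp add: sum_nonneg)
    fix y and a :: 'a assume y: "y \<in> K"
    have du: "u differentiable (at y)" using smooth_on_imp_differentiable[OF assms(1)] y assms(3) by auto
    have "dd a u y = dd (\<Sum>b\<in>Basis. (a \<bullet> b) *\<^sub>R b) u y" by (simp add: euclidean_representation)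
    also have "\<dots> = (\<Sum>b\<in>Basis. (a \<bullet> b) *\<^sub>R dd b u y)" by (simp add: dd_sum_dir du dd_scaleR_dir)
    also have "norm \<dots> \<le> (\<Sum>b\<in>Basis. norm a * \<bar>B b\<bar>)"
    proof (rule sum_norm_le)
      fix b :: 'a assume b: "b \<in> Basis"
      have "norm (dd b u y) \<le> \<bar>B b\<bar>" using B[OF y, of b] by linarith
      then show "norm ((a \<bullet> b) *\<^sub>R dd b u y) \<le> norm a * \<bar>B b\<bar>"
        using Basis_le_norm[OF b, of a] by (auto intro!: mult_mono)
    qed
    finally show "norm (dd a u y) \<le> (\<Sum>b\<in>Basis. \<bar>B b\<bar>) * norm a"
      by (simp add: sum_distrib_left mult.commute)
  qed
qed

lemma dd_dd_sum_dir:
  assumes "open S" "smooth_on u S" "x \<in> S"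
  shows "dd a (dd (\<Sum>i\<in>I. r i *\<^sub>R b i) u) x = (\<Sum>i\<in>I. r i *\<^sub>R dd a (dd (b i) u) x)"
proof -
  have "dd a (dd (\<Sum>i\<in>I. r i *\<^sub>R b i) u) x = dd a (\<lambda>y. \<Sum>i\<in>I. r i *\<^sub>R dd (b i) u y) x"
    by (rule dd_cong[OF assms(1,3)])
      (simp add: dd_sum_dir dd_scaleR_dir smooth_on_imp_differentiable[OF assms(2)])
  also have "\<dots> = (\<Sum>i\<in>I. dd a (\<lambda>y. r i *\<^sub>R dd (b i) u y) x)"
    using smooth_on_imp_differentiable[OF smooth_on_dd[OF assms(2)] assms(3)]
    by (intro dd_sum) auto
  also have "\<dots> = (\<Sum>i\<in>I. r i *\<^sub>R dd a (dd (b i) u) x)"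
    using smooth_on_imp_differentiable[OF smooth_on_dd[OF assms(2)] assms(3)]
    by (intro sum.cong refl dd_bounded_linear bounded_linear_scaleR_right)
  finally show ?thesis .
qed

lemma smooth_on_dd_dd_bound:
  fixes u :: "'a::euclidean_space \<Rightarrow> 'b::real_normed_vector"
  assumes "open S" "smooth_on u S" "compact K" "K \<subseteq> S"
  shows "\<exists>C\<ge>0. \<forall>y\<in>K. \<forall>a b. norm (dd a (dd b u) y) \<le> C * norm a * norm b"
proof -
  have "\<forall>b. \<exists>C\<ge>0. \<forall>y\<in>K. \<forall>a. norm (dd a (dd b u) y) \<le> C * norm a"
    using smooth_on_dd_bound[OF smooth_on_dd[OF assms(2)] assms(3,4)] by blast
  then obtain B where B: "\<And>b. B b \<ge> 0" "\<And>b y a. y \<in> K \<Longrightarrow> norm (dd a (dd b u) y) \<le> B b * norm a" by metis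
  show ?thesis
  proof (intro exI[of _ "\<Sum>b\<in>Basis. B b"] conjI ballI allI)
    show "0 \<le> (\<Sum>b\<in>(Basis::'a set). B b)" by (simp add: sum_nonneg B)
    fix y and a c :: 'a assume y: "y \<in> K"
    have "dd a (dd c u) y = dd a (dd (\<Sum>b\<in>Basis. (c \<bullet> b) *\<^sub>R b) u) y" by (simp add: euclidean_representation)
    also have "\<dots> = (\<Sum>b\<in>Basis. (c \<bullet> b) *\<^sub>R dd a (dd b u) y)"
      by (rule dd_dd_sum_dir[OF assms(1,2)]) (use y assms(4) in auto)
    also have "norm \<dots> \<le> (\<Sum>b\<in>Basis. norm c * (B b * norm a))"
    proof (rule sum_norm_le)
      fix b :: 'a assume b: "b \<in> Basis"
      show "norm ((c \<bullet> b) *\<^sub>R dd a (dd b u) y) \<le> norm c * (B b * norm a)"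
        using Basis_le_norm[OF b, of c] B(2)[OF y] by (auto intro!: mult_mono)
    qed
    finally show "norm (dd a (dd c u) y) \<le> (\<Sum>b\<in>Basis. B b) * norm a * norm c"
      by (simp add: sum_distrib_left sum_distrib_right mult_ac)
  qed
qed

section \<open>Hermitian forms and orthonormal frames\<close>

definition sesq :: "complex^'n^'n::finite \<Rightarrow> complex^'n \<Rightarrow> complex^'n \<Rightarrow> complex" where
  "sesq h V U = (\<Sum>i\<in>UNIV. \<Sum>j\<in>UNIV. h $ i $ j * V $ i * cnj (U $ j))"

lemma sesq_add_left: "sesq h (V + W) U = sesq h V U + sesq h W U"
  by (simp add: sesq_def algebra_simps sum.distrib)

lemma sesq_add_right: "sesq h U (V + W) = sesq h U V + sesq h U W"
  by (simp add: sesq_def algebra_simps sum.distrib)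

lemma sesq_scale_left: "sesq h (c *s V) U = c * sesq h V U"
  by (simp add: sesq_def sum_distrib_left mult_ac)

lemma sesq_scale_right: "sesq h V (c *s U) = cnj c * sesq h V U"
  by (simp add: sesq_def sum_distrib_left mult_ac)

lemma scaleR_eq_smult: "r *\<^sub>R (V::complex^'n) = of_real r *s V"
  unfolding vec_eq_iff vector_scaleR_component vector_smult_component by (simp add: scaleR_conv_of_real)

lemma sesq_scaleR_left: "sesq h (r *\<^sub>R V) U = of_real r * sesq h V U"
  by (simp add: scaleR_eq_smult sesq_scale_left)

lemma sesq_scaleR_right: "sesq h V (r *\<^sub>R U) = of_real r * sesq h V U"
  by (simp add: scaleR_eq_smult sesq_scale_right)

lemma Re_sesq_scaleR: "Re (sesq h (r *\<^sub>R V) (r *\<^sub>R V)) = r\<^sup>2 * Re (sesq h V V)"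
proof -
  have "sesq h (r *\<^sub>R V) (r *\<^sub>R V) = of_real (r\<^sup>2) * sesq h V V"
    by (simp add: sesq_scaleR_left sesq_scaleR_right power2_eq_square)
  then show ?thesis by (simp del: of_real_power)
qed

lemma sesq_zero_left [simp]: "sesq h 0 U = 0"
  by (simp add: sesq_def)

lemma sesq_zero_right [simp]: "sesq h V 0 = 0"
  by (simp add: sesq_def)

lemma sesq_minus_left: "sesq h (- V) U = - sesq h V U"
  by (simp add: sesq_def sum_negf)

lemma sesq_minus_right: "sesq h U (- V) = - sesq h U V"
  by (simp add: sesq_def sum_negf)

lemma sesq_diff_left: "sesq h (V - W) U = sesq h V U - sesq h W U"
  using sesq_add_left[of h V "-W" U] by (simp add: sesq_minus_left)

lemma sesq_diff_right: "sesq h U (V - W) = sesq h U V - sesq h U W"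
  using sesq_add_right[of h U V "-W"] by (simp add: sesq_minus_right)

lemma sesq_sum_left: "sesq h (\<Sum>i\<in>I. V i) U = (\<Sum>i\<in>I. sesq h (V i) U)"
  by (induction I rule: infinite_finite_induct) (auto simp: sesq_add_left)

lemma sesq_sum_right: "sesq h U (\<Sum>i\<in>I. V i) = (\<Sum>i\<in>I. sesq h U (V i))"
  by (induction I rule: infinite_finite_induct) (auto simp: sesq_add_right)

lemma sesq_matrix_diff: "sesq (g - h) V U = sesq g V U - sesq h V U"
  by (simp add: sesq_def algebra_simps sum_subtractf)

lemma sesq_matrix_scaleR: "sesq (r *\<^sub>R g) V U = of_real r * sesq g V U"
  unfolding sesq_def sum_distrib_left vector_scaleR_component
  by (simp add: scaleR_conv_of_real mult_ac)

lemma sesq_hermitian: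
  assumes "hermitian_matrix h"
  shows "sesq h U V = cnj (sesq h V U)"
proof -
  have "cnj (sesq h V U) = (\<Sum>i\<in>UNIV. \<Sum>j\<in>UNIV. cnj (h $ i $ j) * cnj (V $ i) * U $ j)"
    by (simp add: sesq_def)
  also have "\<dots> = (\<Sum>j\<in>UNIV. \<Sum>i\<in>UNIV. cnj (h $ i $ j) * cnj (V $ i) * U $ j)"
    by (rule sum.swap)
  also have "\<dots> = sesq h U V" unfolding sesq_def
  proof (intro sum.cong refl)
    fix i j
    have "cnj (h $ j $ i) = h $ i $ j" using assms unfolding hermitian_matrix_def by metis
    then show "cnj (h $ j $ i) * cnj (V $ j) * U $ i = h $ i $ j * U $ i * cnj (V $ j)" by (simp add: mult_ac)
  qed
  finally show ?thesis by simp
qed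

lemma sesq_diag_real: "hermitian_matrix h \<Longrightarrow> sesq h V V = of_real (Re (sesq h V V))"
  using sesq_hermitian[of h V V] by (simp add: complex_eq_iff)

lemma pos_def_sesq: "pos_def h \<longleftrightarrow> hermitian_matrix h \<and> (\<forall>v. v \<noteq> 0 \<longrightarrow> 0 < Re (sesq h v v))"
  by (simp add: pos_def_def sesq_def)

lemma pos_def_nonneg: "pos_def h \<Longrightarrow> 0 \<le> Re (sesq h v v)"
  by (cases "v = 0") (auto simp: pos_def_sesq less_imp_le)

lemma continuous_on_sesq:
  fixes g :: "'a::topological_space \<Rightarrow> complex^'n^'n::finite"
  assumes "\<And>i j. continuous_on S (\<lambda>y. g y $ i $ j)"
  shows "continuous_on (S \<times> T) (\<lambda>(y, V). sesq (g y) V V)"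
  unfolding sesq_def case_prod_beta
  by (intro continuous_intros continuous_on_compose2[OF assms]) auto

text \<open>The minimum over \<open>K\<close> times the unit sphere is positive, and homogeneity
  extends the bound to all vectors. An empty \<open>K\<close> has no minimum and is treated
  apart.\<close>

lemma sesq_lower_bound:
  fixes g :: "'a::topological_space \<Rightarrow> complex^'n^'n::finite"
  assumes "compact K" "\<And>i j. continuous_on K (\<lambda>y. g y $ i $ j)" "\<And>y. y \<in> K \<Longrightarrow> pos_def (g y)"
  shows "\<exists>c>0. \<forall>y\<in>K. \<forall>V. c * norm V ^ 2 \<le> Re (sesq (g y) V V)"
proof (cases "K = {}")
  case False
  define f where "f = (\<lambda>(y, V). Re (sesq (g y) V V))"
  have "continuous_on (K \<times> sphere 0 1) f"
    using continuous_on_Re[OF continuous_on_sesq[OF assms(2), of "sphere 0 1"]] unfolding f_def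
    by (simp add: case_prod_beta)
  moreover have "compact (K \<times> sphere (0::complex^'n) 1)" using assms(1) by (intro compact_Times) auto
  moreover have "axis undefined 1 \<in> sphere (0::complex^'n) 1" by simp
  then have "K \<times> sphere (0::complex^'n) 1 \<noteq> {}" using False by blast
  ultimately obtain q where q: "q \<in> K \<times> sphere 0 1" "\<And>p. p \<in> K \<times> sphere 0 1 \<Longrightarrow> f q \<le> f p"
    using continuous_attains_inf by metis
  have "0 < f q"
  proof -
    obtain a b where ab: "q = (a, b)" "a \<in> K" "norm b = 1" using q(1) by auto
    then have "b \<noteq> 0" by auto
    then show ?thesis using assms(3)[OF ab(2)] by (simp add: ab(1) f_def pos_def_sesq)
  qed
  moreover have "f q * norm V ^ 2 \<le> Re (sesq (g y) V V)" if y: "y \<in> K" for y V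
  proof (cases "V = 0")
    case False
    define U where "U = (1 / norm V) *\<^sub>R V"
    have "norm U = 1" using False by (simp add: U_def)
    then have "f q \<le> Re (sesq (g y) U U)" using q(2)[of "(y, U)"] y by (simp add: f_def)
    moreover have "V = norm V *\<^sub>R U" using False by (simp add: U_def)
    then have "Re (sesq (g y) V V) = norm V ^ 2 * Re (sesq (g y) U U)" by (metis Re_sesq_scaleR)
    ultimately show ?thesis by (simp add: mult.commute[of "f q"] mult_left_mono)
  qed simp
  ultimately show ?thesis by blast
qed (auto intro: exI[of _ 1])

lemma norm_sesq_le:
  fixes h :: "complex^'n^'n::finite"
  shows "norm (sesq h V U) \<le> (\<Sum>i\<in>UNIV. \<Sum>j\<in>UNIV. norm (h $ i $ j)) * norm V * norm U"
proof -
  have "norm (sesq h V U) \<le> (\<Sum>i\<in>UNIV. \<Sum>j\<in>UNIV. norm (h $ i $ j) * norm V * norm U)"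
    unfolding sesq_def
  proof (intro sum_norm_le)
    fix i j
    show "norm (h $ i $ j * V $ i * cnj (U $ j)) \<le> norm (h $ i $ j) * norm V * norm U"
      unfolding norm_mult complex_mod_cnj
      by (intro mult_mono mult_nonneg_nonneg) (auto simp: Finite_Cartesian_Product.norm_nth_le)
  qed
  then show ?thesis by (simp add: sum_distrib_right)
qed

lemma sesq_upper_bound:
  fixes g :: "'a::topological_space \<Rightarrow> complex^'n^'n::finite"
  assumes "compact K" "\<And>i j. continuous_on K (\<lambda>y. g y $ i $ j)"
  shows "\<exists>C>0. \<forall>y\<in>K. \<forall>V U. norm (sesq (g y) V U) \<le> C * norm V * norm U"
proof -
  have "\<exists>B. \<forall>y\<in>K. norm (g y $ i $ j) \<le> B" for i j
    using compact_imp_bounded[OF compact_continuous_image[OF assms(2) assms(1)]]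
    by (fastforce simp: bounded_iff)
  then obtain B where B: "\<And>i j y. y \<in> K \<Longrightarrow> norm (g y $ i $ j) \<le> B i j" by metis
  define C where "C = \<bar>\<Sum>i\<in>UNIV. \<Sum>j\<in>UNIV. B i j\<bar> + 1"
  have "norm (sesq (g y) V U) \<le> C * norm V * norm U" if "y \<in> K" for y V U
  proof -
    have "(\<Sum>i\<in>UNIV. \<Sum>j\<in>UNIV. norm (g y $ i $ j)) \<le> (\<Sum>i\<in>UNIV. \<Sum>j\<in>UNIV. B i j)"
      by (intro sum_mono B that)
    also have "\<dots> \<le> C" by (simp add: C_def)
    finally have "(\<Sum>i\<in>UNIV. \<Sum>j\<in>UNIV. norm (g y $ i $ j)) * norm V * norm U \<le> C * norm V * norm U"
      by (intro mult_right_mono) auto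
    then show ?thesis using norm_sesq_le[of "g y" V U] by linarith
  qed
  moreover have "C > 0" by (simp add: C_def)
  ultimately show ?thesis by blast
qed

text \<open>An orthonormal family indexed by \<open>'n\<close> is automatically a basis of \<open>complex^'n\<close>.\<close>

definition frame :: "complex^'n^'n::finite \<Rightarrow> ('n \<Rightarrow> complex^'n) \<Rightarrow> bool" where
  "frame g e \<longleftrightarrow> (\<forall>k l. sesq g (e k) (e l) = (if k = l then 1 else 0))"

lemma frame_expand:
  fixes g :: "complex^'n^'n::finite"
  assumes e: "frame g e"
  shows "V = (\<Sum>k\<in>UNIV. sesq g V (e k) *s e k)"
proof -
  \<comment> \<open>Pairing with \<open>e l\<close> reads off the coefficient. This gives linear
    independence first and the shape of the expansion at the end.\<close>
  have coeff: "sesq g (\<Sum>k\<in>UNIV. c k *s e k) (e l) = c l" for c l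
  proof -
    have fr: "sesq g (e k) (e l) = (if k = l then 1 else 0)" for k using e by (simp add: frame_def)
    show ?thesis by (simp add: sesq_sum_left sesq_scale_left fr if_distrib cong: if_cong)
  qed
  have inj: "inj e"
  proof (rule injI)
    fix k l assume "e k = e l"
    then have "sesq g (e k) (e l) = sesq g (e l) (e l)" by simp
    then show "k = l" using e by (auto simp: frame_def split: if_splits)
  qed
  have ind: "vec.independent (range e)"
  proof
    assume "vec.dependent (range e)"
    then obtain u where u: "\<exists>v\<in>range e. u v \<noteq> 0" "(\<Sum>v\<in>range e. u v *s v) = 0"
      by (auto simp: vec.dependent_finite)
    then have "(\<Sum>k\<in>UNIV. u (e k) *s e k) = 0" by (simp add: sum.reindex[OF inj])
    then have "u (e l) = 0" for l using coeff[of "\<lambda>k. u (e k)" l] by simp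
    then show False using u(1) by auto
  qed
  have "vec.dim (UNIV :: (complex^'n) set) \<le> card (range e)"
    using vec.dim_subset_UNIV[of "UNIV :: (complex^'n) set"] by (simp add: card_image[OF inj] vec.dimension_def card_cart_basis)
  then have "V \<in> vec.span (range e)"
    using vec.card_ge_dim_independent[of "range e" UNIV] ind by auto
  then obtain u where "V = (\<Sum>v\<in>range e. u v *s v)" by (auto simp: vec.span_finite)
  then have V: "V = (\<Sum>k\<in>UNIV. u (e k) *s e k)" by (simp add: sum.reindex[OF inj])
  show ?thesis using coeff[of "\<lambda>k. u (e k)"] V by simp
qed

lemma frame_parseval:
  assumes "frame g e" "hermitian_matrix g"
  shows "sesq g V W = (\<Sum>k\<in>UNIV. sesq g V (e k) * cnj (sesq g W (e k)))"
proof -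
  have "sesq g V W = sesq g (\<Sum>k\<in>UNIV. sesq g V (e k) *s e k) W" using frame_expand[OF assms(1)] by metis
  also have "\<dots> = (\<Sum>k\<in>UNIV. sesq g V (e k) * sesq g (e k) W)" by (simp add: sesq_sum_left sesq_scale_left)
  also have "\<dots> = (\<Sum>k\<in>UNIV. sesq g V (e k) * cnj (sesq g W (e k)))"
  proof (intro sum.cong refl)
    fix k show "sesq g V (e k) * sesq g (e k) W = sesq g V (e k) * cnj (sesq g W (e k))"
      by (subst sesq_hermitian[OF assms(2), of "e k" W]) (rule refl)
  qed
  finally show ?thesis .
qed

text \<open>Fewer than \<open>CARD('n)\<close> vectors leave some \<open>v\<close> outside their
  span, and subtracting its projection onto the span cannot make it zero.\<close>

lemma exists_orthogonal_vector:
  fixes g :: "complex^'n^'n::finite"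
  assumes "m < CARD('n)"
    and orth: "\<And>i j. i < m \<Longrightarrow> j < m \<Longrightarrow> sesq g (e i) (e j) = (if i = j then 1 else 0)"
  shows "\<exists>x. x \<noteq> 0 \<and> (\<forall>i<m. sesq g x (e i) = 0)"
proof -
  have "vec.dim (e ` {..<m}) \<le> m"
    using vec.dim_le_card'[of "e ` {..<m}"] card_image_le[of "{..<m}" e] by auto
  then have "vec.dim (vec.span (e ` {..<m})) < vec.dim (UNIV :: (complex^'n) set)"
    using assms(1) by (simp add: vec.dim_span vec.dim_UNIV vec.dimension_def card_cart_basis)
  then have "vec.span (e ` {..<m}) \<noteq> UNIV" by (auto simp del: vec.dim_span)
  then obtain v where v: "v \<notin> vec.span (e ` {..<m})" by auto
  define x where "x = v - (\<Sum>i<m. sesq g v (e i) *s e i)"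
  have "(\<Sum>i<m. sesq g v (e i) *s e i) \<in> vec.span (e ` {..<m})"
    by (intro vec.span_sum vec.span_scale vec.span_base) auto
  then have "x \<noteq> 0" using v unfolding x_def by auto
  moreover have "sesq g x (e j) = 0" if "j < m" for j
    using that unfolding x_def
    by (simp add: sesq_diff_left sesq_sum_left sesq_scale_left orth if_distrib cong: if_cong)
  ultimately show ?thesis by blast
qed

text \<open>The next vector of the basis maximizes the Rayleigh quotient on the orthogonal complement;
  the first-order condition at the maximum makes the complement invariant.\<close>

lemma simultaneous_diagonalization_aux:
  fixes g h :: "complex^'n^'n::finite"
  assumes g: "pos_def g" and h: "hermitian_matrix h" and "m \<le> CARD('n)"
  shows "\<exists>e. (\<forall>i<m. \<forall>j<m. sesq g (e i) (e j) = (if i = j then 1 else 0)) \<and>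
     (\<forall>x. (\<forall>i<m. sesq g x (e i) = 0) \<longrightarrow> (\<forall>i<m. sesq h x (e i) = 0)) \<and>
     (\<forall>i<m. \<forall>j<m. i \<noteq> j \<longrightarrow> sesq h (e i) (e j) = 0)"
  using assms(3)
proof (induction m)
  case (Suc m)
  have "m \<le> CARD('n)" using Suc.prems by simp
  from Suc.IH[OF this] obtain e where e0:
    "(\<forall>i<m. \<forall>j<m. sesq g (e i) (e j) = (if i = j then 1 else 0)) \<and>
     (\<forall>x. (\<forall>i<m. sesq g x (e i) = 0) \<longrightarrow> (\<forall>i<m. sesq h x (e i) = 0)) \<and>
     (\<forall>i<m. \<forall>j<m. i \<noteq> j \<longrightarrow> sesq h (e i) (e j) = 0)"
    by (rule exE)
  note e = e0[THEN conjunct1] e0[THEN conjunct2, THEN conjunct1] e0[THEN conjunct2, THEN conjunct2]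
  have orth: "sesq g (e i) (e j) = (if i = j then 1 else 0)" if "i < m" "j < m" for i j
    using e(1) that by blast
  have inv: "\<forall>i<m. sesq h x (e i) = 0" if "\<forall>i<m. sesq g x (e i) = 0" for x
    using e(2) that by blast
  have hd: "sesq h (e i) (e j) = 0" if "i < m" "j < m" "i \<noteq> j" for i j
    using e(3) that by blast
  have gh: "hermitian_matrix g" using g by (simp add: pos_def_def)
  \<comment> \<open>The unit sphere, measured by \<open>g\<close>, in the orthogonal complement of
    the vectors found so far.\<close>
  define M where "M = {x. Re (sesq g x x) = 1 \<and> (\<forall>i<m. sesq g x (e i) = 0)}"
  obtain x0 where x0: "x0 \<noteq> 0" "\<forall>i<m. sesq g x0 (e i) = 0"
    using exists_orthogonal_vector[OF _ orth, of m] Suc.prems by (meson Suc_le_lessD)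
  have norm1: "(1 / sqrt (Re (sesq g x x))) *\<^sub>R x \<in> M" if "x \<noteq> 0" "\<forall>i<m. sesq g x (e i) = 0" for x
  proof -
    have "Re (sesq g x x) > 0" using that g by (simp add: pos_def_sesq)
    then have "(1 / sqrt (Re (sesq g x x)))\<^sup>2 * Re (sesq g x x) = 1" by (simp add: power_divide)
    then show ?thesis unfolding M_def mem_Collect_eq Re_sesq_scaleR using that(2)
      by (simp only: sesq_scaleR_left) simp
  qed
  have "M \<noteq> {}" using norm1[OF x0] by auto
  have cs: "continuous_on UNIV (\<lambda>x. sesq A x u)" "continuous_on UNIV (\<lambda>x. sesq A x x)" for A u
    unfolding sesq_def by (intro continuous_intros)+
  have "compact M"
  proof -
    obtain c where c: "c > 0" "\<And>V. c * norm V ^ 2 \<le> Re (sesq g V V)"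
      using sesq_lower_bound[of "{0::real}" "\<lambda>_. g"] g by (auto simp: continuous_on_const)
    have "norm x \<le> sqrt (1 / c)" if "x \<in> M" for x
      using c(2)[of x] that c(1) by (intro real_le_rsqrt) (simp add: M_def field_simps)
    then have "bounded M" by (auto simp: bounded_iff)
    moreover have "M = {x. Re (sesq g x x) = 1} \<inter> (\<Inter>i\<in>{..<m}. {x. sesq g x (e i) = 0})"
      by (auto simp: M_def)
    moreover have "closed {x. Re (sesq g x x) = 1}"
      by (intro closed_Collect_eq continuous_on_Re cs continuous_on_const)
    moreover have "closed {x. sesq g x (e i) = 0}" for i
      by (intro closed_Collect_eq cs continuous_on_const)
    ultimately have "closed M" by auto
    then show ?thesis using \<open>bounded M\<close> by (simp add: compact_eq_bounded_closed)
  qed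
  moreover have "continuous_on M (\<lambda>x. Re (sesq h x x))"
    using continuous_on_subset[OF continuous_on_Re[OF cs(2)]] by auto
  ultimately have "\<exists>x\<in>M. \<forall>y\<in>M. Re (sesq h y y) \<le> Re (sesq h x x)"
    using \<open>M \<noteq> {}\<close> by (intro continuous_attains_sup)
  then obtain x where x: "x \<in> M" "\<And>y. y \<in> M \<Longrightarrow> Re (sesq h y y) \<le> Re (sesq h x x)" by auto
  define L where "L = Re (sesq h x x)"
  have gxx: "sesq g x x = 1" using x(1) sesq_diag_real[OF gh, of x] by (simp add: M_def)
  have gx: "\<And>i. i < m \<Longrightarrow> sesq g x (e i) = 0" using x(1) by (simp add: M_def)
  have rayleigh: "Re (sesq h y y) \<le> L * Re (sesq g y y)" if y: "\<forall>i<m. sesq g y (e i) = 0" for y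
  proof (cases "y = 0")
    case False
    then have p: "Re (sesq g y y) > 0" using g by (simp add: pos_def_sesq)
    define r where "r = 1 / sqrt (Re (sesq g y y))"
    have "Re (sesq h (r *\<^sub>R y) (r *\<^sub>R y)) \<le> L"
      using x(2)[OF norm1[OF False y]] by (simp add: L_def r_def)
    moreover have "Re (sesq h (r *\<^sub>R y) (r *\<^sub>R y)) = r * r * Re (sesq h y y)"
      by (simp add: Re_sesq_scaleR power2_eq_square)
    moreover have "r * r = 1 / Re (sesq g y y)" using p unfolding r_def by (simp only: times_divide_times_eq real_sqrt_mult_self mult_1)
    ultimately show ?thesis using p by (simp add: field_simps)
  qed simp
  have crit: "sesq h y x = 0" if y: "\<forall>i<m. sesq g y (e i) = 0" "sesq g y x = 0" for y
  proof (rule ccontr)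
    assume nz: "sesq h y x \<noteq> 0"
    \<comment> \<open>The factor makes \<open>sesq h y' x\<close> real and positive, so moving from
      \<open>x\<close> along \<open>y'\<close> raises the Rayleigh quotient to first order.\<close>
    define y' where "y' = cnj (sesq h y x) *s y"
    define q where "q = (norm (sesq h y x))^2"
    have q: "q > 0" using nz by (simp add: q_def)
    have hyx: "sesq h y' x = of_real q"
      unfolding y'_def sesq_scale_left q_def by (metis complex_norm_square mult.commute)
    have gyx: "sesq g y' x = 0" "sesq g x y' = 0" "\<forall>i<m. sesq g y' (e i) = 0"
      using y sesq_hermitian[OF gh, of x y] by (auto simp: y'_def sesq_scale_left sesq_scale_right)
    have hxy: "sesq h x y' = of_real q" using sesq_hermitian[OF h, of x y'] hyx by simp
    define K where "K = L * Re (sesq g y' y') - Re (sesq h y' y')"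
    have ineq: "2 * t * q \<le> t^2 * K" for t :: real
    proof -
      have "Re (sesq h (x + t *\<^sub>R y') (x + t *\<^sub>R y')) \<le> L * Re (sesq g (x + t *\<^sub>R y') (x + t *\<^sub>R y'))"
        using gx gyx by (intro rayleigh) (simp add: sesq_add_left sesq_scaleR_left)
      then have "L + 2 * t * q + t^2 * Re (sesq h y' y') \<le> L * (1 + t^2 * Re (sesq g y' y'))"
        by (simp add: sesq_add_left sesq_add_right sesq_scaleR_left sesq_scaleR_right hyx hxy gyx gxx
            L_def power2_eq_square algebra_simps)
      then show ?thesis by (simp add: K_def algebra_simps)
    qed
    \<comment> \<open>Small enough that \<open>t * K \<le> q\<close>, whereas maximality demands
      \<open>2 * q \<le> t * K\<close>.\<close>
    define t where "t = q / (\<bar>K\<bar> + 1)"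
    have t: "t > 0" using q by (simp add: t_def)
    have "2 * q \<le> t * K" using ineq[of t] t by (simp add: power2_eq_square)
    also have "\<dots> \<le> t * (\<bar>K\<bar> + 1)" using t by (intro mult_left_mono) auto
    also have "\<dots> = q" by (simp add: t_def)
    finally show False using q by simp
  qed
  define e' where "e' = e(m := x)"
  have hx: "\<And>i. i < m \<Longrightarrow> sesq h x (e i) = 0" using inv[of x] gx by blast
  have sw: "sesq g (e i) x = 0" "sesq h (e i) x = 0" if "i < m" for i
    using sesq_hermitian[OF gh, of "e i" x] sesq_hermitian[OF h, of "e i" x] gx hx that by auto
  show ?case
  proof (intro exI[of _ e'] conjI)
    show "\<forall>i<Suc m. \<forall>j<Suc m. sesq g (e' i) (e' j) = (if i = j then 1 else 0)"
      using orth gxx gx sw by (auto simp: e'_def less_Suc_eq)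
    show "\<forall>y. (\<forall>i<Suc m. sesq g y (e' i) = 0) \<longrightarrow> (\<forall>i<Suc m. sesq h y (e' i) = 0)"
    proof (intro allI impI)
      fix y i assume a: "\<forall>i<Suc m. sesq g y (e' i) = 0" and i: "i < Suc m"
      have b1: "\<forall>j<m. sesq g y (e j) = 0"
      proof (intro allI impI)
        fix j assume "j < m"
        then show "sesq g y (e j) = 0" using a[rule_format, of j] by (simp add: e'_def)
      qed
      have b2: "sesq g y x = 0" using a[rule_format, of m] by (simp add: e'_def)
      show "sesq h y (e' i) = 0"
      proof (cases "i = m")
        case True
        then show ?thesis using crit[OF b1 b2] by (simp add: e'_def)
      next
        case False
        then show ?thesis using inv[OF b1] i by (simp add: e'_def)
      qed
    qed
    show "\<forall>i<Suc m. \<forall>j<Suc m. i \<noteq> j \<longrightarrow> sesq h (e' i) (e' j) = 0"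
      using hd hx sw by (auto simp: e'_def less_Suc_eq)
  qed
qed auto

text \<open>The eigenvalues of \<open>h\<close> relative to \<open>g\<close> are written
  \<open>1 / \<mu> k\<close> because Donaldson's equation prescribes the sum of their
  reciprocals.\<close>

lemma simultaneous_diagonalization:
  fixes g h :: "complex^'n^'n::finite"
  assumes "pos_def g" "pos_def h"
  obtains e \<mu> where "frame g e" "\<And>k. 0 < \<mu> k"
    "\<And>k l. sesq h (e k) (e l) = (if k = l then of_real (1 / \<mu> k) else 0)"
proof -
  have hh: "hermitian_matrix h" using assms(2) by (simp add: pos_def_def)
  obtain e where e0:
    "(\<forall>i<CARD('n). \<forall>j<CARD('n). sesq g (e i) (e j) = (if i = j then 1 else 0)) \<and>
     (\<forall>x. (\<forall>i<CARD('n). sesq g x (e i) = 0) \<longrightarrow> (\<forall>i<CARD('n). sesq h x (e i) = 0)) \<and>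
     (\<forall>i<CARD('n). \<forall>j<CARD('n). i \<noteq> j \<longrightarrow> sesq h (e i) (e j) = 0)"
    by (rule exE[OF simultaneous_diagonalization_aux[OF assms(1) hh order.refl]])
  note e = e0[THEN conjunct1, rule_format] e0[THEN conjunct2, THEN conjunct2, rule_format]
  obtain f :: "'n \<Rightarrow> nat" where f: "bij_betw f UNIV {..<CARD('n)}"
    using ex_bij_betw_finite_nat[of "UNIV :: 'n set"] by (auto simp: atLeast0LessThan)
  have f': "f k < CARD('n)" "f k = f l \<longleftrightarrow> k = l" for k l
    using f by (auto simp: bij_betw_def inj_eq image_subset_iff)
  define \<epsilon> where "\<epsilon> k = e (f k)" for k
  have fr: "frame g \<epsilon>" using e(1) f' by (simp add: frame_def \<epsilon>_def)
  have nz: "\<epsilon> k \<noteq> 0" for k using fr by (metis frame_def sesq_zero_left zero_neq_one)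
  define \<mu> where "\<mu> k = 1 / Re (sesq h (\<epsilon> k) (\<epsilon> k))" for k
  have "0 < \<mu> k" for k using nz assms(2) by (simp add: \<mu>_def pos_def_sesq)
  moreover have "sesq h (\<epsilon> k) (\<epsilon> l) = (if k = l then of_real (1 / \<mu> k) else 0)" for k l
    using e(2) f' sesq_diag_real[OF hh, of "\<epsilon> k"] by (auto simp: \<epsilon>_def \<mu>_def)
  ultimately show ?thesis using that fr by blast
qed

section \<open>The trace form of Donaldson's equation\<close>

definition perm_shift :: "(nat \<Rightarrow> nat) \<Rightarrow> nat \<Rightarrow> nat" where
  "perm_shift \<tau> x = (if x < 2 then x else \<tau> (x - 2) + 2)"

lemma perm_shift_transpose_comp:
  "perm_shift (Transposition.transpose a b \<circ> p) = Transposition.transpose (a + 2) (b + 2) \<circ> perm_shift p"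
  by (rule ext) (auto simp: perm_shift_def Transposition.transpose_def)

text \<open>Letting \<open>\<tau>\<close> act from index 2 onwards embeds one symmetric group in a
  larger one; the sign is followed along a factorization into transpositions.\<close>

lemma perm_shift:
  assumes "\<tau> permutes {..<k}"
  shows "perm_shift \<tau> permutes {..<2+k}" "sign (perm_shift \<tau>) = sign \<tau>"
proof -
  from assms finite_lessThan have "perm_shift \<tau> permutes {..<2+k} \<and> sign (perm_shift \<tau>) = sign \<tau>"
  proof (induction rule: permutes_induct)
    case id
    have "perm_shift id = id" by (rule ext) (auto simp: perm_shift_def)
    then show ?case by (simp only: permutes_id sign_id simp_thms)
  next
    case (swap a b p)
    have "permutation (perm_shift p)" using swap.IH by (auto simp: permutation_permutes)
    moreover have "permutation p" using swap.hyps by (auto simp: permutation_permutes)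
    ultimately have "sign (perm_shift (Transposition.transpose a b \<circ> p)) = sign (Transposition.transpose a b \<circ> p)"
      unfolding perm_shift_transpose_comp using swap
      by (simp only: sign_compose permutation_swap_id sign_swap_id) simp
    moreover have "Transposition.transpose (a + 2) (b + 2) permutes {..<2+k}"
      using swap.hyps by (intro permutes_swap_id) auto
    then have "perm_shift (Transposition.transpose a b \<circ> p) permutes {..<2+k}"
      unfolding perm_shift_transpose_comp by (rule permutes_compose[OF swap.IH[THEN conjunct1]])
    ultimately show ?case by blast
  qed
  then show "perm_shift \<tau> permutes {..<2+k}" "sign (perm_shift \<tau>) = sign \<tau>" by auto
qed

text \<open>Up to the factor \<open>2 ^ m\<close> this is the wedge product of the two-forms
  \<open>\<beta> i\<close>: the unnormalized antisymmetrization of their tensor product.\<close>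

definition alt_prod :: "nat \<Rightarrow> (nat \<Rightarrow> 'v \<Rightarrow> 'v \<Rightarrow> complex) \<Rightarrow> (nat \<Rightarrow> 'v) \<Rightarrow> complex" where
  "alt_prod m \<beta> v = (\<Sum>\<sigma> | \<sigma> permutes {..<2*m}.
     of_int (sign \<sigma>) * (\<Prod>i<m. \<beta> i (v (\<sigma> (2*i))) (v (\<sigma> (2*i+1)))))"

text \<open>Substituting \<open>\<sigma> \<circ> perm_shift \<tau>\<close> shows that every
  \<open>\<tau>\<close> of the inner sum contributes the same outer sum. There are
  \<open>fact (2 * m)\<close> of them, which cancels this factor in the normalization of
  \<open>wedge\<close>.\<close>

lemma wedge_alt_prod:
  "wedge 2 (2*m) (\<lambda>v. a (v 0) (v 1)) (\<lambda>w. alt_prod m \<beta> w / 2^m) v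
     = alt_prod (Suc m) (case_nat a \<beta>) v / 2^(Suc m)"
proof -
  define t where "t \<sigma> = of_int (sign \<sigma>) * (a (v (\<sigma> 0)) (v (\<sigma> 1)) *
      (\<Prod>i<m. \<beta> i (v (\<sigma> (2 + 2*i))) (v (\<sigma> (2 + (2*i+1))))))" for \<sigma>
  have alt: "alt_prod (Suc m) (case_nat a \<beta>) v = (\<Sum>\<sigma> | \<sigma> permutes {..<2+2*m}. t \<sigma>)"
    unfolding alt_prod_def t_def prod.lessThan_Suc_shift by simp
  have inner: "(\<Sum>\<sigma> | \<sigma> permutes {..<2+2*m}. of_int (sign \<sigma>) * a (v (\<sigma> 0)) (v (\<sigma> 1)) *
      (of_int (sign \<tau>) * (\<Prod>i<m. \<beta> i (v (\<sigma> (2 + \<tau> (2*i)))) (v (\<sigma> (2 + \<tau> (2*i+1)))))))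
      = (\<Sum>\<sigma> | \<sigma> permutes {..<2+2*m}. t \<sigma>)" if \<tau>: "\<tau> permutes {..<2*m}" for \<tau>
  proof -
    have "(\<Sum>\<sigma> | \<sigma> permutes {..<2+2*m}. t \<sigma>) = (\<Sum>\<sigma> | \<sigma> permutes {..<2+2*m}. t (\<sigma> \<circ> perm_shift \<tau>))"
      by (rule sum_permutations_compose_right[OF perm_shift(1)[OF \<tau>]])
    also have "\<dots> = (\<Sum>\<sigma> | \<sigma> permutes {..<2+2*m}. of_int (sign \<sigma>) * a (v (\<sigma> 0)) (v (\<sigma> 1)) *
      (of_int (sign \<tau>) * (\<Prod>i<m. \<beta> i (v (\<sigma> (2 + \<tau> (2*i)))) (v (\<sigma> (2 + \<tau> (2*i+1)))))))"
    proof (rule sum.cong[OF refl])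
      fix \<sigma> assume "\<sigma> \<in> {\<sigma>. \<sigma> permutes {..<2+2*m}}"
      then have "permutation \<sigma>" by (auto simp: permutation_permutes)
      moreover have "permutation (perm_shift \<tau>)"
        using perm_shift(1)[OF \<tau>] by (auto simp: permutation_permutes)
      ultimately have s: "sign (\<sigma> \<circ> perm_shift \<tau>) = sign \<sigma> * sign \<tau>"
        by (simp add: sign_compose perm_shift(2)[OF \<tau>])
      have p: "perm_shift \<tau> 0 = 0" "perm_shift \<tau> 1 = 1" "perm_shift \<tau> (2 + j) = 2 + \<tau> j" for j
        by (auto simp: perm_shift_def)
      show "t (\<sigma> \<circ> perm_shift \<tau>) = of_int (sign \<sigma>) * a (v (\<sigma> 0)) (v (\<sigma> 1)) *
        (of_int (sign \<tau>) * (\<Prod>i<m. \<beta> i (v (\<sigma> (2 + \<tau> (2*i)))) (v (\<sigma> (2 + \<tau> (2*i+1))))))"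
        unfolding t_def s o_apply p by (simp add: mult_ac)
    qed
    finally show ?thesis ..
  qed
  have "wedge 2 (2*m) (\<lambda>v. a (v 0) (v 1)) (\<lambda>w. alt_prod m \<beta> w / 2^m) v * (2 * fact (2*m)) * 2^m
    = (\<Sum>\<sigma> | \<sigma> permutes {..<2+2*m}. of_int (sign \<sigma>) * a (v (\<sigma> 0)) (v (\<sigma> 1)) * 
        (\<Sum>\<tau> | \<tau> permutes {..<2*m}. of_int (sign \<tau>) *
           (\<Prod>i<m. \<beta> i (v (\<sigma> (2 + \<tau> (2*i)))) (v (\<sigma> (2 + \<tau> (2*i+1)))))))"
  proof -
    have "wedge 2 (2*m) (\<lambda>v. a (v 0) (v 1)) (\<lambda>w. alt_prod m \<beta> w / 2^m) v =
      (\<Sum>\<sigma> | \<sigma> permutes {..<2+2*m}. of_int (sign \<sigma>) * a (v (\<sigma> 0)) (v (\<sigma> 1)) *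
         alt_prod m \<beta> (\<lambda>i. v (\<sigma> (2 + i)))) / 2^m / (fact 2 * fact (2*m))"
      unfolding wedge_def times_divide_eq_right sum_divide_distrib[symmetric] ..
    then show ?thesis unfolding alt_prod_def by (simp add: fact_2)
  qed
  also have "\<dots> = (\<Sum>\<tau> | \<tau> permutes {..<2*m}. \<Sum>\<sigma> | \<sigma> permutes {..<2+2*m}.
      of_int (sign \<sigma>) * a (v (\<sigma> 0)) (v (\<sigma> 1)) * (of_int (sign \<tau>) *
        (\<Prod>i<m. \<beta> i (v (\<sigma> (2 + \<tau> (2*i)))) (v (\<sigma> (2 + \<tau> (2*i+1)))))))"
    unfolding sum_distrib_left by (rule sum.swap)
  also have "\<dots> = (\<Sum>\<tau> | \<tau> permutes {..<2*m}. \<Sum>\<sigma> | \<sigma> permutes {..<2+2*m}. t \<sigma>)"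
    by (rule sum.cong[OF refl]) (rule inner, simp)
  also have "\<dots> = fact (2*m) * alt_prod (Suc m) (case_nat a \<beta>) v"
    by (simp add: alt card_permutations[OF refl])
  finally show ?thesis by (simp add: field_simps)
qed

lemma case_nat_const: "case_nat a (\<lambda>_. a) = (\<lambda>_. a)"
  by (auto split: nat.split)

lemma wedge_power2_alt_prod:
  "wedge_power2 (\<lambda>v. a (v 0) (v 1)) m = (\<lambda>v. alt_prod m (\<lambda>_. a) v / 2^m)"
proof (induction m)
  case 0
  then show ?case by (simp add: alt_prod_def)
next
  case (Suc m)
  show ?case unfolding wedge_power2.simps Suc.IH wedge_alt_prod case_nat_const ..
qed

section \<open>Permutations that respect the pairs 2i, 2i + 1\<close>

definition pair_perm :: "(nat \<Rightarrow> nat) \<Rightarrow> nat \<Rightarrow> nat" where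
  "pair_perm \<kappa> a = 2 * \<kappa> (a div 2) + a mod 2"

lemma pair_perm_transpose_comp:
  "pair_perm (Transposition.transpose i j \<circ> p) =
     Transposition.transpose (2*i) (2*j) \<circ> (Transposition.transpose (2*i+1) (2*j+1) \<circ> pair_perm p)"
proof (rule ext)
  fix a :: nat
  have "a mod 2 = 0 \<or> a mod 2 = 1" by auto
  then show "pair_perm (Transposition.transpose i j \<circ> p) a =
     (Transposition.transpose (2*i) (2*j) \<circ> (Transposition.transpose (2*i+1) (2*j+1) \<circ> pair_perm p)) a"
    by (auto simp: pair_perm_def Transposition.transpose_def)
qed

text \<open>Exchanging two pairs takes two transpositions of entries, so block permutations are
  even.\<close>

lemma pair_perm:
  assumes "\<kappa> permutes {..<n}"
  shows "pair_perm \<kappa> permutes {..<2*n}" "sign (pair_perm \<kappa>) = 1"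
proof -
  from assms finite_lessThan have "pair_perm \<kappa> permutes {..<2*n} \<and> sign (pair_perm \<kappa>) = 1"
  proof (induction rule: permutes_induct)
    case id
    have "pair_perm id = id" by (rule ext) (auto simp: pair_perm_def)
    then show ?case by (simp only: permutes_id sign_id simp_thms)
  next
    case (swap a b p)
    have perm: "permutation (pair_perm p)" using swap.IH by (auto simp: permutation_permutes)
    have p2: "Transposition.transpose (2*a) (2*b) permutes {..<2*n}"
         "Transposition.transpose (2*a+1) (2*b+1) permutes {..<2*n}"
      using swap.hyps by (auto intro!: permutes_swap_id)
    have "sign (pair_perm (Transposition.transpose a b \<circ> p)) = 1"
      unfolding pair_perm_transpose_comp using swap
      by (simp only: sign_compose permutation_swap_id permutation_compose perm sign_swap_id) simp
    moreover have "pair_perm (Transposition.transpose a b \<circ> p) permutes {..<2*n}"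
      unfolding pair_perm_transpose_comp
      by (intro permutes_compose swap.IH[THEN conjunct1] p2)
    ultimately show ?case by blast
  qed
  then show "pair_perm \<kappa> permutes {..<2*n}" "sign (pair_perm \<kappa>) = 1" by auto
qed

definition pair_flip :: "nat set \<Rightarrow> nat \<Rightarrow> nat" where
  "pair_flip E a = (if a div 2 \<in> E then (if even a then a + 1 else a - 1) else a)"

lemma pair_flip_insert:
  assumes "i \<notin> E"
  shows "pair_flip (insert i E) = Transposition.transpose (2*i) (2*i+1) \<circ> pair_flip E"
proof (rule ext)
  fix a
  show "pair_flip (insert i E) a = (Transposition.transpose (2*i) (2*i+1) \<circ> pair_flip E) a"
  proof (cases "a div 2 = i")
    case True
    then have "a = 2*i \<or> a = 2*i+1" by presburger
    then show ?thesis using assms True by (auto simp: pair_flip_def Transposition.transpose_def)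
  next
    case False
    then have "pair_flip E a \<noteq> 2*i" "pair_flip E a \<noteq> 2*i+1" 
      by (auto simp: pair_flip_def split: if_splits elim!: oddE evenE)
    then show ?thesis using False by (auto simp: pair_flip_def Transposition.transpose_def)
  qed
qed

lemma pair_flip:
  assumes "finite E"
  shows "permutation (pair_flip E)" "sign (pair_flip E) = (-1) ^ card E"
proof -
  from assms have "permutation (pair_flip E) \<and> sign (pair_flip E) = (-1) ^ card E"
  proof (induction E)
    case empty
    have "pair_flip {} = id" by (rule ext) (simp add: pair_flip_def)
    then show ?case by simp
  next
    case (insert i E)
    then show ?case unfolding pair_flip_insert[OF insert.hyps(2)]
      by (auto simp del: o_apply simp: sign_compose permutation_swap_id sign_swap_id permutation_compose)
  qed
  then show "permutation (pair_flip E)" "sign (pair_flip E) = (-1) ^ card E" by auto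
qed

lemma div2_eq_cases:
  fixes a b c :: nat
  shows "a div 2 = b div 2 \<Longrightarrow> b div 2 = c div 2 \<Longrightarrow> b \<noteq> c \<Longrightarrow> a = b \<or> a = c"
  by (cases "even a"; cases "even b"; cases "even c") (auto elim!: evenE oddE)

lemma div2_eq_neq:
  fixes a b :: nat
  shows "a div 2 = b div 2 \<Longrightarrow> a \<noteq> b \<Longrightarrow> even a \<and> b = a + 1 \<or> even b \<and> a = b + 1"
  by (cases "even a"; cases "even b") (auto elim!: evenE oddE)

text \<open>The values of the standard symplectic form on the standard symplectic basis, scaled by 2 to
  match the values of \<open>form11 h\<close> on an \<open>h\<close>-orthonormal complex basis.\<close>

definition symp :: "nat \<Rightarrow> nat \<Rightarrow> complex" where
  "symp a b = (if even a \<and> b = a + 1 then 2 else if even b \<and> a = b + 1 then -2 else 0)"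

lemma symp_nonzero: "symp a b \<noteq> 0 \<longleftrightarrow> a \<noteq> b \<and> a div 2 = b div 2"
proof
  assume "symp a b \<noteq> 0"
  then show "a \<noteq> b \<and> a div 2 = b div 2" by (auto simp: symp_def split: if_splits elim!: evenE)
next
  assume *: "a \<noteq> b \<and> a div 2 = b div 2"
  then have "even a \<and> b = a + 1 \<or> even b \<and> a = b + 1" using div2_eq_neq by blast
  then show "symp a b \<noteq> 0" by (auto simp: symp_def)
qed

definition symp_weight :: "nat \<Rightarrow> (nat \<Rightarrow> nat) \<Rightarrow> complex" where
  "symp_weight n \<sigma> = of_int (sign \<sigma>) * (\<Prod>i<n. symp (\<sigma> (2*i)) (\<sigma> (2*i+1)))"

text \<open>Two pairs cannot be sent into the same pair, since that pair has only two elements and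
  \<open>\<sigma>\<close> is injective.\<close>

lemma inj_on_pairs:
  fixes \<sigma> :: "nat \<Rightarrow> nat"
  assumes "inj \<sigma>" and "\<And>i. i \<in> I \<Longrightarrow> \<sigma> (2*i) div 2 = \<sigma> (2*i+1) div 2"
  shows "inj_on (\<lambda>i. \<sigma> (2*i) div 2) I"
proof (rule inj_onI)
  fix i j assume ij: "i \<in> I" "j \<in> I" "\<sigma> (2*i) div 2 = \<sigma> (2*j) div 2"
  have ne: "\<sigma> (2*i) \<noteq> \<sigma> (2*i+1)" "\<sigma> (2*j) \<noteq> \<sigma> (2*j+1)" using assms(1) by (auto simp: inj_eq)
  have "\<sigma> (2*i) = \<sigma> (2*j) \<or> \<sigma> (2*i) = \<sigma> (2*j+1)"
    by (rule div2_eq_cases[OF ij(3) assms(2)[OF ij(2)] ne(2)])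
  then have "2*i = 2*j \<or> 2*i = 2*j+1" using assms(1) by (simp only: inj_eq)
  then show "i = j" by presburger
qed

text \<open>If no factor vanishes, \<open>\<sigma>\<close> carries pairs to pairs, so it is a block
  permutation composed with flips inside pairs. Each flip changes the sign of
  \<open>\<sigma>\<close> and the sign of one factor, so all nonzero weights agree.\<close>

lemma symp_weight_nonzero:
  assumes \<sigma>: "\<sigma> permutes {..<2*n}" and nz: "symp_weight n \<sigma> \<noteq> 0"
  shows "bij_betw (\<lambda>i. \<sigma> (2*i) div 2) {..<n} {..<n}" "symp_weight n \<sigma> = 2^n"
proof -
  have inj: "inj \<sigma>" using permutes_inj[OF \<sigma>] .
  have div: "\<sigma> (2*i) div 2 = \<sigma> (2*i+1) div 2" if "i < n" for i
    using nz that by (auto simp: symp_weight_def symp_nonzero)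
  have lt: "\<sigma> (2*i) div 2 < n" if "i < n" for i
    using permutes_in_image[OF \<sigma>, of "2*i"] that by auto
  have injd: "inj_on (\<lambda>i. \<sigma> (2*i) div 2) {..<n}" by (rule inj_on_pairs[OF inj]) (auto simp: div)
  moreover have "(\<lambda>i. \<sigma> (2*i) div 2) ` {..<n} \<subseteq> {..<n}" using lt by auto
  ultimately have "(\<lambda>i. \<sigma> (2*i) div 2) ` {..<n} = {..<n}" by (simp add: endo_inj_surj)
  then show bij: "bij_betw (\<lambda>i. \<sigma> (2*i) div 2) {..<n} {..<n}" using injd by (simp add: bij_betw_def)
  define \<kappa> where "\<kappa> i = (if i < n then \<sigma> (2*i) div 2 else i)" for i
  have "bij_betw \<kappa> {..<n} {..<n}" using bij by (rule bij_betw_cong[THEN iffD1, rotated]) (simp add: \<kappa>_def)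
  then have \<kappa>: "\<kappa> permutes {..<n}" by (rule bij_imp_permutes) (simp add: \<kappa>_def)
  \<comment> \<open>The pairs whose order is reversed; once they have been flipped, a pure block
    permutation remains.\<close>
  define E where "E = {i. i < n \<and> odd (\<sigma> (2*i))}"
  have fE: "finite E" by (simp add: E_def)
  have eq: "\<sigma> = pair_perm \<kappa> \<circ> pair_flip E"
  proof (rule ext)
    fix a
    show "\<sigma> a = (pair_perm \<kappa> \<circ> pair_flip E) a"
    proof (cases "a < 2*n")
      case False
      then have "a div 2 \<notin> E" "\<not> a div 2 < n" by (auto simp: E_def)
      moreover have "\<sigma> a = a" using permutes_not_in[OF \<sigma>] False by auto
      ultimately show ?thesis by (simp add: pair_flip_def pair_perm_def \<kappa>_def)
    next
      case True
      define i where "i = a div 2"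
      have i: "i < n" using True by (auto simp: i_def)
      have ne: "\<sigma> (2*i) \<noteq> \<sigma> (2*i+1)" using inj by (auto simp: inj_eq)
      have a: "a = 2*i \<or> a = 2*i+1" unfolding i_def by presburger
      have "\<sigma> a = 2 * (\<sigma> (2*i) div 2) + pair_flip E a mod 2"
      proof -
        consider "even (\<sigma> (2*i))" "\<sigma> (2*i+1) = \<sigma> (2*i) + 1" | "even (\<sigma> (2*i+1))" "\<sigma> (2*i) = \<sigma> (2*i+1) + 1"
          using div2_eq_neq[OF div[OF i] ne] by blast
        then show ?thesis
        proof cases
          case 1
          then show ?thesis using a i by (auto simp: pair_flip_def E_def)
        next
          case 2
          then have "i \<in> E" using i by (simp add: E_def)
          then show ?thesis using a 2 by (auto simp: pair_flip_def)
        qed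
      qed
      moreover have "pair_flip E a div 2 = i" using a by (auto simp: pair_flip_def)
      ultimately show ?thesis using i by (simp add: pair_perm_def \<kappa>_def)
    qed
  qed
  have "permutation (pair_perm \<kappa>)" using pair_perm(1)[OF \<kappa>] by (auto simp: permutation_permutes)
  then have s: "sign \<sigma> = (-1) ^ card E"
    using pair_flip[OF fE] pair_perm(2)[OF \<kappa>] by (simp add: eq sign_compose)
  have "symp (\<sigma> (2*i)) (\<sigma> (2*i+1)) = 2 * (if i \<in> E then -1 else 1)" if "i < n" for i
  proof -
    have ne: "\<sigma> (2*i) \<noteq> \<sigma> (2*i+1)" using inj by (auto simp: inj_eq)
    show ?thesis
    proof (cases "even (\<sigma> (2*i))")
      case True
      then have "\<sigma> (2*i+1) = \<sigma> (2*i) + 1" using div2_eq_neq[OF div[OF that] ne] by auto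
      then show ?thesis using True that by (simp add: symp_def E_def)
    next
      case False
      then have "\<sigma> (2*i) = \<sigma> (2*i+1) + 1" "even (\<sigma> (2*i+1))" using div2_eq_neq[OF div[OF that] ne] by auto
      then show ?thesis using False that by (simp add: symp_def E_def)
    qed
  qed
  then have "(\<Prod>i<n. symp (\<sigma> (2*i)) (\<sigma> (2*i+1))) = (\<Prod>i<n. 2 * (if i \<in> E then -1 else 1))" by simp
  also have "\<dots> = 2^n * (\<Prod>i<n. (if i \<in> E then -1 else 1))" by (simp add: prod.distrib)
  also have "(\<Prod>i<n. (if i \<in> E then -1 else 1)) = (\<Prod>i\<in>E. (-1::complex))"
    by (rule prod.mono_neutral_cong_right) (auto simp: E_def)
  also have "\<dots> = (-1) ^ card E" by simp
  finally show "symp_weight n \<sigma> = 2^n" unfolding symp_weight_def s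
    by (simp add: power_mult_distrib[symmetric])
qed

text \<open>All nonzero weights are equal, so nothing cancels, and the identity has nonzero weight.
  This is the nonvanishing of the volume form, by which the equation is divided later.\<close>

lemma symp_weight_sum_nonzero: "(\<Sum>\<sigma> | \<sigma> permutes {..<2*n}. symp_weight n \<sigma>) \<noteq> 0"
proof -
  define P where "P = {\<sigma>. \<sigma> permutes {..<2*n} \<and> symp_weight n \<sigma> \<noteq> 0}"
  have fin: "finite {\<sigma>. \<sigma> permutes {..<2*n}}" by (simp add: finite_permutations)
  have "(\<Sum>\<sigma> | \<sigma> permutes {..<2*n}. symp_weight n \<sigma>) = (\<Sum>\<sigma>\<in>P. symp_weight n \<sigma>)"
    by (rule sum.mono_neutral_right[OF fin]) (auto simp: P_def)
  also have "\<dots> = (\<Sum>\<sigma>\<in>P. 2^n)"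
    by (rule sum.cong[OF refl]) (auto simp: P_def intro: symp_weight_nonzero(2))
  also have "\<dots> = of_nat (card P) * 2^n" by simp
  finally have eq: "(\<Sum>\<sigma> | \<sigma> permutes {..<2*n}. symp_weight n \<sigma>) = of_nat (card P) * 2^n" .
  have "id \<in> P" by (simp add: P_def symp_weight_def symp_def permutes_id)
  moreover have "finite P" using fin by (simp add: P_def)
  ultimately have "card P \<noteq> 0" by auto
  then show ?thesis using eq by simp
qed

text \<open>The label of the first pair may be replaced by the average over all pairs, since permuting whole pairs
  is an even permutation.\<close>

lemma symp_weight_trace:
  fixes d :: "nat \<Rightarrow> complex"
  shows "of_nat n * (\<Sum>\<sigma> | \<sigma> permutes {..<2*n}. d (\<sigma> 0 div 2) * symp_weight n \<sigma>)
    = (\<Sum>k<n. d k) * (\<Sum>\<sigma> | \<sigma> permutes {..<2*n}. symp_weight n \<sigma>)"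
proof -
  define S where "S j = (\<Sum>\<sigma> | \<sigma> permutes {..<2*n}. d (\<sigma> (2*j) div 2) * symp_weight n \<sigma>)" for j
  have S: "S j = S 0" if j: "j < n" for j
  proof -
    define \<kappa> where "\<kappa> = Transposition.transpose 0 j"
    have \<kappa>: "\<kappa> permutes {..<n}" using j unfolding \<kappa>_def by (intro permutes_swap_id) auto
    have p: "pair_perm \<kappa> (2*i) = 2 * \<kappa> i" "pair_perm \<kappa> (2*i+1) = 2 * \<kappa> i + 1" for i
      by (auto simp: pair_perm_def)
    have "S 0 = (\<Sum>\<sigma> | \<sigma> permutes {..<2*n}. d ((\<sigma> \<circ> pair_perm \<kappa>) (2*0) div 2) * symp_weight n (\<sigma> \<circ> pair_perm \<kappa>))"
      unfolding S_def by (rule sum_permutations_compose_right[OF pair_perm(1)[OF \<kappa>]])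
    also have "\<dots> = S j" unfolding S_def
    proof (rule sum.cong[OF refl])
      fix \<sigma> assume "\<sigma> \<in> {\<sigma>. \<sigma> permutes {..<2*n}}"
      then have "permutation \<sigma>" by (auto simp: permutation_permutes)
      moreover have "permutation (pair_perm \<kappa>)"
        using pair_perm(1)[OF \<kappa>] by (auto simp: permutation_permutes)
      ultimately have s: "sign (\<sigma> \<circ> pair_perm \<kappa>) = sign \<sigma>"
        by (simp add: sign_compose pair_perm(2)[OF \<kappa>])
      have "(\<Prod>i<n. symp (\<sigma> (2 * \<kappa> i)) (\<sigma> (2 * \<kappa> i + 1))) = (\<Prod>i<n. symp (\<sigma> (2*i)) (\<sigma> (2*i+1)))"
        using prod.permute[OF \<kappa>, of "\<lambda>i. symp (\<sigma> (2*i)) (\<sigma> (2*i+1))"] by (simp add: o_def)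
      then have "symp_weight n (\<sigma> \<circ> pair_perm \<kappa>) = symp_weight n \<sigma>"
        unfolding symp_weight_def s o_apply p by simp
      moreover have "(\<sigma> \<circ> pair_perm \<kappa>) (2*0) = \<sigma> (2*j)" unfolding o_apply p by (simp add: \<kappa>_def)
      ultimately show "d ((\<sigma> \<circ> pair_perm \<kappa>) (2*0) div 2) * symp_weight n (\<sigma> \<circ> pair_perm \<kappa>)
        = d (\<sigma> (2*j) div 2) * symp_weight n \<sigma>" by simp
    qed
    finally show ?thesis by simp
  qed
  \<comment> \<open>All \<open>S j\<close> coincide, so \<open>n\<close> copies of
    \<open>S 0\<close> may be replaced by their sum; for a permutation of nonzero weight the labels
    of its pairs run through all of \<open>{..<n}\<close>.\<close>
  have "of_nat n * S 0 = (\<Sum>j<n. S 0)" by simp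
  also have "\<dots> = (\<Sum>j<n. S j)" by (intro sum.cong refl S[symmetric]) auto
  also have "\<dots> = (\<Sum>\<sigma> | \<sigma> permutes {..<2*n}. (\<Sum>j<n. d (\<sigma> (2*j) div 2)) * symp_weight n \<sigma>)"
    unfolding S_def by (subst sum.swap) (simp add: sum_distrib_right)
  also have "\<dots> = (\<Sum>\<sigma> | \<sigma> permutes {..<2*n}. (\<Sum>k<n. d k) * symp_weight n \<sigma>)"
  proof (rule sum.cong[OF refl])
    fix \<sigma> assume "\<sigma> \<in> {\<sigma>. \<sigma> permutes {..<2*n}}"
    then have \<sigma>: "\<sigma> permutes {..<2*n}" by simp
    show "(\<Sum>j<n. d (\<sigma> (2*j) div 2)) * symp_weight n \<sigma> = (\<Sum>k<n. d k) * symp_weight n \<sigma>"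
    proof (cases "symp_weight n \<sigma> = 0")
      case False
      then show ?thesis using sum.reindex_bij_betw[OF symp_weight_nonzero(1)[OF \<sigma> False], of d] by simp
    qed simp
  qed
  finally show ?thesis unfolding S_def by (simp add: sum_distrib_left)
qed

text \<open>By counting: the last \<open>m\<close> pairs fill \<open>m\<close> of the
  \<open>Suc m\<close> target pairs, so the images of 0 and 1 both lie in the one that is
  left.\<close>

lemma missing_pair:
  assumes \<sigma>: "\<sigma> permutes {..<2*Suc m}"
    and div: "\<And>i. i < m \<Longrightarrow> \<sigma> (2*i+2) div 2 = \<sigma> (2*i+3) div 2"
  shows "\<sigma> 0 div 2 = \<sigma> 1 div 2"
proof -
  have inj: "inj \<sigma>" using permutes_inj[OF \<sigma>] .
  have div': "\<sigma> (2*i) div 2 = \<sigma> (2*i+1) div 2" if "i \<in> {1..m}" for i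
  proof -
    have j: "i = Suc (i - 1)" "i - 1 < m" using that by auto
    have "2*i = 2*(i-1)+2" "2*i+1 = 2*(i-1)+3" using j by auto
    then show ?thesis using div[OF j(2)] by (simp only:)
  qed
  define B where "B = (\<lambda>i. \<sigma> (2*i) div 2) ` {1..m}"
  have "card B = m" unfolding B_def by (subst card_image[OF inj_on_pairs[OF inj div']]) auto
  have lt: "\<sigma> a div 2 \<in> {..m}" if "a < 2 * Suc m" for a
    using permutes_in_image[OF \<sigma>, of a] that by auto
  then have "B \<subseteq> {..m}" by (force simp: B_def)
  then have "card ({..m} - B) = 1" using \<open>card B = m\<close> by (simp add: card_Diff_subset finite_subset)
  then obtain k where k: "{..m} - B = {k}" by (auto simp: card_1_singleton_iff)
  have "\<sigma> a div 2 \<notin> B" if a: "a < 2" for a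
  proof
    assume "\<sigma> a div 2 \<in> B"
    then obtain i where i: "i \<in> {1..m}" "\<sigma> a div 2 = \<sigma> (2*i) div 2" by (auto simp: B_def)
    have "\<sigma> (2*i) \<noteq> \<sigma> (2*i+1)" using inj by (auto simp: inj_eq)
    then have "\<sigma> a = \<sigma> (2*i) \<or> \<sigma> a = \<sigma> (2*i+1)" using div2_eq_cases[OF i(2) div'[OF i(1)]] by blast
    then have "a = 2*i \<or> a = 2*i+1" using inj by (simp only: inj_eq)
    then show False using a i(1) by auto
  qed
  then have "\<sigma> 0 div 2 \<in> {..m} - B" "\<sigma> 1 div 2 \<in> {..m} - B" using lt by auto
  then show ?thesis unfolding k by simp
qed

text \<open>On a symplectic basis for \<open>b\<close> both alternating sums become sums of
  \<open>symp_weight\<close>, the first one weighted with the label of the first pair. It suffices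
  to know \<open>a\<close> on paired indices: by \<open>missing_pair\<close> the other factors
  vanish unless the first two images form a pair.\<close>

lemma alt_prod_trace:
  fixes a b :: "'v \<Rightarrow> 'v \<Rightarrow> complex"
  assumes b: "\<And>i j. i < 2 * Suc m \<Longrightarrow> j < 2 * Suc m \<Longrightarrow> b (v i) (v j) = symp i j"
    and a: "\<And>i j. i < 2 * Suc m \<Longrightarrow> j < 2 * Suc m \<Longrightarrow> i div 2 = j div 2 \<Longrightarrow> a (v i) (v j) = d (i div 2) * symp i j"
    and eq: "alt_prod (Suc m) (case_nat a (\<lambda>_. b)) v = c * alt_prod (Suc m) (\<lambda>_. b) v"
  shows "(\<Sum>k<Suc m. d k) = of_nat (Suc m) * c"
proof -
  let ?P = "{\<sigma>. \<sigma> permutes {..<2 * Suc m}}"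
  let ?W = "symp_weight (Suc m)"
  have lt: "\<sigma> i < 2 * Suc m" if "\<sigma> permutes {..<2 * Suc m}" "i < 2 * Suc m" for \<sigma> i
    using permutes_in_image[OF that(1), of i] that(2) by auto
  have R: "alt_prod (Suc m) (\<lambda>_. b) v = (\<Sum>\<sigma>\<in>?P. ?W \<sigma>)"
    unfolding alt_prod_def symp_weight_def
  proof (rule sum.cong[OF refl])
    fix \<sigma> assume "\<sigma> \<in> ?P"
    then have \<sigma>: "\<sigma> permutes {..<2 * Suc m}" by simp
    have "(\<Prod>i<Suc m. b (v (\<sigma> (2*i))) (v (\<sigma> (2*i+1)))) = (\<Prod>i<Suc m. symp (\<sigma> (2*i)) (\<sigma> (2*i+1)))"
      by (rule prod.cong[OF refl], rule b; rule lt[OF \<sigma>]) auto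
    then show "of_int (sign \<sigma>) * (\<Prod>i<Suc m. b (v (\<sigma> (2*i))) (v (\<sigma> (2*i+1))))
      = of_int (sign \<sigma>) * (\<Prod>i<Suc m. symp (\<sigma> (2*i)) (\<sigma> (2*i+1)))" by (simp only:)
  qed
  have L: "alt_prod (Suc m) (case_nat a (\<lambda>_. b)) v = (\<Sum>\<sigma>\<in>?P. d (\<sigma> 0 div 2) * ?W \<sigma>)"
    unfolding alt_prod_def
  proof (rule sum.cong[OF refl])
    fix \<sigma> assume "\<sigma> \<in> ?P"
    then have \<sigma>: "\<sigma> permutes {..<2 * Suc m}" by simp
    define Q where "Q = (\<Prod>i<m. symp (\<sigma> (2*i+2)) (\<sigma> (2*i+3)))"
    have Q: "(\<Prod>i<m. b (v (\<sigma> (2*i+2))) (v (\<sigma> (2*i+3)))) = Q"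
      unfolding Q_def by (rule prod.cong[OF refl], rule b; rule lt[OF \<sigma>]) auto
    have "(\<Prod>i<Suc m. case_nat a (\<lambda>_. b) i (v (\<sigma> (2*i))) (v (\<sigma> (2*i+1)))) = a (v (\<sigma> 0)) (v (\<sigma> 1)) * Q"
      unfolding Q[symmetric] unfolding prod.lessThan_Suc_shift by (simp add: eval_nat_numeral)
    moreover have "?W \<sigma> = of_int (sign \<sigma>) * (symp (\<sigma> 0) (\<sigma> 1) * Q)"
      unfolding Q_def symp_weight_def prod.lessThan_Suc_shift by (simp add: eval_nat_numeral)
    moreover have "a (v (\<sigma> 0)) (v (\<sigma> 1)) * Q = d (\<sigma> 0 div 2) * symp (\<sigma> 0) (\<sigma> 1) * Q"
    proof (cases "Q = 0")
      case False
      then have "\<sigma> (2*i+2) div 2 = \<sigma> (2*i+3) div 2" if "i < m" for i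
        using that by (auto simp: Q_def symp_nonzero)
      then have "\<sigma> 0 div 2 = \<sigma> 1 div 2" using missing_pair[OF \<sigma>] by blast
      then show ?thesis by (subst a[OF lt[OF \<sigma>] lt[OF \<sigma>]]) auto
    qed simp
    ultimately show "of_int (sign \<sigma>) * (\<Prod>i<Suc m. case_nat a (\<lambda>_. b) i (v (\<sigma> (2*i))) (v (\<sigma> (2*i+1))))
       = d (\<sigma> 0 div 2) * ?W \<sigma>" by (simp add: mult_ac)
  qed
  have "(\<Sum>k<Suc m. d k) * (\<Sum>\<sigma>\<in>?P. ?W \<sigma>) = of_nat (Suc m) * c * (\<Sum>\<sigma>\<in>?P. ?W \<sigma>)"
    using symp_weight_trace[of "Suc m" d] eq unfolding L R by (simp only: mult.assoc)
  then show ?thesis using symp_weight_sum_nonzero[of "Suc m"] by (simp only: mult_cancel_right) blast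
qed

lemma permutes_lessThan_2: "{\<sigma>. \<sigma> permutes {..<2::nat}} = {id, Transposition.transpose 0 1}"
proof -
  have "{..<2::nat} = {0, 1}" by auto
  then show ?thesis using permutes_doubleton_iff[of _ "0::nat" 1] by auto
qed

lemma wedge_dz_dzbar:
  "wedge 1 1 (dz i) (dzbar j) v = v 0 $ i * cnj (v 1 $ j) - v 1 $ i * cnj (v 0 $ j)"
proof -
  have "(Transposition.transpose 0 1 :: nat \<Rightarrow> nat) \<noteq> id"
    by (metis id_apply transpose_apply_first zero_neq_one)
  then show ?thesis
    unfolding wedge_def one_add_one permutes_lessThan_2
    by (simp add: dz_def dzbar_def sign_swap_id)
qed

lemma form11_sesq: "form11 h = (\<lambda>v. \<i> * (sesq h (v 0) (v 1) - sesq h (v 1) (v 0)))"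
  unfolding form11_def wedge_dz_dzbar sesq_def
  by (simp add: algebra_simps sum_subtractf sum_distrib_left)

lemma symp_parity:
  "symp i j = (if i div 2 = j div 2 then if even i \<and> odd j then 2 else if odd i \<and> even j then -2 else 0 else 0)"
  unfolding symp_def by (cases "even i"; cases "even j") (auto elim!: evenE oddE, presburger+)

abbreviation imul :: "complex^'n \<Rightarrow> complex^'n::finite" where "imul V \<equiv> \<i> *s V"

text \<open>The identity of top-degree forms is evaluated on the real basis of the vectors
  \<open>\<epsilon> k\<close> and \<open>\<i> *s \<epsilon> k\<close>, where \<open>form11 h\<close>
  takes the values \<open>symp\<close>. The common volume factor cancels, and a trace
  remains.\<close>

lemma donaldson_trace:
  fixes g h :: "complex^'n^'n::finite"
  assumes \<epsilon>: "frame h \<epsilon>"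
    and eq: "\<And>v. wedge 2 (2 * (CARD('n) - 1)) (form11 g) (wedge_power2 (form11 h) (CARD('n) - 1)) v =
       c * wedge_power2 (form11 h) CARD('n) v"
  shows "(\<Sum>k\<in>UNIV. sesq g (\<epsilon> k) (\<epsilon> k)) = of_nat CARD('n) * c"
proof -
  define m where "m = CARD('n) - 1"
  have n: "CARD('n) = Suc m" using finite_UNIV_card_ge_0[where 'a='n] by (simp add: m_def)
  obtain f :: "nat \<Rightarrow> 'n" where f: "bij_betw f {..<Suc m} UNIV"
    using ex_bij_betw_nat_finite[of "UNIV :: 'n set"] n by (auto simp: atLeast0LessThan)
  define a where "a = (\<lambda>x y. \<i> * (sesq g x y - sesq g y x))"
  define b where "b = (\<lambda>x y. \<i> * (sesq h x y - sesq h y x))"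
  have ga: "form11 g = (\<lambda>v. a (v 0) (v 1))" and hb: "form11 h = (\<lambda>v. b (v 0) (v 1))"
    by (simp_all add: form11_sesq a_def b_def)
  define v where "v i = (if even i then \<epsilon> (f (i div 2)) else \<i> *s \<epsilon> (f (i div 2)))" for i :: nat
  define d where "d k = sesq g (\<epsilon> (f k)) (\<epsilon> (f k))" for k
  have ii: "\<i> * (z * \<i>) = - z" for z :: complex by (simp add: complex_eq_iff)
  have av: "a x x = 0" "a (imul x) (imul x) = 0" "a x (imul x) = sesq g x x * 2" "a (imul x) x = sesq g x x * (-2)" for x
    by (simp_all add: a_def sesq_scale_left sesq_scale_right complex_eq_iff)
  have "(\<Sum>k<Suc m. d k) = of_nat (Suc m) * c"
  proof (rule alt_prod_trace[where b = b and a = a and v = v])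
    fix i j assume ij: "i < 2 * Suc m" "j < 2 * Suc m"
    have lt: "i div 2 < Suc m" "j div 2 < Suc m" using ij by auto
    then have fr: "sesq h (\<epsilon> (f (i div 2))) (\<epsilon> (f (j div 2))) = (if i div 2 = j div 2 then 1 else 0)"
      "sesq h (\<epsilon> (f (j div 2))) (\<epsilon> (f (i div 2))) = (if i div 2 = j div 2 then 1 else 0)"
      using \<epsilon> f unfolding frame_def bij_betw_def by (auto simp: inj_on_eq_iff)
    show "b (v i) (v j) = symp i j"
      unfolding b_def v_def symp_parity
      by (cases "even i"; cases "even j") (simp_all add: sesq_scale_left sesq_scale_right fr ii)
    assume e: "i div 2 = j div 2"
    show "a (v i) (v j) = d (i div 2) * symp i j"
      unfolding v_def symp_parity d_def e
      by (cases "even i"; cases "even j") (simp_all only: av if_True if_False simp_thms mult_zero_right)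
  next
    have "wedge 2 (2 * m) (form11 g) (wedge_power2 (form11 h) m) v = c * wedge_power2 (form11 h) (Suc m) v"
      using eq[of v] unfolding n by simp
    then show "alt_prod (Suc m) (case_nat a (\<lambda>_. b)) v = c * alt_prod (Suc m) (\<lambda>_. b) v"
      unfolding ga hb wedge_power2_alt_prod wedge_alt_prod by (simp add: field_simps)
  qed
  moreover have "(\<Sum>k<Suc m. d k) = (\<Sum>k\<in>UNIV. sesq g (\<epsilon> k) (\<epsilon> k))"
    unfolding d_def by (rule sum.reindex_bij_betw[OF f])
  ultimately show ?thesis by (simp add: n)
qed

section \<open>Derivatives of type (1,0) and the complex Hessian\<close>

lemma dd_complex_components:
  fixes u :: "complex^'n::finite \<Rightarrow> 'b::real_normed_vector"
  assumes "u differentiable (at x)"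
  shows "dd V u x = (\<Sum>k\<in>UNIV. Re (V $ k) *\<^sub>R dd (axis k 1) u x + Im (V $ k) *\<^sub>R dd (axis k \<i>) u x)"
proof -
  have "V = (\<Sum>k\<in>UNIV. Re (V $ k) *\<^sub>R axis k 1 + Im (V $ k) *\<^sub>R axis k \<i>)"
    by (auto simp: vec_eq_iff axis_def complex_eq_iff if_distrib sum.distrib cong: if_cong)
  then have "dd V u x = dd (\<Sum>k\<in>UNIV. Re (V $ k) *\<^sub>R axis k 1 + Im (V $ k) *\<^sub>R axis k \<i>) u x" by simp
  then show ?thesis by (simp add: dd_sum_dir dd_add_dir dd_scaleR_dir assms)
qed

lemma d_dz_sum:
  assumes "f differentiable (at x)"
  shows "(\<Sum>k\<in>UNIV. V $ k * d_dz k f x) = (dd V f x - \<i> * dd (imul V) f x) / 2"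
proof -
  have "(dd V f x - \<i> * dd (imul V) f x) / 2 = (\<Sum>k\<in>UNIV. (Re (V $ k) *\<^sub>R dd (axis k 1) f x + Im (V $ k) *\<^sub>R dd (axis k \<i>) f x
      - \<i> * (Re (imul V $ k) *\<^sub>R dd (axis k 1) f x + Im (imul V $ k) *\<^sub>R dd (axis k \<i>) f x)) / 2)"
    unfolding dd_complex_components[OF assms, of V] dd_complex_components[OF assms, of "imul V"]
    by (simp only: sum_divide_distrib[symmetric] sum_subtractf sum_distrib_left[symmetric])
  also have "\<dots> = (\<Sum>k\<in>UNIV. V $ k * d_dz k f x)"
    by (intro sum.cong refl) (simp add: d_dz_def dd_def[symmetric] complex_eq_iff field_simps)
  finally show ?thesis ..
qed

lemma d_dzbar_sum:
  assumes "f differentiable (at x)"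
  shows "(\<Sum>k\<in>UNIV. cnj (U $ k) * d_dzbar k f x) = (dd U f x + \<i> * dd (imul U) f x) / 2"
proof -
  have "(dd U f x + \<i> * dd (imul U) f x) / 2 = (\<Sum>k\<in>UNIV. (Re (U $ k) *\<^sub>R dd (axis k 1) f x + Im (U $ k) *\<^sub>R dd (axis k \<i>) f x
      + \<i> * (Re (imul U $ k) *\<^sub>R dd (axis k 1) f x + Im (imul U $ k) *\<^sub>R dd (axis k \<i>) f x)) / 2)"
    unfolding dd_complex_components[OF assms, of U] dd_complex_components[OF assms, of "imul U"]
    by (simp only: sum_divide_distrib[symmetric] sum.distrib sum_distrib_left[symmetric] distrib_left)
  also have "\<dots> = (\<Sum>k\<in>UNIV. cnj (U $ k) * d_dzbar k f x)"
    by (intro sum.cong refl) (simp add: d_dzbar_def dd_def[symmetric] complex_eq_iff field_simps)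
  finally show ?thesis ..
qed

text \<open>\<open>\<partial>\<^sub>V u\<close> for a real function \<open>u\<close>.\<close>

definition dzdir :: "complex^'n::finite \<Rightarrow> (complex^'n \<Rightarrow> real) \<Rightarrow> complex^'n \<Rightarrow> complex" where
  "dzdir V u x = Complex (dd V u x / 2) (- dd (imul V) u x / 2)"

text \<open>\<open>\<partial>\<^sub>V \<partial>\<^bsub>\<bar>U\<^esub> u\<close>, the complex Hessian.\<close>

definition chess :: "(complex^'n::finite \<Rightarrow> real) \<Rightarrow> complex^'n \<Rightarrow> complex^'n \<Rightarrow> complex^'n \<Rightarrow> complex" where
  "chess u x V U = Complex ((dd V (dd U u) x + dd (imul V) (dd (imul U) u) x) / 4)
      ((dd V (dd (imul U) u) x - dd (imul V) (dd U u) x) / 4)"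

lemma dd_of_real:
  fixes u :: "'a::real_normed_vector \<Rightarrow> real"
  assumes "u differentiable (at x)"
  shows "dd a (\<lambda>y. of_real (u y) :: complex) x = of_real (dd a u x)"
  by (rule dd_bounded_linear[OF bounded_linear_of_real assms])

lemma differentiable_of_real:
  fixes u :: "'a::real_normed_vector \<Rightarrow> real"
  assumes "u differentiable (at x)"
  shows "(\<lambda>y. of_real (u y) :: complex) differentiable (at x)"
  using bounded_linear.has_derivative[OF bounded_linear_of_real] assms unfolding differentiable_def by blast

lemma dzdir_sum:
  fixes u :: "complex^'n::finite \<Rightarrow> real"
  assumes "u differentiable (at x)"
  shows "(\<Sum>k\<in>UNIV. V $ k * d_dz k (\<lambda>y. complex_of_real (u y)) x) = dzdir V u x"
  unfolding d_dz_sum[OF differentiable_of_real[OF assms]]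
  by (simp add: dd_of_real[OF assms] dzdir_def complex_eq_iff)

lemma d_dzbar_of_real_cnj:
  assumes "u differentiable (at x)"
  shows "d_dzbar k (\<lambda>y. complex_of_real (u y)) x = cnj (d_dz k (\<lambda>y. complex_of_real (u y)) x)"
  unfolding d_dz_def d_dzbar_def dd_def[symmetric] dd_of_real[OF assms] by simp

text \<open>This links the iterated Wirtinger derivatives in \<open>perturb\<close> to real second
  derivatives along \<open>V\<close>, \<open>imul V\<close>, \<open>U\<close> and
  \<open>imul U\<close>; these vectors are constant, so they pass through the
  differentiations.\<close>

lemma chess_sum:
  fixes u :: "complex^'n::finite \<Rightarrow> real"
  assumes "open S" "smooth_on u S" "x \<in> S"
  shows "(\<Sum>i\<in>UNIV. \<Sum>j\<in>UNIV. d_dz i (d_dzbar j (\<lambda>y. complex_of_real (u y))) x * V $ i * cnj (U $ j))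
     = chess u x V U"
proof -
  let ?c = "\<lambda>y. complex_of_real (u y)"
  have d: "u differentiable (at y)" if "y \<in> S" for y
    using smooth_on_imp_differentiable[OF assms(2) that] .
  have d1: "dd a u differentiable (at x)" for a
    using smooth_on_imp_differentiable[OF smooth_on_dd[OF assms(2)] assms(3)] .
  have lin: "bounded_linear (\<lambda>z::complex. c * z)" for c by (rule bounded_linear_mult_right)
  have eqU: "(\<Sum>j\<in>UNIV. cnj (U $ j) * d_dzbar j ?c y)
      = of_real (dd U u y) * (1/2) + of_real (dd (imul U) u y) * (\<i>/2)" if "y \<in> S" for y
    using d_dzbar_sum[OF differentiable_of_real[OF d[OF that]], of U]
    by (simp add: dd_of_real[OF d[OF that]] add_divide_distrib)
  have eqj: "d_dzbar j ?c y = of_real (dd (axis j 1) u y) * (1/2) + of_real (dd (axis j \<i>) u y) * (\<i>/2)" if "y \<in> S" for j y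
    unfolding d_dzbar_def dd_def[symmetric] dd_of_real[OF d[OF that]] by (simp add: add_divide_distrib)
  have diff2: "(\<lambda>y. of_real (dd p u y) * c + of_real (dd q u y) * c') differentiable (at x)" for p q and c c' :: complex
    by (intro differentiable_add differentiable_mult differentiable_of_real d1 differentiable_const)
  have diffj: "d_dzbar j ?c differentiable (at x)" for j
    by (rule differentiable_cong_open[OF assms(1,3) eqj, THEN iffD2, OF _ diff2])
  have "(\<Sum>i\<in>UNIV. \<Sum>j\<in>UNIV. d_dz i (d_dzbar j ?c) x * V $ i * cnj (U $ j))
      = (\<Sum>j\<in>UNIV. cnj (U $ j) * (\<Sum>i\<in>UNIV. V $ i * d_dz i (d_dzbar j ?c) x))"
    by (subst sum.swap) (simp add: sum_distrib_left mult_ac)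
  also have "\<dots> = (\<Sum>j\<in>UNIV. cnj (U $ j) * ((dd V (d_dzbar j ?c) x - \<i> * dd (imul V) (d_dzbar j ?c) x) / 2))"
    by (simp only: d_dz_sum[OF diffj])
  also have "\<dots> = ((\<Sum>j\<in>UNIV. cnj (U $ j) * dd V (d_dzbar j ?c) x)
      - \<i> * (\<Sum>j\<in>UNIV. cnj (U $ j) * dd (imul V) (d_dzbar j ?c) x)) / 2"
    by (simp add: sum_distrib_left sum_subtractf sum_divide_distrib algebra_simps diff_divide_distrib)
  also have "\<dots> = (dd V (\<lambda>y. \<Sum>j\<in>UNIV. cnj (U $ j) * d_dzbar j ?c y) x
      - \<i> * dd (imul V) (\<lambda>y. \<Sum>j\<in>UNIV. cnj (U $ j) * d_dzbar j ?c y) x) / 2"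
  proof -
    have "(\<Sum>j\<in>UNIV. cnj (U $ j) * dd W (d_dzbar j ?c) x) = dd W (\<lambda>y. \<Sum>j\<in>UNIV. cnj (U $ j) * d_dzbar j ?c y) x" for W
    proof -
      have "dd W (\<lambda>y. \<Sum>j\<in>UNIV. cnj (U $ j) * d_dzbar j ?c y) x
          = (\<Sum>j\<in>UNIV. dd W (\<lambda>y. cnj (U $ j) * d_dzbar j ?c y) x)"
        by (rule dd_sum) (intro differentiable_mult differentiable_const diffj)
      also have "\<dots> = (\<Sum>j\<in>UNIV. cnj (U $ j) * dd W (d_dzbar j ?c) x)"
        by (simp only: dd_bounded_linear[OF lin diffj])
      finally show ?thesis ..
    qed
    then show ?thesis by simp
  qed
  also have "\<dots> = chess u x V U"
  proof -
    have L: "dd W (\<lambda>y. \<Sum>j\<in>UNIV. cnj (U $ j) * d_dzbar j ?c y) x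
        = of_real (dd W (dd U u) x) * (1/2) + of_real (dd W (dd (imul U) u) x) * (\<i>/2)" for W
    proof -
      have "dd W (\<lambda>y. \<Sum>j\<in>UNIV. cnj (U $ j) * d_dzbar j ?c y) x
        = dd W (\<lambda>y. of_real (dd U u y) * (1/2) + of_real (dd (imul U) u y) * (\<i>/2)) x"
        by (rule dd_cong[OF assms(1,3)]) (rule eqU)
      also have "\<dots> = dd W (\<lambda>y. of_real (dd U u y) * (1/2)) x + dd W (\<lambda>y. of_real (dd (imul U) u y) * (\<i>/2)) x"
        by (intro dd_add differentiable_mult differentiable_of_real d1 differentiable_const)
      also have "\<dots> = of_real (dd W (dd U u) x) * (1/2) + of_real (dd W (dd (imul U) u) x) * (\<i>/2)"
        by (simp only: dd_bounded_linear[OF bounded_linear_mult_left differentiable_of_real[OF d1]] dd_of_real[OF d1])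
      finally show ?thesis .
    qed
    show ?thesis unfolding L by (simp add: chess_def complex_eq_iff field_simps)
  qed
  finally show ?thesis .
qed

lemma sesq_perturb:
  assumes "open S" "smooth_on (in_chart c u) S" "x \<in> S"
  shows "sesq (perturb chi u c x) V U = sesq (chi c x) V U + chess (in_chart c u) x V U"
proof -
  have "sesq (perturb chi u c x) V U = sesq (chi c x) V U +
     (\<Sum>i\<in>UNIV. \<Sum>j\<in>UNIV. d_dz i (d_dzbar j (\<lambda>y. complex_of_real (in_chart c u y))) x * V $ i * cnj (U $ j))"
    by (simp add: sesq_def perturb_def algebra_simps sum.distrib)
  then show ?thesis unfolding chess_sum[OF assms] .
qed

text \<open>Positivity makes the kernel trivial, which gives a left inverse and, for square
  matrices, a two-sided one for \<open>matrix_inv\<close> to choose.\<close>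

lemma transpose_matrix_inv_mult:
  fixes g :: "complex^'n^'n::finite"
  assumes "pos_def g"
  shows "transpose g ** matrix_inv (transpose g) = mat 1"
proof -
  have "V = 0" if "transpose g *v V = 0" for V
  proof -
    have "(\<Sum>j\<in>UNIV. (transpose g *v V) $ j * cnj (V $ j)) = sesq g V V"
      unfolding sesq_def by (subst sum.swap)
        (simp add: matrix_vector_mult_def transpose_def sum_distrib_right)
    then have "sesq g V V = 0" using that by simp
    then show ?thesis using assms by (metis pos_def_sesq less_irrefl zero_complex.sel(1))
  qed
  then obtain B where B: "B ** transpose g = mat 1"
    using matrix_left_invertible_ker[of "transpose g"] by blast
  then have "transpose g ** B = mat 1" using matrix_left_right_inverse by blast
  then have "\<exists>A'. transpose g ** A' = mat 1 \<and> A' ** transpose g = mat 1" using B by blast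
  from someI_ex[OF this] show ?thesis unfolding matrix_inv_def by blast
qed

text \<open>By Cauchy-Schwarz \<open>grad_sq\<close> is the maximum of |\<partial>_U u|^2 / g(U, U),
  attained at the gradient vector when that is nonzero. Later arguments use this description in
  place of the inverse matrix.\<close>

lemma grad_sq_extremal:
  fixes u :: "'a \<Rightarrow> real"
  assumes g: "pos_def (g c x)" and du: "in_chart c u differentiable (at x)"
  shows "norm (dzdir U (in_chart c u) x) ^ 2 \<le> grad_sq g u c x * Re (sesq (g c x) U U)"
    and "\<exists>V. dzdir V (in_chart c u) x = of_real (grad_sq g u c x) \<and> Re (sesq (g c x) V V) = grad_sq g u c x"
proof -
  let ?f = "\<lambda>y. complex_of_real (in_chart c u y)"
  define G where "G = matrix_inv (transpose (g c x))"
  have herm: "hermitian_matrix (g c x)" using g by (simp add: pos_def_def)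
  \<comment> \<open>The gradient vector: pairing it with \<open>W\<close> gives the conjugate of the
    derivative along \<open>W\<close>, as \<open>sV\<close> shows.\<close>
  define V where "V = G *v (\<chi> l. d_dzbar l ?f x)"
  have "transpose (g c x) *v V = (\<chi> l. d_dzbar l ?f x)"
    unfolding V_def G_def matrix_vector_mul_assoc transpose_matrix_inv_mult[OF g] by simp
  then have comp: "(\<Sum>i\<in>UNIV. g c x $ i $ j * V $ i) = d_dzbar j ?f x" for j
    by (simp add: vec_eq_iff matrix_vector_mult_def transpose_def)
  have sV: "sesq (g c x) V W = cnj (dzdir W (in_chart c u) x)" for W
  proof -
    have "sesq (g c x) V W = (\<Sum>j\<in>UNIV. (\<Sum>i\<in>UNIV. g c x $ i $ j * V $ i) * cnj (W $ j))"
      unfolding sesq_def by (subst sum.swap) (simp add: sum_distrib_right)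
    also have "\<dots> = cnj (\<Sum>j\<in>UNIV. W $ j * d_dz j ?f x)"
      unfolding comp d_dzbar_of_real_cnj[OF du] by (simp add: mult.commute)
    finally show ?thesis unfolding dzdir_sum[OF du] .
  qed
  have "grad_sq g u c x = Re (\<Sum>k\<in>UNIV. V $ k * d_dz k ?f x)"
    unfolding grad_sq_def Let_def G_def[symmetric] V_def
    by (simp add: matrix_vector_mult_def sum_distrib_left sum_distrib_right mult_ac)
  then have w: "grad_sq g u c x = Re (dzdir V (in_chart c u) x)" unfolding dzdir_sum[OF du] .
  have VV: "sesq (g c x) V V = of_real (grad_sq g u c x)"
    using sV[of V] sesq_diag_real[OF herm, of V] w by (metis complex_cnj_complex_of_real complex_cnj_cnj Re_complex_of_real)
  have real: "dzdir V (in_chart c u) x = of_real (grad_sq g u c x)"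
    using sV[of V] VV by (metis complex_cnj_complex_of_real complex_cnj_cnj)
  then show "\<exists>V. dzdir V (in_chart c u) x = of_real (grad_sq g u c x) \<and> Re (sesq (g c x) V V) = grad_sq g u c x"
    using VV by (intro exI[of _ V]) simp
  define w where "w = grad_sq g u c x"
  define z where "z = dzdir U (in_chart c u) x"
  have w0: "0 \<le> w" using pos_def_nonneg[OF g, of V] VV by (simp add: w_def)
  have nn: "0 \<le> Re (sesq (g c x) (z *s V - of_real s *s U) (z *s V - of_real s *s U))" for s
    by (rule pos_def_nonneg[OF g])
  have zUV: "sesq (g c x) U V = z" using sesq_hermitian[OF herm, of U V] sV[of U] by (simp add: z_def)
  have "0 \<le> norm z ^ 2 * w - 2 * s * norm z ^ 2 + s^2 * Re (sesq (g c x) U U)" if "True" for s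
  proof -
    have "sesq (g c x) (cnj z *s U) V = of_real (norm z ^ 2)"
      unfolding sesq_scale_left zUV by (metis complex_norm_square mult.commute)
    have zz: "z * cnj z = of_real (norm z ^ 2)" by (metis complex_norm_square)
    have "sesq (g c x) (z *s V - of_real s *s U) (z *s V - of_real s *s U)
      = z * cnj z * of_real w - of_real s * (z * cnj z) - of_real s * (z * cnj z) + of_real (s^2) * sesq (g c x) U U"
      by (simp add: sesq_diff_left sesq_diff_right sesq_scale_left sesq_scale_right VV zUV
          sV[of U, folded z_def] w_def[symmetric] algebra_simps power2_eq_square)
    then have "sesq (g c x) (z *s V - of_real s *s U) (z *s V - of_real s *s U)
      = of_real (norm z ^ 2 * w - 2 * s * norm z ^ 2) + of_real (s^2) * sesq (g c x) U U"
      unfolding zz by (simp add: algebra_simps)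
    then show ?thesis using nn[of s] by (simp del: of_real_power)
  qed note quad = this[OF TrueI]
  define q where "q = Re (sesq (g c x) U U)"
  have q0: "0 \<le> q" unfolding q_def by (rule pos_def_nonneg[OF g])
  show "norm (dzdir U (in_chart c u) x) ^ 2 \<le> grad_sq g u c x * Re (sesq (g c x) U U)"
    unfolding z_def[symmetric] w_def[symmetric] q_def[symmetric]
  proof (cases "U = 0")
    case True
    then have "z = 0" using zUV by simp
    then show "norm z ^ 2 \<le> w * q" using w0 q0 by simp
  next
    case False
    then have q: "q > 0" using g by (simp add: q_def pos_def_sesq)
    \<comment> \<open>The quadratic polynomial in \<open>quad\<close> is evaluated at its
      minimum.\<close>
    have "0 \<le> norm z ^ 2 * w - 2 * (norm z ^ 2 / q) * norm z ^ 2 + (norm z ^ 2 / q)^2 * q"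
      using quad[of "norm z ^ 2 / q"] by (simp add: q_def)
    also have "\<dots> = norm z ^ 2 * (w - norm z ^ 2 / q)" using q by (simp add: field_simps power2_eq_square)
    finally have "norm z = 0 \<or> norm z ^ 2 / q \<le> w"
      by (metis diff_ge_0_iff_ge mult_nonneg_nonneg zero_le_mult_iff zero_le_power2 power2_eq_iff_nonneg less_eq_real_def not_le mult_pos_neg zero_power2 norm_ge_zero zero_less_power2)
    then show "norm z ^ 2 \<le> w * q" using q w0 by (auto simp: field_simps)
  qed
qed

section \<open>The inequality at a maximum point\<close>

text \<open>The inequality is \<open>tr (h\<^sup>-\<^sup>1 - \<eta>) h (h\<^sup>-\<^sup>1 - \<eta>) g \<ge> 0\<close> with \<open>\<eta> = \<Sum> \<mu>\<^sub>k e\<^sub>k \<otimes> \<bar>e\<^sub>k\<close>. It bounds the trace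
  from below by an expression that is affine in \<open>h\<close>; where equality holds, the derivative of the
  trace can be read off without differentiating an inverse matrix.\<close>

lemma trace_ge:
  fixes g h :: "complex^'n^'n::finite" and \<mu> :: "'n \<Rightarrow> real"
  assumes g: "pos_def g" and h: "hermitian_matrix h" and \<epsilon>: "frame h \<epsilon>"
  shows "2 * (\<Sum>k\<in>UNIV. \<mu> k * Re (sesq g (e k) (e k)))
      - Re (\<Sum>k\<in>UNIV. \<Sum>l\<in>UNIV. of_real (\<mu> k * \<mu> l) * sesq h (e k) (e l) * sesq g (e l) (e k))
    \<le> Re (\<Sum>j\<in>UNIV. sesq g (\<epsilon> j) (\<epsilon> j))"
proof -
  have gh: "hermitian_matrix g" using g by (simp add: pos_def_def)
  \<comment> \<open>\<open>y j\<close> is \<open>\<eta>\<close> h applied to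
    \<open>\<epsilon> j\<close>; the inequality says that the squared \<open>g\<close>-lengths of
    the \<open>\<epsilon> j - y j\<close> have a nonnegative sum.\<close>
  define y where "y j = (\<Sum>k\<in>UNIV. (of_real (\<mu> k) * sesq h (\<epsilon> j) (e k)) *s e k)" for j
  have hc: "sesq h (\<epsilon> j) (e k) = cnj (sesq h (e k) (\<epsilon> j))" for j k
    by (rule sesq_hermitian[OF h])
  have gc: "Re (sesq g U V) = Re (sesq g V U)" for U V
    using sesq_hermitian[OF gh, of U V] by simp
  have ek: "sesq g (e k) U = (\<Sum>j\<in>UNIV. sesq h (e k) (\<epsilon> j) * sesq g (\<epsilon> j) U)" for k U
  proof -
    have "sesq g (e k) U = sesq g (\<Sum>j\<in>UNIV. sesq h (e k) (\<epsilon> j) *s \<epsilon> j) U"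
      using frame_expand[OF \<epsilon>, of "e k"] by simp
    then show ?thesis by (simp add: sesq_sum_left sesq_scale_left)
  qed
  have A: "(\<Sum>j\<in>UNIV. sesq g (\<epsilon> j) (y j)) = (\<Sum>k\<in>UNIV. of_real (\<mu> k) * sesq g (e k) (e k))"
  proof -
    have "(\<Sum>j\<in>UNIV. sesq g (\<epsilon> j) (y j)) = (\<Sum>j\<in>UNIV. \<Sum>k\<in>UNIV. of_real (\<mu> k) * (sesq h (e k) (\<epsilon> j) * sesq g (\<epsilon> j) (e k)))"
      by (simp add: y_def sesq_sum_right sesq_scale_right hc mult.assoc)
    also have "\<dots> = (\<Sum>k\<in>UNIV. of_real (\<mu> k) * (\<Sum>j\<in>UNIV. sesq h (e k) (\<epsilon> j) * sesq g (\<epsilon> j) (e k)))"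
      by (subst sum.swap) (simp only: sum_distrib_left)
    finally show ?thesis by (simp only: ek[symmetric])
  qed
  have B: "(\<Sum>j\<in>UNIV. sesq g (y j) (y j))
     = (\<Sum>k\<in>UNIV. \<Sum>l\<in>UNIV. of_real (\<mu> k * \<mu> l) * sesq h (e k) (e l) * sesq g (e l) (e k))"
  proof -
    have "(\<Sum>j\<in>UNIV. sesq g (y j) (y j)) = (\<Sum>j\<in>UNIV. \<Sum>k\<in>UNIV. \<Sum>l\<in>UNIV.
        of_real (\<mu> k * \<mu> l) * (sesq h (e k) (\<epsilon> j) * cnj (sesq h (e l) (\<epsilon> j))) * sesq g (e l) (e k))"
      unfolding y_def sesq_sum_right unfolding sesq_sum_left sesq_scale_right sesq_scale_left hc sum_distrib_left
      by (simp add: mult_ac)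
    also have "\<dots> = (\<Sum>k\<in>UNIV. \<Sum>l\<in>UNIV. \<Sum>j\<in>UNIV.
        of_real (\<mu> k * \<mu> l) * (sesq h (e k) (\<epsilon> j) * cnj (sesq h (e l) (\<epsilon> j))) * sesq g (e l) (e k))"
      by (subst sum.swap) (intro sum.cong refl sum.swap)
    also have "\<dots> = (\<Sum>k\<in>UNIV. \<Sum>l\<in>UNIV. of_real (\<mu> k * \<mu> l) * sesq h (e k) (e l) * sesq g (e l) (e k))"
      by (simp only: frame_parseval[OF \<epsilon> h, of "e _" "e _"] sum_distrib_left sum_distrib_right)
    finally show ?thesis .
  qed
  have "0 \<le> (\<Sum>j\<in>UNIV. Re (sesq g (\<epsilon> j - y j) (\<epsilon> j - y j)))"
    by (intro sum_nonneg pos_def_nonneg g)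
  also have "\<dots> = (\<Sum>j\<in>UNIV. Re (sesq g (\<epsilon> j) (\<epsilon> j)) - 2 * Re (sesq g (\<epsilon> j) (y j)) + Re (sesq g (y j) (y j)))"
  proof (rule sum.cong[OF refl])
    fix j show "Re (sesq g (\<epsilon> j - y j) (\<epsilon> j - y j))
      = Re (sesq g (\<epsilon> j) (\<epsilon> j)) - 2 * Re (sesq g (\<epsilon> j) (y j)) + Re (sesq g (y j) (y j))"
      using gc[of "y j" "\<epsilon> j"] by (simp add: sesq_diff_left sesq_diff_right)
  qed
  also have "\<dots> = Re (\<Sum>j\<in>UNIV. sesq g (\<epsilon> j) (\<epsilon> j)) - 2 * Re (\<Sum>j\<in>UNIV. sesq g (\<epsilon> j) (y j))
      + Re (\<Sum>j\<in>UNIV. sesq g (y j) (y j))"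
    by (simp add: sum.distrib sum_subtractf sum_distrib_left)
  finally show ?thesis unfolding A B by simp
qed

lemma smooth_on_mult_const:
  fixes u :: "'a::real_normed_vector \<Rightarrow> complex"
  shows "open S \<Longrightarrow> smooth_on u S \<Longrightarrow> smooth_on (\<lambda>y. u y * c) S"
  by (rule smooth_on_bounded_linear[OF _ bounded_linear_mult_left])

lemma smooth_on_sesq:
  assumes "open S" "\<And>i j. smooth_on (\<lambda>y. g y $ i $ j) S"
  shows "smooth_on (\<lambda>y. sesq (g y) V U) S"
  unfolding sesq_def mult.assoc
  by (intro smooth_on_sum smooth_on_mult_const assms)

lemma smooth_on_Re: "open S \<Longrightarrow> smooth_on u S \<Longrightarrow> smooth_on (\<lambda>y. Re (u y)) S"
  by (rule smooth_on_bounded_linear[OF _ bounded_linear_Re])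

lemma smooth_on_of_real:
  fixes u :: "'a::real_normed_vector \<Rightarrow> real"
  shows "open S \<Longrightarrow> smooth_on u S \<Longrightarrow> smooth_on (\<lambda>y. complex_of_real (u y)) S"
  by (rule smooth_on_bounded_linear[OF _ bounded_linear_of_real])

lemma smooth_on_chess:
  assumes "open S" "smooth_on u S"
  shows "smooth_on (\<lambda>y. chess u y V U) S"
proof -
  have eq: "(\<lambda>y. chess u y V U) = (\<lambda>y. complex_of_real (dd V (dd U u) y) * (1/4) + complex_of_real (dd (imul V) (dd (imul U) u) y) * (1/4)
     + (complex_of_real (dd V (dd (imul U) u) y) * (\<i>/4) + complex_of_real (dd (imul V) (dd U u) y) * (-\<i>/4)))"
    by (rule ext) (simp add: chess_def complex_eq_iff)
  show ?thesis unfolding eq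
    by (intro smooth_on_add smooth_on_mult_const smooth_on_of_real smooth_on_dd assms)
qed

lemma frame_rescale:
  fixes \<mu> :: "'n::finite \<Rightarrow> real"
  assumes \<mu>: "\<And>k. 0 < \<mu> k"
    and diag: "\<And>k l. sesq h (e k) (e l) = (if k = l then of_real (1 / \<mu> k) else 0)"
  shows "frame h (\<lambda>k. of_real (sqrt (\<mu> k)) *s e k)"
  unfolding frame_def
proof (intro allI)
  fix k l
  have "sesq h (of_real (sqrt (\<mu> k)) *s e k) (of_real (sqrt (\<mu> l)) *s e l)
      = of_real (sqrt (\<mu> k) * sqrt (\<mu> l)) * sesq h (e k) (e l)"
    by (simp add: sesq_scale_left sesq_scale_right)
  also have "\<dots> = (if k = l then of_real (\<mu> k) * of_real (1 / \<mu> k) else 0)"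
    using \<mu>[of k] \<mu>[of l] by (cases "k = l") (simp_all add: diag del: of_real_divide of_real_mult)
  also have "\<dots> = (if k = l then 1 else 0)" using \<mu>[of k] \<mu>[of l] by auto
  finally show "sesq h (of_real (sqrt (\<mu> k)) *s e k) (of_real (sqrt (\<mu> l)) *s e l) = (if k = l then 1 else 0)" .
qed

text \<open>\<open>N\<close> is \<open>f\<close> minus the lower bound of \<open>trace_ge\<close>
  with \<open>e\<close> and \<open>\<mu>\<close> frozen at \<open>x\<close>. It is nonnegative on
  \<open>S\<close> and zero at \<open>x\<close>, so its derivative vanishes there; that is the
  second identity.\<close>

lemma trace_derivative:
  fixes g h :: "complex^'n::finite \<Rightarrow> complex^'n^'n" and \<mu> :: "'n \<Rightarrow> real"
  assumes S: "open S" "x \<in> S"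
    and g: "\<And>y. y \<in> S \<Longrightarrow> pos_def (g y)" and h: "\<And>y. y \<in> S \<Longrightarrow> pos_def (h y)"
    and dg: "\<And>V U. (\<lambda>y. sesq (g y) V U) differentiable (at x)"
    and dh: "\<And>V U. (\<lambda>y. sesq (h y) V U) differentiable (at x)"
    and df: "f differentiable (at x)"
    and tr: "\<And>y \<epsilon>. y \<in> S \<Longrightarrow> frame (h y) \<epsilon> \<Longrightarrow> (\<Sum>k\<in>UNIV. sesq (g y) (\<epsilon> k) (\<epsilon> k)) = of_real (f y)"
    and e: "frame (g x) e" and \<mu>: "\<And>k. 0 < \<mu> k"
    and diag: "\<And>k l. sesq (h x) (e k) (e l) = (if k = l then of_real (1 / \<mu> k) else 0)"
  shows "(\<Sum>k\<in>UNIV. \<mu> k) = f x"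
    and "(\<Sum>k\<in>UNIV. \<mu> k ^ 2 * dd b (\<lambda>y. Re (sesq (h y) (e k) (e k))) x)
       = (\<Sum>k\<in>UNIV. \<mu> k * dd b (\<lambda>y. Re (sesq (g y) (e k) (e k))) x) - dd b f x"
proof -
  have ge: "sesq (g x) (e k) (e l) = (if k = l then 1 else 0)" for k l
    using e by (simp add: frame_def)
  note fr = frame_rescale[OF \<mu> diag]
  from tr[OF S(2) fr] have "(\<Sum>k\<in>UNIV. complex_of_real (sqrt (\<mu> k)) * (of_real (sqrt (\<mu> k)) * 1)) = of_real (f x)"
    by (simp add: sesq_scale_left sesq_scale_right ge)
  then have "complex_of_real (\<Sum>k\<in>UNIV. \<mu> k) = of_real (f x)"
    using \<mu> by (simp add: less_imp_le flip: of_real_mult)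
  then show sum: "(\<Sum>k\<in>UNIV. \<mu> k) = f x" by (simp only: of_real_eq_iff)
  define N where "N y = f y - 2 * (\<Sum>k\<in>UNIV. \<mu> k * Re (sesq (g y) (e k) (e k)))
      + Re (\<Sum>k\<in>UNIV. \<Sum>l\<in>UNIV. of_real (\<mu> k * \<mu> l) * (sesq (h y) (e k) (e l) * sesq (g y) (e l) (e k)))" for y
  have N0: "N x = 0"
    using \<mu> by (simp add: N_def diag ge sum[symmetric] if_distrib less_imp_neq[symmetric] cong: if_cong)
  have Nn: "0 \<le> N y" if y: "y \<in> S" for y
  proof -
    obtain \<epsilon> \<nu> where \<epsilon>0: "frame (g y) \<epsilon>" "\<And>k. 0 < \<nu> k"
      "\<And>k l. sesq (h y) (\<epsilon> k) (\<epsilon> l) = (if k = l then of_real (1 / \<nu> k) else 0)"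
      using simultaneous_diagonalization[OF g h, OF y y] by metis
    note fr = frame_rescale[OF \<epsilon>0(2,3)]
    have "hermitian_matrix (h y)" using h[OF y] by (simp add: pos_def_def)
    from trace_ge[OF g[OF y] this fr, of \<mu> e] tr[OF y fr]
    show ?thesis by (simp add: N_def mult.assoc)
  qed
  define N' where "N' b = dd b f x - 2 * (\<Sum>k\<in>UNIV. \<mu> k * Re (dd b (\<lambda>y. sesq (g y) (e k) (e k)) x))
      + Re (\<Sum>k\<in>UNIV. \<Sum>l\<in>UNIV. of_real (\<mu> k * \<mu> l) *
        (sesq (h x) (e k) (e l) * dd b (\<lambda>y. sesq (g y) (e l) (e k)) x
          + dd b (\<lambda>y. sesq (h y) (e k) (e l)) x * sesq (g x) (e l) (e k)))" for b
  have "(N has_derivative N') (at x)"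
    unfolding N_def[abs_def] N'_def[abs_def]
    by (intro has_derivative_add has_derivative_diff has_derivative_dd[OF df] has_derivative_mult_right
        has_derivative_sum has_derivative_Re has_derivative_mult has_derivative_dd[OF dg] has_derivative_dd[OF dh])
  then have "N' = (\<lambda>b. 0)"
    by (rule differential_zero_maxmin[OF S(2,1)]) (use N0 Nn in auto)
  then have "N' b = 0" by metis
  moreover have "N' b = dd b f x - (\<Sum>k\<in>UNIV. \<mu> k * Re (dd b (\<lambda>y. sesq (g y) (e k) (e k)) x))
     + (\<Sum>k\<in>UNIV. \<mu> k ^ 2 * Re (dd b (\<lambda>y. sesq (h y) (e k) (e k)) x))"
  proof -
    have "(\<Sum>l\<in>UNIV. of_real (\<mu> k * \<mu> l) *
        (sesq (h x) (e k) (e l) * dd b (\<lambda>y. sesq (g y) (e l) (e k)) x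
          + dd b (\<lambda>y. sesq (h y) (e k) (e l)) x * sesq (g x) (e l) (e k)))
       = of_real (\<mu> k) * dd b (\<lambda>y. sesq (g y) (e k) (e k)) x + of_real (\<mu> k ^ 2) * dd b (\<lambda>y. sesq (h y) (e k) (e k)) x" for k
    proof -
      have "(\<Sum>l\<in>UNIV. of_real (\<mu> k * \<mu> l) *
        (sesq (h x) (e k) (e l) * dd b (\<lambda>y. sesq (g y) (e l) (e k)) x
          + dd b (\<lambda>y. sesq (h y) (e k) (e l)) x * sesq (g x) (e l) (e k)))
        = (\<Sum>l\<in>UNIV. if l = k then of_real (\<mu> k * \<mu> k) *
        (of_real (1 / \<mu> k) * dd b (\<lambda>y. sesq (g y) (e k) (e k)) x
          + dd b (\<lambda>y. sesq (h y) (e k) (e k)) x) else 0)"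
        by (rule sum.cong[OF refl]) (simp add: diag ge)
      also have "\<dots> = of_real (\<mu> k * \<mu> k) *
        (of_real (1 / \<mu> k) * dd b (\<lambda>y. sesq (g y) (e k) (e k)) x + dd b (\<lambda>y. sesq (h y) (e k) (e k)) x)" by simp
      finally show ?thesis using \<mu>[of k] by (simp add: algebra_simps power2_eq_square)
    qed note inner = this
    show ?thesis unfolding N'_def inner by (simp add: sum.distrib del: of_real_power)
  qed
  moreover have "Re (dd b (\<lambda>y. sesq (g y) (e k) (e k)) x) = dd b (\<lambda>y. Re (sesq (g y) (e k) (e k))) x"
    "Re (dd b (\<lambda>y. sesq (h y) (e k) (e k)) x) = dd b (\<lambda>y. Re (sesq (h y) (e k) (e k))) x" for k
    using dd_bounded_linear[OF bounded_linear_Re dg] dd_bounded_linear[OF bounded_linear_Re dh] by metis+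
  ultimately show "(\<Sum>k\<in>UNIV. \<mu> k ^ 2 * dd b (\<lambda>y. Re (sesq (h y) (e k) (e k))) x)
       = (\<Sum>k\<in>UNIV. \<mu> k * dd b (\<lambda>y. Re (sesq (g y) (e k) (e k))) x) - dd b f x"
    by simp
qed

text \<open>Along a real line, \<open>u + \<i> v\<close> is the derivative of \<phi> along
  \<open>V\<close>, \<open>p\<close> is t, and \<open>\<gamma>\<close> is g(V, V). As a function of
  t the exponent has first derivative \<open>- S\<close> and second derivative \<open>q\<close>. The
  maximality of a quotient is tested on a difference, so \<open>\<gamma>\<close> is never divided
  by.\<close>

lemma second_variation:
  fixes u v p \<gamma> u' v' p' \<gamma>' :: "real \<Rightarrow> real"
  assumes d: "0 < d"
    and du: "\<And>s. \<bar>s\<bar> < d \<Longrightarrow> (u has_real_derivative u' s) (at s)" "(u' has_real_derivative u2) (at 0)"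
    and dv: "\<And>s. \<bar>s\<bar> < d \<Longrightarrow> (v has_real_derivative v' s) (at s)" "(v' has_real_derivative v2) (at 0)"
    and dp: "\<And>s. \<bar>s\<bar> < d \<Longrightarrow> (p has_real_derivative p' s) (at s)" "(p' has_real_derivative p2) (at 0)"
    and dc: "\<And>s. \<bar>s\<bar> < d \<Longrightarrow> (\<gamma> has_real_derivative \<gamma>' s) (at s)" "(\<gamma>' has_real_derivative c2) (at 0)"
    and pos: "\<And>s. \<bar>s\<bar> < d \<Longrightarrow> 0 < p s"
    and max: "\<And>s. \<bar>s\<bar> < d \<Longrightarrow> (u s ^ 2 + v s ^ 2) * exp (- lam * p s + 1 / p s)
        \<le> \<rho>^2 * exp (- lam * p 0 + 1 / p 0) * \<gamma> s"
    and init: "u 0 = \<rho>" "0 < \<rho>" "v 0 = 0" "\<gamma> 0 = 1"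
  defines "S \<equiv> lam + 1 / (p 0)^2" and "q \<equiv> 2 / (p 0)^3"
  shows "2 * u' 0 = \<rho> * (S * p' 0 + \<gamma>' 0)"
    and "2 * \<rho> * u2 + 2 * (u' 0)^2 + 2 * (v' 0)^2 - 4 * \<rho> * u' 0 * S * p' 0
       + \<rho>^2 * (S^2 * (p' 0)^2 + q * (p' 0)^2 - S * p2 - c2) \<le> 0"
proof -
  define E where "E s = exp (- lam * p s + 1 / p s)" for s
  define W where "W = \<rho>^2 * E 0"
  define P where "P s = (u s ^ 2 + v s ^ 2) * E s - W * \<gamma> s" for s
  define E' where "E' s = E s * (- (lam + 1 / (p s)^2) * p' s)" for s
  define P' where "P' s = (2 * u s * u' s + 2 * v s * v' s) * E s + (u s ^ 2 + v s ^ 2) * E' s - W * \<gamma>' s" for s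
  have E: "(E has_real_derivative E' s) (at s)" if "\<bar>s\<bar> < d" for s
    unfolding E_def[abs_def] E'_def using dp(1)[OF that] pos[OF that]
    by (auto intro!: derivative_eq_intros simp: field_simps power2_eq_square)
  have z: "\<bar>0::real\<bar> < d" using d by simp
  have p0: "p 0 > 0" using pos[OF z] .
  define X where "X = E 0 * (S^2 * (p' 0)^2 + q * (p' 0)^2 - S * p2)"
  have E2: "(E' has_real_derivative X) (at 0)"
    unfolding E'_def[abs_def]
    using E[OF z] dp(1)[OF z] dp(2) p0
    by (auto intro!: derivative_eq_intros simp: X_def E'_def S_def q_def)
      (simp add: field_simps power2_eq_square power3_eq_cube power4_eq_xxxx)
  have P1: "(P has_real_derivative P' s) (at s)" if "\<bar>s\<bar> < d" for s
    unfolding P_def[abs_def] P'_def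
    by (rule derivative_eq_intros E[OF that] du(1)[OF that] dv(1)[OF that] dc(1)[OF that] refl)+ simp
  have P2: "(P' has_real_derivative ((2 * (u' 0)^2 + 2 * \<rho> * u2 + 2 * (v' 0)^2) * E 0
     + 2 * (2 * \<rho> * u' 0) * E' 0 + \<rho>^2 * X - W * c2)) (at 0)"
    unfolding P'_def[abs_def]
    by (rule derivative_eq_intros E[OF z] E2 du(1)[OF z] du(2) dv(1)[OF z] dv(2) dc(2) refl)+
      (simp add: init power2_eq_square algebra_simps)
  have mx: "P s \<le> P 0" if "\<bar>s\<bar> < d" for s
    using max[OF that] by (simp add: P_def W_def E_def init)
  note T = second_derivative_test[OF d P1 P2 mx]
  have E0: "E 0 > 0" by (simp add: E_def)
  have "E 0 * (2 * \<rho> * u' 0 - \<rho>^2 * (S * p' 0 + \<gamma>' 0)) = 0"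
    using T(1) by (simp add: P'_def E'_def W_def S_def init algebra_simps)
  then have "2 * \<rho> * u' 0 = \<rho>^2 * (S * p' 0 + \<gamma>' 0)" using E0 by simp
  then show "2 * u' 0 = \<rho> * (S * p' 0 + \<gamma>' 0)" using init(2) by (simp add: power2_eq_square)
  have "E 0 * (2 * \<rho> * u2 + 2 * (u' 0)^2 + 2 * (v' 0)^2 - 4 * \<rho> * u' 0 * S * p' 0
       + \<rho>^2 * (S^2 * (p' 0)^2 + q * (p' 0)^2 - S * p2 - c2)) \<le> 0"
    using T(2) by (simp add: X_def E'_def W_def S_def algebra_simps)
  then show "2 * \<rho> * u2 + 2 * (u' 0)^2 + 2 * (v' 0)^2 - 4 * \<rho> * u' 0 * S * p' 0
       + \<rho>^2 * (S^2 * (p' 0)^2 + q * (p' 0)^2 - S * p2 - c2) \<le> 0"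
    using E0 by (simp add: mult_le_0_iff)
qed

text \<open>The squares of \<open>u\<^sub>X\<close>, \<open>u\<^sub>Y\<close> cancel against the first-order conditions: this is the reason for using
  both real directions \<open>X = e\<close> and \<open>Y = \<i>e\<close>, with \<open>b = b\<^sub>1 + \<i> b\<^sub>2\<close> the deviation of \<open>u + \<i> v\<close> from being
  holomorphic.\<close>

lemma second_variation_combine:
  fixes \<rho> :: real
  assumes "0 < \<rho>"
    and X: "2 * uX = \<rho> * (S * pX + cX)"
      "2 * \<rho> * uXX + 2 * uX^2 + 2 * vX^2 - 4 * \<rho> * uX * S * pX + \<rho>^2 * (S^2 * pX^2 + q * pX^2 - S * pXX - cXX) \<le> 0"
    and Y: "2 * uY = \<rho> * (S * pY + cY)"
      "2 * \<rho> * uYY + 2 * uY^2 + 2 * vY^2 - 4 * \<rho> * uY * S * pY + \<rho>^2 * (S^2 * pY^2 + q * pY^2 - S * pYY - cYY) \<le> 0"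
    and b: "2 * b1 = uX - vY" "2 * b2 = vX + uY"
  shows "2 * (uXX + uYY) + \<rho> * (q * (pX^2 + pY^2) - S * (pXX + pYY) - (cXX + cYY))
     \<le> 4 * (b1 * (S * pX + cX) + b2 * (S * pY + cY))"
proof -
  have v: "vY = uX - 2 * b1" "vX = 2 * b2 - uY" using b by auto
  have u: "uX = \<rho> * (S * pX + cX) / 2" "uY = \<rho> * (S * pY + cY) / 2" using X(1) Y(1) by auto
  \<comment> \<open>An exact identity: the sum of the two second-order conditions is
    \<open>\<rho>\<close> times the claim plus squares, which are then dropped.\<close>
  have "\<rho> * (2 * (uXX + uYY) + \<rho> * (q * (pX^2 + pY^2) - S * (pXX + pYY) - (cXX + cYY))
     - 4 * (b1 * (S * pX + cX) + b2 * (S * pY + cY))) + \<rho>^2 * (cX^2 + cY^2) + 8 * (b1^2 + b2^2) =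
    (2 * \<rho> * uXX + 2 * uX^2 + 2 * vX^2 - 4 * \<rho> * uX * S * pX + \<rho>^2 * (S^2 * pX^2 + q * pX^2 - S * pXX - cXX)) +
    (2 * \<rho> * uYY + 2 * uY^2 + 2 * vY^2 - 4 * \<rho> * uY * S * pY + \<rho>^2 * (S^2 * pY^2 + q * pY^2 - S * pYY - cYY))"
    unfolding v u by (simp add: field_simps power2_eq_square)
  also have "\<dots> \<le> 0" using X(2) Y(2) by linarith
  finally have le: "\<rho> * (2 * (uXX + uYY) + \<rho> * (q * (pX^2 + pY^2) - S * (pXX + pYY) - (cXX + cYY))
     - 4 * (b1 * (S * pX + cX) + b2 * (S * pY + cY))) + \<rho>^2 * (cX^2 + cY^2) + 8 * (b1^2 + b2^2) \<le> 0" .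
  have "\<rho> * (2 * (uXX + uYY) + \<rho> * (q * (pX^2 + pY^2) - S * (pXX + pYY) - (cXX + cYY))
     - 4 * (b1 * (S * pX + cX) + b2 * (S * pY + cY))) \<le> 0"
  proof -
    have "0 \<le> \<rho>^2 * (cX^2 + cY^2)" "0 \<le> 8 * (b1^2 + b2^2)" by simp_all
    then show ?thesis using le by linarith
  qed
  then show ?thesis using assms(1) by (simp add: mult_le_0_iff)
qed

lemma dzdir_frame:
  fixes u :: "complex^'n::finite \<Rightarrow> real"
  assumes "u differentiable (at x)" "frame g e"
  shows "dzdir V u x = (\<Sum>k\<in>UNIV. sesq g V (e k) * dzdir (e k) u x)"
proof -
  have "V $ i = (\<Sum>k\<in>UNIV. sesq g V (e k) * e k $ i)" for i
    using arg_cong[OF frame_expand[OF assms(2), of V], of "\<lambda>v. v $ i"] by simp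
  then have "dzdir V u x = (\<Sum>i\<in>UNIV. (\<Sum>k\<in>UNIV. sesq g V (e k) * e k $ i) * d_dz i (\<lambda>y. complex_of_real (u y)) x)"
    unfolding dzdir_sum[OF assms(1), symmetric] by metis
  also have "\<dots> = (\<Sum>k\<in>UNIV. sesq g V (e k) * (\<Sum>i\<in>UNIV. e k $ i * d_dz i (\<lambda>y. complex_of_real (u y)) x))"
    unfolding sum_distrib_left sum_distrib_right mult.assoc by (rule sum.swap)
  finally show ?thesis unfolding dzdir_sum[OF assms(1)] .
qed

lemma frame_coeff_norm:
  assumes "frame g e" "hermitian_matrix g"
  shows "(\<Sum>k\<in>UNIV. norm (sesq g V (e k)) ^ 2) = Re (sesq g V V)"
proof -
  have "sesq g V V = (\<Sum>k\<in>UNIV. of_real (norm (sesq g V (e k)) ^ 2))"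
    unfolding frame_parseval[OF assms, of V V] by (simp only: complex_norm_square)
  then show ?thesis by (simp del: of_real_power)
qed

lemma dzdir_norm_le_frame:
  fixes u :: "complex^'n::finite \<Rightarrow> real"
  assumes "u differentiable (at x)" "frame g e" "hermitian_matrix g"
  shows "norm (dzdir V u x) ^ 2 \<le> Re (sesq g V V) * (\<Sum>k\<in>UNIV. norm (dzdir (e k) u x) ^ 2)"
proof -
  have "norm (dzdir V u x) \<le> (\<Sum>k\<in>UNIV. norm (sesq g V (e k)) * norm (dzdir (e k) u x))"
    unfolding dzdir_frame[OF assms(1,2), of V] by (intro order_trans[OF norm_sum]) (simp add: norm_mult)
  then have "norm (dzdir V u x) ^ 2 \<le> (\<Sum>k\<in>UNIV. norm (sesq g V (e k)) * norm (dzdir (e k) u x)) ^ 2"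
    by (intro power_mono) auto
  also have "\<dots> \<le> (\<Sum>k\<in>UNIV. norm (sesq g V (e k)) ^ 2) * (\<Sum>k\<in>UNIV. norm (dzdir (e k) u x) ^ 2)"
    by (rule Cauchy_Schwarz_ineq_sum)
  finally show ?thesis unfolding frame_coeff_norm[OF assms(2,3)] .
qed

lemma norm_dzdir_square: "norm (dzdir V u x) ^ 2 = (dd V u x / 2)^2 + (dd (imul V) u x / 2)^2"
  by (simp add: dzdir_def cmod_power2)

lemma sesq_imul: "sesq h (imul V) (imul U) = sesq h V U"
  by (simp add: sesq_scale_left sesq_scale_right complex_eq_iff)

text \<open>The maximum property is restricted to a real segment through \<open>x\<close>. Later
  \<open>a\<close> runs through \<open>e k\<close> and \<open>imul (e k)\<close>.\<close>

lemma max_point_direction: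
  fixes \<phi> \<gamma> :: "complex^'n::finite \<Rightarrow> real"
  assumes S: "open S" "x \<in> S" and sm: "smooth_on \<phi> S" "smooth_on \<gamma> S"
    and V: "dzdir V \<phi> x = of_real \<rho>" "0 < \<rho>" and \<gamma>: "\<gamma> x = 1"
    and t: "t = \<phi> x - m + 1"
    and pos: "\<And>y. y \<in> S \<Longrightarrow> 0 < \<phi> y - m + 1"
    and max: "\<And>y. y \<in> S \<Longrightarrow> norm (dzdir V \<phi> y) ^ 2 * exp (- lam * (\<phi> y - m + 1) + 1 / (\<phi> y - m + 1))
       \<le> \<rho>^2 * exp (- lam * t + 1 / t) * \<gamma> y"
  defines "Q \<equiv> lam + 1 / t^2" and "q \<equiv> 2 / t^3"
    and "u \<equiv> (\<lambda>y. dd V \<phi> y / 2)" and "v \<equiv> (\<lambda>y. - dd (imul V) \<phi> y / 2)"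
  shows "2 * dd a u x = \<rho> * (Q * dd a \<phi> x + dd a \<gamma> x)"
    and "2 * \<rho> * dd a (dd a u) x + 2 * (dd a u x)^2 + 2 * (dd a v x)^2 - 4 * \<rho> * dd a u x * Q * dd a \<phi> x
       + \<rho>^2 * (Q^2 * (dd a \<phi> x)^2 + q * (dd a \<phi> x)^2 - Q * dd a (dd a \<phi>) x - dd a (dd a \<gamma>) x) \<le> 0"
proof -
  have su: "smooth_on u S" and sv: "smooth_on v S"
    unfolding u_def v_def
    using smooth_on_bounded_linear[OF S(1) bounded_linear_mult_right[of "1/2::real"] smooth_on_dd[OF sm(1), of V]]
      smooth_on_bounded_linear[OF S(1) bounded_linear_mult_right[of "-1/2::real"] smooth_on_dd[OF sm(1), of "imul V"]]
    by simp_all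
  obtain d0 where d0: "0 < d0" "ball x d0 \<subseteq> S" using S by (meson openE)
  define d where "d = d0 / (norm a + 1)"
  have na: "0 < norm a + 1" by (simp add: add_nonneg_pos)
  have d: "0 < d" using d0 na by (simp add: d_def)
  have inS: "x + s *\<^sub>R a \<in> S" if "\<bar>s\<bar> < d" for s
  proof -
    have "\<bar>s\<bar> * norm a \<le> \<bar>s\<bar> * (norm a + 1)" by (simp add: mult_left_mono)
    also have "\<dots> < d * (norm a + 1)" using that na by (simp add: mult_strict_right_mono)
    also have "\<dots> = d0" using na by (simp add: d_def)
    finally show ?thesis using d0(2) by (auto simp: mem_ball dist_norm)
  qed
  have D1: "((\<lambda>s. w (x + s *\<^sub>R a)) has_real_derivative dd a w (x + s *\<^sub>R a)) (at s)"
    if "smooth_on w S" "\<bar>s\<bar> < d" for s and w :: "complex^'n \<Rightarrow> real"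
    by (rule dd_line_real[OF smooth_on_imp_differentiable[OF that(1) inS[OF that(2)]]])
  have D2: "((\<lambda>s. dd a w (x + s *\<^sub>R a)) has_real_derivative dd a (dd a w) x) (at 0)"
    if "smooth_on w S" for w :: "complex^'n \<Rightarrow> real"
    using D1[OF smooth_on_dd[OF that], of 0] d by simp
  have p1: "((\<lambda>s. \<phi> (x + s *\<^sub>R a) - m + 1) has_real_derivative dd a \<phi> (x + s *\<^sub>R a)) (at s)" if "\<bar>s\<bar> < d" for s
    using D1[OF sm(1) that] by (auto intro!: derivative_eq_intros)
  have mx: "(u (x + s *\<^sub>R a) ^ 2 + v (x + s *\<^sub>R a) ^ 2) * exp (- lam * (\<phi> (x + s *\<^sub>R a) - m + 1) + 1 / (\<phi> (x + s *\<^sub>R a) - m + 1))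
      \<le> \<rho>^2 * exp (- lam * (\<phi> (x + 0 *\<^sub>R a) - m + 1) + 1 / (\<phi> (x + 0 *\<^sub>R a) - m + 1)) * \<gamma> (x + s *\<^sub>R a)" if "\<bar>s\<bar> < d" for s
    using max[OF inS[OF that]] unfolding norm_dzdir_square u_def v_def t by simp
  have init: "u (x + 0 *\<^sub>R a) = \<rho>" "0 < \<rho>" "v (x + 0 *\<^sub>R a) = 0" "\<gamma> (x + 0 *\<^sub>R a) = 1"
    using V \<gamma> unfolding u_def v_def dzdir_def by (auto simp: complex_eq_iff)
  note T = second_variation[OF d D1[OF su] D2[OF su] D1[OF sv] D2[OF sv] p1 D2[OF sm(1)] D1[OF sm(2)] D2[OF sm(2)]
      pos[OF inS] mx init]
  show "2 * dd a u x = \<rho> * (Q * dd a \<phi> x + dd a \<gamma> x)"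
    using T(1) by (simp add: Q_def t)
  show "2 * \<rho> * dd a (dd a u) x + 2 * (dd a u x)^2 + 2 * (dd a v x)^2 - 4 * \<rho> * dd a u x * Q * dd a \<phi> x
       + \<rho>^2 * (Q^2 * (dd a \<phi> x)^2 + q * (dd a \<phi> x)^2 - Q * dd a (dd a \<phi>) x - dd a (dd a \<gamma>) x) \<le> 0"
    using T(2) by (simp add: Q_def q_def t)
qed

text \<open>All background quantities that enter the computation at a maximum point; \<phi> is not
  among them. The vectors are normalized by \<open>g\<close> and not by the coordinate norm because
  they will come from \<open>g\<close>-orthonormal frames.\<close>

definition unit_bound ::
    "(complex^'n::finite \<Rightarrow> complex^'n^'n) \<Rightarrow> (complex^'n \<Rightarrow> complex^'n^'n) \<Rightarrow> (complex^'n \<Rightarrow> real) \<Rightarrow>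
      complex^'n \<Rightarrow> real \<Rightarrow> bool" where
  "unit_bound g chi f x \<Lambda> \<longleftrightarrow> (\<forall>V a. Re (sesq (g x) V V) = 1 \<longrightarrow> Re (sesq (g x) a a) = 1 \<longrightarrow>
        \<bar>dd a (\<lambda>y. Re (sesq (g y) V V)) x\<bar> \<le> \<Lambda> \<and> \<bar>dd a (dd a (\<lambda>y. Re (sesq (g y) V V))) x\<bar> \<le> \<Lambda> \<and>
        \<bar>dd a (\<lambda>y. Re (sesq (chi y) V V)) x\<bar> \<le> \<Lambda> \<and> \<bar>dd a f x\<bar> \<le> \<Lambda> \<and> norm (sesq (chi x) V a) \<le> \<Lambda>)"

text \<open>The inequality obtained from the second variation at a maximum point: \<open>1/\<mu>\<^sub>k\<close> are the eigenvalues of \<open>\<chi>\<^sub>\<phi>\<close>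
  and \<open>a\<^sub>k\<close> the diagonal entries of \<open>\<chi>\<close>, relative to \<open>\<omega>\<close>, \<open>r\<^sub>k = |\<partial>\<^sub>k \<phi>|\<close>, \<open>\<rho> = |\<nabla>\<phi>|\<close> and \<open>t = \<phi> - m + 1\<close>.\<close>

definition max_point_ineq ::
    "real \<Rightarrow> real \<Rightarrow> real \<Rightarrow> real \<Rightarrow> ('n::finite \<Rightarrow> real) \<Rightarrow> ('n \<Rightarrow> real) \<Rightarrow> ('n \<Rightarrow> real) \<Rightarrow> bool" where
  "max_point_ineq \<Lambda> lam \<rho> t \<mu> a r \<longleftrightarrow>
     (lam + 1/t^2) * ((\<Sum>k\<in>UNIV. \<mu> k ^ 2 * a k) - sum \<mu> UNIV) + 2/t^3 * (\<Sum>k\<in>UNIV. \<mu> k ^ 2 * r k ^ 2)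
       \<le> \<Lambda>/2 * (\<Sum>k\<in>UNIV. \<mu> k ^ 2) + \<Lambda>/\<rho> * (sum \<mu> UNIV + 1 + (\<Sum>k\<in>UNIV. \<mu> k ^ 2))
         + 2 * \<Lambda> / \<rho> * (sum \<mu> UNIV + \<Lambda> * (\<Sum>k\<in>UNIV. \<mu> k ^ 2))
         + 2 * (lam + 1/t^2) / \<rho> * (\<Sum>k\<in>UNIV. (\<mu> k + \<Lambda> * \<mu> k ^ 2) * r k)"

text \<open>In each direction of the diagonalizing frame two real second variations are added. Their
  third derivatives of \<phi> form the derivative along \<open>V\<close> of a Hessian entry, that
  is, of \<open>H\<close> minus \<open>chi\<close>. Weighting with \<open>\<mu> k ^ 2\<close> and
  summing allows \<open>trace_derivative\<close> to replace the part with \<open>H\<close> by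
  derivatives of \<open>g\<close> and \<open>f\<close>.\<close>

lemma max_point_inequality:
  fixes g chi H :: "complex^'n::finite \<Rightarrow> complex^'n^'n" and f \<phi> :: "complex^'n \<Rightarrow> real"
  assumes S: "open S" "x \<in> S"
    and smg: "\<And>i j. smooth_on (\<lambda>y. g y $ i $ j) S" and smc: "\<And>i j. smooth_on (\<lambda>y. chi y $ i $ j) S"
    and smf: "smooth_on f S" and sm\<phi>: "smooth_on \<phi> S"
    and pg: "\<And>y. y \<in> S \<Longrightarrow> pos_def (g y)" and pH: "\<And>y. y \<in> S \<Longrightarrow> pos_def (H y)"
    and H: "\<And>y V U. y \<in> S \<Longrightarrow> sesq (H y) V U = sesq (chi y) V U + chess \<phi> y V U"
    and tr: "\<And>y \<epsilon>. y \<in> S \<Longrightarrow> frame (H y) \<epsilon> \<Longrightarrow> (\<Sum>k\<in>UNIV. sesq (g y) (\<epsilon> k) (\<epsilon> k)) = of_real (f y)"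
    and ub: "unit_bound g chi f x \<Lambda>"
    and V: "Re (sesq (g x) V V) = 1" "dzdir V \<phi> x = of_real \<rho>" "0 < \<rho>"
    and lam: "0 < lam"
    and t: "t = \<phi> x - m + 1"
    and pos: "\<And>y. y \<in> S \<Longrightarrow> 0 < \<phi> y - m + 1"
    and max: "\<And>y. y \<in> S \<Longrightarrow> norm (dzdir V \<phi> y) ^ 2 * exp (- lam * (\<phi> y - m + 1) + 1 / (\<phi> y - m + 1))
       \<le> \<rho>^2 * exp (- lam * t + 1 / t) * Re (sesq (g y) V V)"
  shows "\<exists>(\<mu>::'n \<Rightarrow> real) e. frame (g x) e \<and> (\<forall>k. 0 < \<mu> k) \<and> sum \<mu> UNIV = f x \<and>
     \<rho>^2 \<le> (\<Sum>k\<in>UNIV. norm (dzdir (e k) \<phi> x) ^ 2) \<and>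
     max_point_ineq \<Lambda> lam \<rho> t \<mu> (\<lambda>k. Re (sesq (chi x) (e k) (e k))) (\<lambda>k. norm (dzdir (e k) \<phi> x))"
proof -
  note \<Lambda> = ub[unfolded unit_bound_def, rule_format]
  have hg: "hermitian_matrix (g x)" using pg[OF S(2)] by (simp add: pos_def_def)
  obtain e \<mu> where e: "frame (g x) e" and \<mu>: "\<And>k. 0 < \<mu> k"
    and diag: "\<And>k l. sesq (H x) (e k) (e l) = (if k = l then of_real (1 / \<mu> k) else 0)"
    using simultaneous_diagonalization[OF pg pH, OF S(2) S(2)] by metis
  define Q where "Q = lam + 1 / t^2"
  define q where "q = 2 / t^3"
  define \<gamma> where "\<gamma> y = Re (sesq (g y) V V)" for y
  define u where "u y = dd V \<phi> y / 2" for y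
  define v where "v y = - dd (imul V) \<phi> y / 2" for y
  have t0: "0 < t" using pos[OF S(2)] by (simp add: t)
  have Q: "0 < Q" using lam t0 by (simp add: Q_def add_pos_nonneg)
  have sgVU: "smooth_on (\<lambda>y. sesq (g y) W U) S" for W U by (rule smooth_on_sesq[OF S(1) smg])
  have scVU: "smooth_on (\<lambda>y. sesq (chi y) W U) S" for W U by (rule smooth_on_sesq[OF S(1) smc])
  have sHVU: "smooth_on (\<lambda>y. sesq (H y) W U) S" for W U
  proof -
    have "smooth_on (\<lambda>y. sesq (H y) W U) S = smooth_on (\<lambda>y. sesq (chi y) W U + chess \<phi> y W U) S"
      by (rule smooth_on_cong[OF S(1) H])
    then show ?thesis using smooth_on_add[OF S(1) scVU smooth_on_chess[OF S(1) sm\<phi>]] by blast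
  qed
  have s\<gamma>: "smooth_on \<gamma> S" unfolding \<gamma>_def[abs_def] by (rule smooth_on_Re[OF S(1) sgVU])
  have \<gamma>x: "\<gamma> x = 1" using V by (simp add: \<gamma>_def)
  note dif = smooth_on_imp_differentiable[OF _ S(2)]
  have TD1: "sum \<mu> UNIV = f x"
    by (rule trace_derivative(1)[OF S pg pH dif[OF sgVU] dif[OF sHVU] dif[OF smf] tr e \<mu> diag])
  have TD2: "(\<Sum>k\<in>UNIV. \<mu> k ^ 2 * dd V (\<lambda>y. Re (sesq (H y) (e k) (e k))) x)
       = (\<Sum>k\<in>UNIV. \<mu> k * dd V (\<lambda>y. Re (sesq (g y) (e k) (e k))) x) - dd V f x"
    by (rule trace_derivative(2)[OF S pg pH dif[OF sgVU] dif[OF sHVU] dif[OF smf] tr e \<mu> diag])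
  note MD = max_point_direction[OF S sm\<phi> s\<gamma> V(2,3) \<gamma>x t pos max[folded \<gamma>_def],
      folded Q_def q_def u_def[abs_def] v_def[abs_def]]
  define a where "a k = Re (sesq (chi x) (e k) (e k))" for k
  define r where "r k = norm (dzdir (e k) \<phi> x)" for k
  define h' where "h' k = dd V (\<lambda>y. Re (sesq (H y) (e k) (e k))) x" for k
  define c' where "c' k = dd V (\<lambda>y. Re (sesq (chi y) (e k) (e k))) x" for k
  have unit: "Re (sesq (g x) (e k) (e k)) = 1" "Re (sesq (g x) (imul (e k)) (imul (e k))) = 1" for k
    using e by (simp_all add: sesq_imul frame_def)
  have key: "(h' k - c' k) + \<rho> * (q * r k ^ 2 - Q * (1 / \<mu> k - a k)) \<le> \<rho> * \<Lambda> / 2 + 2 * (1 / \<mu> k + \<Lambda>) * (\<Lambda> + Q * r k)" for k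
  proof -
    let ?X = "e k" and ?Y = "imul (e k)"
    have du: "dd b (dd c \<phi>) x = dd c (dd b \<phi>) x" for b c by (rule dd_commute[OF S(1) sm\<phi> S(2)])
    have half: "dd b (\<lambda>y. w y / 2) y = dd b w y / 2" "dd b (\<lambda>y. - w y / 2) y = - dd b w y / 2"
      if "w differentiable (at y)" for b and w :: "complex^'n \<Rightarrow> real" and y
      using dd_bounded_linear[OF bounded_linear_mult_right[of "1/2::real"] that, of b]
        dd_bounded_linear[OF bounded_linear_mult_right[of "-1/2::real"] that, of b] by simp_all
    have u1: "dd b u y = dd b (dd V \<phi>) y / 2" "dd b v y = - dd b (dd (imul V) \<phi>) y / 2" if "y \<in> S" for b y
      unfolding u_def[abs_def] v_def[abs_def]
      using half[OF smooth_on_imp_differentiable[OF smooth_on_dd[OF sm\<phi>] that]] by auto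
    \<comment> \<open>Two exchanges bring \<open>V\<close> to the outside of the third derivative,
      as needed for the comparison with \<open>h' k\<close>.\<close>
    have u2: "dd b (dd b u) x = dd V (dd b (dd b \<phi>)) x / 2" for b
    proof -
      have "dd b (dd b u) x = dd b (\<lambda>y. dd V (dd b \<phi>) y / 2) x"
        by (rule dd_cong[OF S]) (simp add: u1 dd_commute[OF S(1) sm\<phi>, of _ b V])
      also have "\<dots> = dd b (dd V (dd b \<phi>)) x / 2"
        by (rule half(1)) (intro dif smooth_on_dd sm\<phi>)
      also have "dd b (dd V (dd b \<phi>)) x = dd V (dd b (dd b \<phi>)) x"
        by (rule dd_commute[OF S(1) smooth_on_dd[OF sm\<phi>] S(2)])
      finally show ?thesis .
    qed
    have uu: "dd ?X (dd ?X u) x + dd ?Y (dd ?Y u) x = 2 * (h' k - c' k)"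
    proof -
      have "h' k = dd V (\<lambda>y. Re (sesq (chi y) ?X ?X) + (dd ?X (dd ?X \<phi>) y + dd ?Y (dd ?Y \<phi>) y) * (1/4)) x"
        unfolding h'_def by (rule dd_cong[OF S]) (simp add: H chess_def)
      also have "\<dots> = c' k + dd V (\<lambda>y. (dd ?X (dd ?X \<phi>) y + dd ?Y (dd ?Y \<phi>) y) * (1/4)) x"
        unfolding c'_def by (intro dd_add differentiable_mult differentiable_add differentiable_const dif smooth_on_dd sm\<phi> smooth_on_Re[OF S(1) scVU])
      also have "dd V (\<lambda>y. (dd ?X (dd ?X \<phi>) y + dd ?Y (dd ?Y \<phi>) y) * (1/4)) x
          = dd V (\<lambda>y. dd ?X (dd ?X \<phi>) y + dd ?Y (dd ?Y \<phi>) y) x * (1/4)"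
        by (rule dd_bounded_linear[OF bounded_linear_mult_left]) (intro differentiable_add dif smooth_on_dd sm\<phi>)
      also have "dd V (\<lambda>y. dd ?X (dd ?X \<phi>) y + dd ?Y (dd ?Y \<phi>) y) x = dd V (dd ?X (dd ?X \<phi>)) x + dd V (dd ?Y (dd ?Y \<phi>)) x"
        by (intro dd_add dif smooth_on_dd sm\<phi>)
      finally show ?thesis by (simp add: u2)
    qed
    \<comment> \<open>The deviation of \<partial>_V \<phi> from being holomorphic in direction
      \<open>e k\<close>. It is a Hessian entry, so no third derivative enters here.\<close>
    define \<beta> where "\<beta> = chess \<phi> x V ?X"
    have b: "2 * Re \<beta> = dd ?X u x - dd ?Y v x" "2 * Im \<beta> = dd ?X v x + dd ?Y u x"
      unfolding \<beta>_def chess_def u1[OF S(2)] by (simp_all add: du[of V] du[of "imul V"])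
    note C = second_variation_combine[OF V(3) MD(1)[of ?X] MD(2)[of ?X] MD(1)[of ?Y] MD(2)[of ?Y] b]
    have p2: "(dd ?X \<phi> x)^2 + (dd ?Y \<phi> x)^2 = 4 * r k ^ 2"
      unfolding r_def norm_dzdir_square by (simp add: power_divide)
    have pp: "dd ?X (dd ?X \<phi>) x + dd ?Y (dd ?Y \<phi>) x = 4 * (1 / \<mu> k - a k)"
      using H[OF S(2), of ?X ?X] by (simp add: diag a_def chess_def complex_eq_iff)
    have cc: "dd ?X (dd ?X \<gamma>) x + dd ?Y (dd ?Y \<gamma>) x \<le> 2 * \<Lambda>"
      using \<Lambda>[OF V(1) unit(1)[of k]] \<Lambda>[OF V(1) unit(2)[of k]] unfolding \<gamma>_def[abs_def] by linarith
    have c1: "\<bar>dd ?X \<gamma> x\<bar> \<le> \<Lambda>" "\<bar>dd ?Y \<gamma> x\<bar> \<le> \<Lambda>"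
      using \<Lambda>[OF V(1) unit(1)[of k]] \<Lambda>[OF V(1) unit(2)[of k]] unfolding \<gamma>_def[abs_def] by auto
    have \<Lambda>0: "0 \<le> \<Lambda>" using c1 by linarith
    \<comment> \<open>\<open>H\<close> is diagonal in the frame, so its entry at \<open>V\<close>
      and \<open>e k\<close> is at most \<open>1 / \<mu> k\<close>, which is harmless after
      multiplication by \<open>\<mu> k ^ 2\<close>.\<close>
    have nb: "norm \<beta> \<le> 1 / \<mu> k + \<Lambda>"
    proof -
      have "sesq (H x) V ?X = sesq (H x) (\<Sum>l\<in>UNIV. sesq (g x) V (e l) *s e l) ?X"
        using frame_expand[OF e, of V] by simp
      also have "\<dots> = sesq (g x) V ?X * of_real (1 / \<mu> k)"
        by (simp add: sesq_sum_left sesq_scale_left diag if_distrib cong: if_cong del: of_real_divide)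
      finally have "norm (sesq (H x) V ?X) = norm (sesq (g x) V ?X) * (1 / \<mu> k)"
        using \<mu>[of k] by (simp add: norm_mult norm_divide)
      moreover have "norm (sesq (g x) V ?X) \<le> 1"
      proof -
        have "norm (sesq (g x) V ?X) ^ 2 \<le> (\<Sum>l\<in>UNIV. norm (sesq (g x) V (e l)) ^ 2)"
          by (rule member_le_sum[of k UNIV "\<lambda>l. norm (sesq (g x) V (e l)) ^ 2"]) auto
        then have "norm (sesq (g x) V ?X) ^ 2 \<le> 1^2" unfolding frame_coeff_norm[OF e hg] using V by simp
        then show ?thesis by (rule power2_le_imp_le) simp
      qed
      ultimately have "norm (sesq (H x) V ?X) \<le> 1 / \<mu> k" using \<mu>[of k] by (simp add: divide_right_mono)
      moreover have "norm (sesq (chi x) V ?X) \<le> \<Lambda>" using \<Lambda>[OF V(1) unit(1)[of k]] by blast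
      moreover have "norm \<beta> \<le> norm (sesq (H x) V ?X) + norm (sesq (chi x) V ?X)"
        using norm_triangle_ineq4[of "sesq (H x) V ?X" "sesq (chi x) V ?X"] H[OF S(2), of V ?X]
        by (simp add: \<beta>_def)
      ultimately show ?thesis by linarith
    qed
    have rb: "Re \<beta> * (Q * dd ?X \<phi> x + dd ?X \<gamma> x) + Im \<beta> * (Q * dd ?Y \<phi> x + dd ?Y \<gamma> x) \<le> norm \<beta> * (2 * (\<Lambda> + Q * r k))"
    proof -
      define z where "z = dzdir (e k) \<phi> x"
      have "Re \<beta> * dd ?X \<phi> x + Im \<beta> * dd ?Y \<phi> x = 2 * Re (\<beta> * z)"
        by (simp add: z_def dzdir_def)
      also have "\<dots> \<le> 2 * (norm \<beta> * norm z)" using complex_Re_le_cmod[of "\<beta> * z"] by (simp add: norm_mult)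
      finally have 1: "Re \<beta> * dd ?X \<phi> x + Im \<beta> * dd ?Y \<phi> x \<le> 2 * (norm \<beta> * r k)" by (simp add: z_def r_def)
      have "Re \<beta> * dd ?X \<gamma> x \<le> \<bar>Re \<beta>\<bar> * \<bar>dd ?X \<gamma> x\<bar>" "Im \<beta> * dd ?Y \<gamma> x \<le> \<bar>Im \<beta>\<bar> * \<bar>dd ?Y \<gamma> x\<bar>"
        by (metis abs_ge_self abs_mult)+
      moreover have "\<bar>Re \<beta>\<bar> * \<bar>dd ?X \<gamma> x\<bar> \<le> norm \<beta> * \<Lambda>" "\<bar>Im \<beta>\<bar> * \<bar>dd ?Y \<gamma> x\<bar> \<le> norm \<beta> * \<Lambda>"
        using c1 by (auto intro!: mult_mono abs_Re_le_cmod abs_Im_le_cmod)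
      ultimately have 2: "Re \<beta> * dd ?X \<gamma> x + Im \<beta> * dd ?Y \<gamma> x \<le> 2 * (norm \<beta> * \<Lambda>)" by linarith
      have "Q * (Re \<beta> * dd ?X \<phi> x + Im \<beta> * dd ?Y \<phi> x) \<le> Q * (2 * (norm \<beta> * r k))"
        using 1 Q by (intro mult_left_mono) auto
      then show ?thesis using 2 by (simp add: algebra_simps)
    qed
    have nb': "norm \<beta> * (2 * (\<Lambda> + Q * r k)) \<le> (1 / \<mu> k + \<Lambda>) * (2 * (\<Lambda> + Q * r k))"
      using nb \<Lambda>0 Q by (intro mult_right_mono) (auto simp: r_def)
    have "2 * (2 * (h' k - c' k)) + \<rho> * (q * (4 * r k ^ 2) - Q * (4 * (1 / \<mu> k - a k)) - (dd ?X (dd ?X \<gamma>) x + dd ?Y (dd ?Y \<gamma>) x))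
      \<le> 4 * (Re \<beta> * (Q * dd ?X \<phi> x + dd ?X \<gamma> x) + Im \<beta> * (Q * dd ?Y \<phi> x + dd ?Y \<gamma> x))"
      by (rule C[unfolded uu p2 pp])
    also have "\<dots> \<le> 4 * ((1 / \<mu> k + \<Lambda>) * (2 * (\<Lambda> + Q * r k)))"
      by (rule mult_left_mono[OF order_trans[OF rb nb']]) simp
    finally have "2 * (2 * (h' k - c' k)) + \<rho> * (q * (4 * r k ^ 2) - Q * (4 * (1 / \<mu> k - a k)) - (dd ?X (dd ?X \<gamma>) x + dd ?Y (dd ?Y \<gamma>) x))
      \<le> 4 * ((1 / \<mu> k + \<Lambda>) * (2 * (\<Lambda> + Q * r k)))" .
    moreover have "\<rho> * (dd ?X (dd ?X \<gamma>) x + dd ?Y (dd ?Y \<gamma>) x) \<le> \<rho> * (2 * \<Lambda>)"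
      using cc V(3) by (intro mult_left_mono) auto
    moreover define \<iota> where "\<iota> = 1 / \<mu> k"
    ultimately show ?thesis unfolding \<iota>_def[symmetric] by (simp add: algebra_simps)
  qed
  define \<sigma> where "\<sigma> = sum \<mu> UNIV"
  define T where "T = (\<Sum>k\<in>UNIV. \<mu> k ^ 2)"
  have key2: "\<mu> k ^ 2 * h' k / \<rho> - \<mu> k ^ 2 * c' k / \<rho> + q * (\<mu> k ^ 2 * r k ^ 2) + Q * (\<mu> k ^ 2 * a k) - Q * \<mu> k
     \<le> \<Lambda> / 2 * \<mu> k ^ 2 + 2 * \<Lambda> / \<rho> * (\<mu> k + \<Lambda> * \<mu> k ^ 2) + 2 * Q / \<rho> * ((\<mu> k + \<Lambda> * \<mu> k ^ 2) * r k)" for k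
  proof -
    have "(\<mu> k ^ 2 / \<rho>) * ((h' k - c' k) + \<rho> * (q * r k ^ 2 - Q * (1 / \<mu> k - a k)))
       \<le> (\<mu> k ^ 2 / \<rho>) * (\<rho> * \<Lambda> / 2 + 2 * (1 / \<mu> k + \<Lambda>) * (\<Lambda> + Q * r k))"
      using key[of k] V(3) by (intro mult_left_mono) auto
    moreover have "(\<mu> k ^ 2 / \<rho>) * ((h' k - c' k) + \<rho> * (q * r k ^ 2 - Q * (1 / \<mu> k - a k)))
       = \<mu> k ^ 2 * h' k / \<rho> - \<mu> k ^ 2 * c' k / \<rho> + q * (\<mu> k ^ 2 * r k ^ 2) + Q * (\<mu> k ^ 2 * a k) - Q * \<mu> k"
      using \<mu>[of k] V(3) by (simp add: field_simps power2_eq_square)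
    moreover have "(\<mu> k ^ 2 / \<rho>) * (\<rho> * \<Lambda> / 2 + 2 * (1 / \<mu> k + \<Lambda>) * (\<Lambda> + Q * r k))
       = \<Lambda> / 2 * \<mu> k ^ 2 + 2 * \<Lambda> / \<rho> * (\<mu> k + \<Lambda> * \<mu> k ^ 2) + 2 * Q / \<rho> * ((\<mu> k + \<Lambda> * \<mu> k ^ 2) * r k)"
      using \<mu>[of k] V(3) by (simp add: field_simps power2_eq_square)
    ultimately show ?thesis by linarith
  qed
  have "(\<Sum>k\<in>UNIV. \<mu> k ^ 2 * h' k / \<rho> - \<mu> k ^ 2 * c' k / \<rho> + q * (\<mu> k ^ 2 * r k ^ 2) + Q * (\<mu> k ^ 2 * a k) - Q * \<mu> k)
     \<le> (\<Sum>k\<in>UNIV. \<Lambda> / 2 * \<mu> k ^ 2 + 2 * \<Lambda> / \<rho> * (\<mu> k + \<Lambda> * \<mu> k ^ 2) + 2 * Q / \<rho> * ((\<mu> k + \<Lambda> * \<mu> k ^ 2) * r k))"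
    by (intro sum_mono key2)
  then have sumd: "(\<Sum>k\<in>UNIV. \<mu> k ^ 2 * h' k) / \<rho> - (\<Sum>k\<in>UNIV. \<mu> k ^ 2 * c' k) / \<rho> + q * (\<Sum>k\<in>UNIV. \<mu> k ^ 2 * r k ^ 2)
       + Q * (\<Sum>k\<in>UNIV. \<mu> k ^ 2 * a k) - Q * \<sigma>
     \<le> \<Lambda> / 2 * T + 2 * \<Lambda> / \<rho> * (\<sigma> + \<Lambda> * T) + 2 * Q / \<rho> * (\<Sum>k\<in>UNIV. (\<mu> k + \<Lambda> * \<mu> k ^ 2) * r k)"
    by (simp only: sum.distrib sum_subtractf sum_distrib_left[symmetric] sum_divide_distrib[symmetric] \<sigma>_def T_def)
  \<comment> \<open>Here the differentiated equation \<open>TD2\<close> eliminates the third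
    derivatives of \<phi>.\<close>
  have "- (\<Lambda> * (\<sigma> + 1)) \<le> (\<Sum>k\<in>UNIV. \<mu> k ^ 2 * h' k)"
  proof -
    have "- (\<Lambda> * \<sigma>) = (\<Sum>k\<in>UNIV. \<mu> k * (- \<Lambda>))" unfolding \<sigma>_def sum_distrib_right[symmetric] by simp
    also have "\<dots> \<le> (\<Sum>k\<in>UNIV. \<mu> k * dd V (\<lambda>y. Re (sesq (g y) (e k) (e k))) x)"
    proof (intro sum_mono mult_left_mono)
      fix k
      show "- \<Lambda> \<le> dd V (\<lambda>y. Re (sesq (g y) (e k) (e k))) x" using \<Lambda>[OF unit(1)[of k] V(1)] by linarith
      show "0 \<le> \<mu> k" using \<mu>[of k] by simp
    qed
    moreover have "dd V f x \<le> \<Lambda>" using \<Lambda>[OF V(1) V(1)] by linarith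
    ultimately show ?thesis unfolding h'_def TD2 by (simp add: algebra_simps)
  qed
  moreover have "(\<Sum>k\<in>UNIV. \<mu> k ^ 2 * c' k) \<le> \<Lambda> * T"
    unfolding T_def sum_distrib_left
  proof (intro sum_mono)
    fix k
    have "c' k \<le> \<Lambda>" using \<Lambda>[OF unit(1)[of k] V(1)] unfolding c'_def by linarith
    then show "\<mu> k ^ 2 * c' k \<le> \<Lambda> * \<mu> k ^ 2" by (simp add: mult.commute[of "\<mu> k ^ 2"] mult_right_mono)
  qed
  ultimately have "- (\<Lambda> * (\<sigma> + 1 + T)) \<le> (\<Sum>k\<in>UNIV. \<mu> k ^ 2 * h' k) - (\<Sum>k\<in>UNIV. \<mu> k ^ 2 * c' k)"
    by (simp add: algebra_simps)
  then have "(- (\<Lambda> * (\<sigma> + 1 + T))) / \<rho> \<le> ((\<Sum>k\<in>UNIV. \<mu> k ^ 2 * h' k) - (\<Sum>k\<in>UNIV. \<mu> k ^ 2 * c' k)) / \<rho>"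
    using V(3) by (intro divide_right_mono) auto
  then have low: "- (\<Lambda> / \<rho> * (\<sigma> + 1 + T)) \<le> (\<Sum>k\<in>UNIV. \<mu> k ^ 2 * h' k) / \<rho> - (\<Sum>k\<in>UNIV. \<mu> k ^ 2 * c' k) / \<rho>"
    by (simp add: diff_divide_distrib)
  have "Q * ((\<Sum>k\<in>UNIV. \<mu> k ^ 2 * a k) - \<sigma>) + q * (\<Sum>k\<in>UNIV. \<mu> k ^ 2 * r k ^ 2)
      \<le> \<Lambda>/2 * T + \<Lambda>/\<rho> * (\<sigma> + 1 + T) + 2 * \<Lambda> / \<rho> * (\<sigma> + \<Lambda> * T)
         + 2 * Q / \<rho> * (\<Sum>k\<in>UNIV. (\<mu> k + \<Lambda> * \<mu> k ^ 2) * r k)"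
    using sumd low unfolding right_diff_distrib by linarith
  moreover have "\<rho>^2 \<le> (\<Sum>k\<in>UNIV. norm (dzdir (e k) \<phi> x) ^ 2)"
    using dzdir_norm_le_frame[OF dif[OF sm\<phi>] e hg, of V] V by simp
  ultimately show ?thesis using e \<mu> TD1
    unfolding max_point_ineq_def Q_def q_def T_def \<sigma>_def a_def r_def by blast
qed

section \<open>The local gradient estimate\<close>

text \<open>If the gradient is large compared with \<open>t\<^sup>3\<close>, the good term \<open>\<Sum> \<mu>\<^sub>k\<^sup>2 r\<^sub>k\<^sup>2\<close> forces one of the \<open>\<mu>\<^sub>k\<close> to be
  small; then the cone condition makes \<open>\<Sum> \<mu>\<^sub>k\<^sup>2 a\<^sub>k - \<Sum> \<mu>\<^sub>k\<close> at least \<open>\<epsilon> \<Sum> \<mu>\<^sub>k\<^sup>2\<close> up to a small error.\<close>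

lemma gradient_bound_arith:
  fixes lam \<epsilon> \<Lambda> f0 f1 :: real
  assumes \<Lambda>: "1 \<le> \<Lambda>" and \<epsilon>: "0 < \<epsilon>" and f: "0 < f0" "f0 \<le> f1" and lam: "0 < lam" "\<Lambda> / 2 + 2 \<le> lam * \<epsilon>"
  shows "\<exists>B. \<forall>(\<mu>::'n::finite \<Rightarrow> real) a r \<rho> t.
     (\<forall>k. 0 < \<mu> k) \<longrightarrow> (\<forall>k. 0 \<le> r k) \<longrightarrow> f0 \<le> sum \<mu> UNIV \<longrightarrow> sum \<mu> UNIV \<le> f1 \<longrightarrow>
     0 < \<rho> \<longrightarrow> 1 \<le> t \<longrightarrow> \<rho>^2 \<le> (\<Sum>k\<in>UNIV. r k ^ 2) \<longrightarrow>
     (\<forall>k. (real CARD('n) - 1) / sum \<mu> UNIV + \<epsilon> \<le> a k) \<longrightarrow>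
     max_point_ineq \<Lambda> lam \<rho> t \<mu> a r \<longrightarrow>
     \<rho>^2 \<le> B * t^3"
proof -
  define n where "n = real CARD('n)"
  have n1: "1 \<le> n" unfolding n_def using finite_UNIV_card_ge_0[where 'a='n] by simp
  \<comment> \<open>An upper bound of \<open>lam + 1/t^2\<close>, because
    \<open>1 \<le> t\<close>.\<close>
  define L where "L = lam + 1"
  \<comment> \<open>Once \<open>b \<le> \<rho>\<close>, \<open>K / b\<close> bounds all error terms
    with a factor \<open>1/\<rho>\<close>, including what remains of the mixed term after completing
    the square.\<close>
  define K where "K = \<Lambda> * (f1 + 1 + f1^2) + 2 * \<Lambda> * (f1 + \<Lambda> * f1^2) + n * (L^2 * (1 + \<Lambda> * f1)^2)"
  define K2 where "K2 = \<Lambda> / 2 * f1^2 + K + L * f1"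
  define K3 where "K3 = K2 + 1"
  \<comment> \<open>The assumption that \<open>\<rho>^2\<close> exceeds \<open>b^2 * t^3\<close>
    will give \<open>2 * T * b \<le> K + 2 * L * K3\<close>. This value of \<open>b\<close>
    contradicts that, since \<open>f0^2 / n\<close> is a lower bound of \<open>T\<close>.\<close>
  define b where "b = 1 + (2 * L * K3 + K) * n / f0^2"
  have pos: "0 < L" "0 \<le> K" "0 \<le> K2" "0 < K3" "1 \<le> b"
  proof -
    show L: "0 < L" using lam by (simp add: L_def)
    show K: "0 \<le> K" unfolding K_def using \<Lambda> f n1 L by (intro add_nonneg_nonneg mult_nonneg_nonneg) auto
    show K2: "0 \<le> K2" unfolding K2_def using \<Lambda> f L K by (intro add_nonneg_nonneg mult_nonneg_nonneg) auto
    then show "0 < K3" by (simp add: K3_def)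
    then show "1 \<le> b" unfolding b_def using L K n1 f by simp
  qed
  show ?thesis
  proof (intro exI[of _ "b^2"] allI impI)
    fix \<mu> a r :: "'n \<Rightarrow> real" and \<rho> t :: real
    define \<sigma> where "\<sigma> = sum \<mu> UNIV"
    define T where "T = (\<Sum>k\<in>UNIV. \<mu> k ^ 2)"
    define E where "E = (\<Sum>k\<in>UNIV. \<mu> k ^ 2 * r k ^ 2)"
    define A where "A = (\<Sum>k\<in>UNIV. \<mu> k ^ 2 * a k)"
    define S where "S = lam + 1/t^2"
    assume \<mu>: "\<forall>k. 0 < \<mu> k" and r: "\<forall>k. 0 \<le> r k" and s0: "f0 \<le> sum \<mu> UNIV" and s1: "sum \<mu> UNIV \<le> f1"
      and \<rho>: "0 < \<rho>" and t: "1 \<le> t" and r\<rho>: "\<rho>^2 \<le> (\<Sum>k\<in>UNIV. r k ^ 2)"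
      and a: "\<forall>k. (real CARD('n) - 1) / sum \<mu> UNIV + \<epsilon> \<le> a k"
      and "max_point_ineq \<Lambda> lam \<rho> t \<mu> a r"
    then have M: "S * (A - \<sigma>) + 2/t^3 * E \<le> \<Lambda>/2 * T + \<Lambda>/\<rho> * (\<sigma> + 1 + T)
         + 2 * \<Lambda> / \<rho> * (\<sigma> + \<Lambda> * T) + 2 * S / \<rho> * (\<Sum>k\<in>UNIV. (\<mu> k + \<Lambda> * \<mu> k ^ 2) * r k)"
      by (simp only: max_point_ineq_def \<sigma>_def T_def E_def A_def S_def)
    have \<sigma>: "0 < \<sigma>" "f0 \<le> \<sigma>" "\<sigma> \<le> f1" using s0 s1 f by (auto simp: \<sigma>_def)
    have S: "lam \<le> S" "S \<le> L" using t by (auto simp: S_def L_def)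
    have \<mu>\<sigma>: "\<mu> k \<le> \<sigma>" for k
      unfolding \<sigma>_def using \<mu> by (intro member_le_sum) (auto intro: less_imp_le)
    have T0: "0 \<le> T" by (simp add: T_def sum_nonneg)
    have T1: "T \<le> f1^2"
    proof -
      have "T \<le> (\<Sum>k\<in>UNIV. \<mu> k * \<sigma>)" unfolding T_def power2_eq_square
        using \<mu> \<mu>\<sigma> by (intro sum_mono mult_left_mono) (auto intro: less_imp_le)
      also have "\<dots> = \<sigma>^2" by (simp add: \<sigma>_def sum_distrib_right power2_eq_square)
      also have "\<dots> \<le> f1^2" using \<sigma> by (intro power_mono) auto
      finally show ?thesis .
    qed
    show "\<rho>^2 \<le> b^2 * t^3"
    proof (rule ccontr)
      assume "\<not> \<rho>^2 \<le> b^2 * t^3"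
      then have big: "b^2 * t^3 < \<rho>^2" by simp
      have t3: "1 \<le> t^3" using t by simp
      have "b^2 \<le> \<rho>^2" using big mult_left_mono[OF t3, of "b^2"] by simp
      then have b\<rho>: "b \<le> \<rho>" using \<rho> by (rule power2_le_imp_le[OF _ less_imp_le])
      have b\<rho>t: "t^3 / \<rho>^2 \<le> 1 / b^2" using big pos(5) \<rho> by (simp add: field_simps)
      have inv: "1/\<rho> \<le> 1/b" using b\<rho> pos(5) by (simp add: frac_le)
      \<comment> \<open>Completing the square spends half of the good term \<open>2/t^3 * E\<close>;
        the remainder is small because \<open>t^3 / \<rho>^2 \<le> 1 / b^2\<close>.\<close>
      have cross: "2 * S / \<rho> * ((\<mu> k + \<Lambda> * \<mu> k ^ 2) * r k) \<le> 1/t^3 * (\<mu> k ^ 2 * r k ^ 2) + (L^2 * (1 + \<Lambda> * f1)^2) / b" for k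
      proof -
        define X where "X = S * (1 + \<Lambda> * \<mu> k) / \<rho>"
        have "0 \<le> (X * t^3 - \<mu> k * r k)^2 / t^3" using t by simp
        also have "\<dots> = X^2 * t^3 - 2 * X * (\<mu> k * r k) + 1/t^3 * (\<mu> k ^ 2 * r k ^ 2)"
          using t by (simp add: field_simps power2_eq_square)
        finally have "2 * X * (\<mu> k * r k) \<le> 1/t^3 * (\<mu> k ^ 2 * r k ^ 2) + X^2 * t^3" by simp
        moreover have "2 * S / \<rho> * ((\<mu> k + \<Lambda> * \<mu> k ^ 2) * r k) = 2 * X * (\<mu> k * r k)"
          by (simp add: X_def field_simps power2_eq_square)
        moreover have "X^2 * t^3 \<le> (L^2 * (1 + \<Lambda> * f1)^2) / b"
        proof -
          have "X^2 * t^3 = S^2 * (1 + \<Lambda> * \<mu> k)^2 * (t^3/\<rho>^2)" by (simp add: X_def power_mult_distrib power_divide)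
          also have "\<dots> \<le> (L^2 * (1 + \<Lambda> * f1)^2) * (1/b^2)"
          proof (intro mult_mono b\<rho>t power_mono)
            show "1 + \<Lambda> * \<mu> k \<le> 1 + \<Lambda> * f1" using \<mu>\<sigma>[of k] \<sigma>(3) \<Lambda> by simp
            show "0 \<le> 1 + \<Lambda> * \<mu> k" using \<mu> \<Lambda> by (simp add: less_imp_le add_nonneg_nonneg)
            show "S \<le> L" "0 \<le> S" using S lam by auto
          qed (use t \<rho> in auto)
          also have "\<dots> \<le> (L^2 * (1 + \<Lambda> * f1)^2) * (1/b)"
          proof (rule mult_left_mono)
            show "1/b^2 \<le> 1/b" using pos(5) by (simp add: power2_eq_square field_simps)
          qed simp
          finally show ?thesis by simp
        qed
        ultimately show ?thesis by linarith
      qed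
      have "2 * S / \<rho> * (\<Sum>k\<in>UNIV. (\<mu> k + \<Lambda> * \<mu> k ^ 2) * r k)
         \<le> (\<Sum>k\<in>(UNIV::'n set). 1/t^3 * (\<mu> k ^ 2 * r k ^ 2) + (L^2 * (1 + \<Lambda> * f1)^2) / b)"
        unfolding sum_distrib_left by (intro sum_mono cross)
      also have "\<dots> = 1/t^3 * E + n * (L^2 * (1 + \<Lambda> * f1)^2) / b"
        by (simp add: sum.distrib E_def sum_distrib_left n_def)
      finally have c: "2 * S / \<rho> * (\<Sum>k\<in>UNIV. (\<mu> k + \<Lambda> * \<mu> k ^ 2) * r k)
        \<le> 1/t^3 * E + n * (L^2 * (1 + \<Lambda> * f1)^2) / b" .
      have d1: "\<Lambda>/\<rho> * (\<sigma> + 1 + T) \<le> \<Lambda> * (f1 + 1 + f1^2) / b"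
      proof -
        have "(1/\<rho>) * (\<Lambda> * (\<sigma> + 1 + T)) \<le> (1/b) * (\<Lambda> * (f1 + 1 + f1^2))"
          using inv \<sigma> T0 T1 \<Lambda> pos(5) by (intro mult_mono) auto
        then show ?thesis by simp
      qed
      have d2: "2 * \<Lambda> / \<rho> * (\<sigma> + \<Lambda> * T) \<le> 2 * \<Lambda> * (f1 + \<Lambda> * f1^2) / b"
      proof -
        have "(1/\<rho>) * (2 * \<Lambda> * (\<sigma> + \<Lambda> * T)) \<le> (1/b) * (2 * \<Lambda> * (f1 + \<Lambda> * f1^2))"
          using inv \<sigma> T0 T1 \<Lambda> pos(5) by (intro mult_mono add_mono) auto
        then show ?thesis by simp
      qed
      have Kb: "K / b = \<Lambda> * (f1 + 1 + f1^2) / b + 2 * \<Lambda> * (f1 + \<Lambda> * f1^2) / b + n * (L^2 * (1 + \<Lambda> * f1)^2) / b"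
        by (simp add: K_def add_divide_distrib)
      have t2: "2/t^3 * E = 1/t^3 * E + 1/t^3 * E" by simp
      have main: "S * (A - \<sigma>) + 1/t^3 * E \<le> \<Lambda>/2 * T + K / b"
        using M c d1 d2 unfolding Kb t2 by linarith
      obtain k0 where k0: "\<And>k. \<mu> k0 \<le> \<mu> k"
      proof -
        have "Min (range \<mu>) \<in> range \<mu>" by (rule Min_in) auto
        then obtain k0 where "\<mu> k0 = Min (range \<mu>)" by (metis imageE)
        then show ?thesis using that by (metis Min_le finite_imageI finite rangeI)
      qed
      have \<mu>0: "0 < \<mu> k0" using \<mu> by simp
      have E0: "\<mu> k0 ^ 2 * \<rho>^2 \<le> E"
      proof -
        have "\<mu> k0 ^ 2 * \<rho>^2 \<le> \<mu> k0 ^ 2 * (\<Sum>k\<in>UNIV. r k ^ 2)" using r\<rho> by (intro mult_left_mono) auto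
        also have "\<dots> \<le> E" unfolding E_def sum_distrib_left
          using k0 \<mu>0 by (intro sum_mono mult_right_mono power_mono) auto
        finally show ?thesis .
      qed
      have En: "0 \<le> 1/t^3 * E" using t by (simp add: E_def sum_nonneg)
      have apos: "(n - 1) / \<sigma> + \<epsilon> \<le> a k" for k using a by (simp add: n_def \<sigma>_def)
      have "(n - 1) / \<sigma> \<ge> 0" using n1 \<sigma> by simp
      then have "0 \<le> a k" for k using apos[of k] \<epsilon> by linarith
      then have A0: "0 \<le> A" unfolding A_def by (intro sum_nonneg mult_nonneg_nonneg) auto
      \<comment> \<open>The other half of the good term dominates \<open>\<mu> k0 ^ 2 * b^2\<close>,
        so the smallest of the \<mu> is of order \<open>1 / b\<close>.\<close>
      have "(\<mu> k0 * b)^2 \<le> K3^2"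
      proof -
        have "b^2 \<le> \<rho>^2 / t^3" using big t by (simp add: field_simps)
        then have "\<mu> k0 ^ 2 * b^2 \<le> \<mu> k0 ^ 2 * (\<rho>^2 / t^3)" by (intro mult_left_mono) auto
        also have "\<dots> \<le> 1/t^3 * E" using E0 t by (simp add: divide_right_mono)
        also have "\<dots> \<le> \<Lambda>/2 * T + K / b + S * \<sigma> - S * A"
          using main by (simp add: algebra_simps)
        also have "\<dots> \<le> K2"
        proof -
          have "\<Lambda>/2 * T \<le> \<Lambda>/2 * f1^2" using T1 \<Lambda> by (intro mult_left_mono) auto
          moreover have "K / b \<le> K" using pos(2,5) by (simp add: divide_le_eq mult_le_cancel_left1)
          moreover have "S * \<sigma> \<le> L * f1" using S \<sigma> lam by (intro mult_mono) auto
          moreover have "0 \<le> S * A" using S lam A0 by simp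
          ultimately show ?thesis unfolding K2_def by linarith
        qed
        also have "\<dots> \<le> K3^2" unfolding K3_def using pos(3) by (simp add: power2_eq_square algebra_simps)
        finally show ?thesis by (simp add: power_mult_distrib)
      qed
      then have small: "\<mu> k0 * b \<le> K3" using pos(4) by (rule power2_le_imp_le[OF _ less_imp_le])
      \<comment> \<open>Cauchy-Schwarz over the other n - 1 indices: with \<open>\<mu> k0\<close>
        negligible, the factor n - 1 in the cone condition is just enough to compensate
        \<open>\<sigma>\<close>.\<close>
      have "(n - 1) * T \<ge> \<sigma>^2 - 2 * \<sigma> * \<mu> k0"
      proof -
        have "(\<Sum>k\<in>UNIV - {k0}. \<mu> k) = \<sigma> - \<mu> k0" by (simp add: \<sigma>_def sum_diff1)
        then have "(\<sigma> - \<mu> k0)^2 \<le> real (card (UNIV - {k0})) * (\<Sum>k\<in>UNIV - {k0}. \<mu> k ^ 2)"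
          using sum_squared_le_sum_of_squares[of \<mu> "UNIV - {k0}"] by (simp add: mult.commute)
        also have "\<dots> \<le> (n - 1) * T"
          unfolding T_def using n1
          by (intro mult_mono sum_mono2) (auto simp: n_def card_Diff_singleton of_nat_diff sum_nonneg)
        finally show ?thesis using zero_le_power2[of "\<mu> k0"] unfolding power2_diff by linarith
      qed
      then have "((n - 1) * T) / \<sigma> \<ge> (\<sigma>^2 - 2 * \<sigma> * \<mu> k0) / \<sigma>" using \<sigma> by (intro divide_right_mono) auto
      moreover have "(\<sigma>^2 - 2 * \<sigma> * \<mu> k0) / \<sigma> = \<sigma> - 2 * \<mu> k0"
        using \<sigma> by (simp add: diff_divide_distrib power2_eq_square)
      ultimately have nT: "((n - 1) / \<sigma>) * T \<ge> \<sigma> - 2 * \<mu> k0" by simp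
      have "((n - 1) / \<sigma> + \<epsilon>) * T \<le> A"
        unfolding T_def A_def sum_distrib_left
        using mult_left_mono[OF apos zero_le_power2] by (intro sum_mono) (simp add: mult.commute)
      then have "\<epsilon> * T - 2 * \<mu> k0 \<le> A - \<sigma>" using nT by (simp add: algebra_simps)
      then have "S * (\<epsilon> * T - 2 * \<mu> k0) \<le> S * (A - \<sigma>)" using S lam by (intro mult_left_mono) auto
      then have "S * (\<epsilon> * T) \<le> \<Lambda>/2 * T + K / b + 2 * S * \<mu> k0"
        using main En by (simp add: algebra_simps)
      \<comment> \<open>The lower bound on \<open>lam * \<epsilon>\<close> absorbs
        \<open>\<Lambda>/2 * T\<close> and leaves \<open>2 * T\<close>.\<close>
      moreover have "(\<Lambda>/2 + 2) * T \<le> S * (\<epsilon> * T)"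
      proof -
        have "(\<Lambda>/2 + 2) * T \<le> lam * \<epsilon> * T" using lam T0 by (intro mult_right_mono) auto
        also have "\<dots> \<le> S * \<epsilon> * T" using S \<epsilon> T0 by (intro mult_right_mono) auto
        finally show ?thesis by (simp add: mult.assoc)
      qed
      moreover have "S * \<mu> k0 \<le> L * \<mu> k0" using S \<mu>0 by simp
      ultimately have "2 * T \<le> K / b + 2 * L * \<mu> k0" by (simp add: algebra_simps)
      then have "2 * T * b \<le> (K / b + 2 * L * \<mu> k0) * b" using pos(5) by (intro mult_right_mono) auto
      also have "\<dots> = K + 2 * L * (\<mu> k0 * b)" using pos(5) by (simp add: algebra_simps)
      also have "\<dots> \<le> K + 2 * L * K3" using small pos(1) by simp
      finally have up: "2 * T * b \<le> K + 2 * L * K3" .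
      have "f0^2 \<le> \<sigma>^2" using \<sigma> f by (intro power_mono) auto
      also have "\<sigma>^2 \<le> n * T" using sum_squared_le_sum_of_squares[of \<mu> UNIV] by (simp add: n_def T_def \<sigma>_def mult.commute)
      finally have T2: "f0^2 / n \<le> T" using n1 by (simp add: field_simps)
      have "f0^2 / n * b \<le> T * b" using T2 pos(5) by (intro mult_right_mono) auto
      moreover have "f0^2 / n * b = f0^2 / n + (2 * L * K3 + K)"
        unfolding b_def using n1 f by (simp add: field_simps)
      moreover have "0 < f0^2 / n" using f n1 by simp
      moreover have "0 \<le> T * b" using T0 pos(5) by simp
      ultimately show False using up by linarith
    qed
  qed
qed

lemma Ck_on_subset: "Ck_on k u S \<Longrightarrow> T \<subseteq> S \<Longrightarrow> Ck_on k u T"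
  by (induction k arbitrary: u) (auto intro: continuous_on_subset)

lemma smooth_on_subset: "smooth_on u S \<Longrightarrow> T \<subseteq> S \<Longrightarrow> smooth_on u T"
  unfolding smooth_on_def using Ck_on_subset by blast

lemma dd_sesq:
  fixes g :: "complex^'n::finite \<Rightarrow> complex^'n^'n"
  assumes "\<And>i j. (\<lambda>y. g y $ i $ j) differentiable (at x)"
  shows "dd a (\<lambda>y. sesq (g y) V U) x = sesq (\<chi> i j. dd a (\<lambda>y. g y $ i $ j) x) V U"
proof -
  have 1: "dd a (\<lambda>y. g y $ i $ j * (V $ i * cnj (U $ j))) x = dd a (\<lambda>y. g y $ i $ j) x * (V $ i * cnj (U $ j))" for i j
    by (rule dd_bounded_linear[OF bounded_linear_mult_left assms])
  have d: "(\<lambda>y. g y $ i $ j * (V $ i * cnj (U $ j))) differentiable (at x)" for i j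
    by (intro differentiable_mult assms differentiable_const)
  have d2: "(\<lambda>y. \<Sum>j\<in>UNIV. g y $ i $ j * (V $ i * cnj (U $ j))) differentiable (at x)" for i
    by (intro differentiable_sum ballI d) auto
  have "dd a (\<lambda>y. sesq (g y) V U) x = (\<Sum>i\<in>UNIV. \<Sum>j\<in>UNIV. dd a (\<lambda>y. g y $ i $ j * (V $ i * cnj (U $ j))) x)"
    unfolding sesq_def mult.assoc by (simp only: dd_sum d d2)
  then show ?thesis unfolding 1 by (simp add: sesq_def mult.assoc)
qed

lemma dd_dd_sesq:
  fixes g :: "complex^'n::finite \<Rightarrow> complex^'n^'n"
  assumes "open S" "x \<in> S" "\<And>i j. smooth_on (\<lambda>y. g y $ i $ j) S"
  shows "dd a (dd b (\<lambda>y. sesq (g y) V U)) x = sesq (\<chi> i j. dd a (dd b (\<lambda>y. g y $ i $ j)) x) V U"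
proof -
  have "dd a (dd b (\<lambda>y. sesq (g y) V U)) x = dd a (\<lambda>y. sesq (\<chi> i j. dd b (\<lambda>y. g y $ i $ j) y) V U) x"
    by (rule dd_cong[OF assms(1,2)]) (rule dd_sesq[OF smooth_on_imp_differentiable[OF assms(3)]])
  also have "\<dots> = sesq (\<chi> i j. dd a (dd b (\<lambda>y. g y $ i $ j)) x) V U"
    using smooth_on_imp_differentiable[OF smooth_on_dd[OF assms(3)] assms(2)]
    by (subst dd_sesq) simp_all
  finally show ?thesis .
qed

lemma sesq_dd_bound:
  fixes g :: "complex^'n::finite \<Rightarrow> complex^'n^'n"
  assumes "open S" "compact K" "K \<subseteq> S" "\<And>i j. smooth_on (\<lambda>y. g y $ i $ j) S"
  shows "\<exists>C\<ge>0. \<forall>x\<in>K. \<forall>a V. \<bar>dd a (\<lambda>y. Re (sesq (g y) V V)) x\<bar> \<le> C * norm a * norm V ^ 2 \<and>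
     \<bar>dd a (dd a (\<lambda>y. Re (sesq (g y) V V))) x\<bar> \<le> C * norm a ^ 2 * norm V ^ 2"
proof -
  have "\<exists>C\<ge>0. \<forall>y\<in>K. \<forall>a. norm (dd a (\<lambda>y. g y $ i $ j) y) \<le> C * norm a" for i j
    by (rule smooth_on_dd_bound[OF assms(4,2,3)])
  then obtain C1 where C1: "\<And>i j. 0 \<le> C1 i j" "\<And>i j y a. y \<in> K \<Longrightarrow> norm (dd a (\<lambda>y. g y $ i $ j) y) \<le> C1 i j * norm a"
    by metis
  have "\<exists>C\<ge>0. \<forall>y\<in>K. \<forall>a b. norm (dd a (dd b (\<lambda>y. g y $ i $ j)) y) \<le> C * norm a * norm b" for i j
    by (rule smooth_on_dd_dd_bound[OF assms(1,4,2,3)])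
  then obtain C2 where C2: "\<And>i j. 0 \<le> C2 i j" "\<And>i j y a b. y \<in> K \<Longrightarrow> norm (dd a (dd b (\<lambda>y. g y $ i $ j)) y) \<le> C2 i j * norm a * norm b"
    by metis
  define D1 where "D1 = (\<Sum>i\<in>UNIV. \<Sum>j\<in>UNIV. C1 i j)"
  define D2 where "D2 = (\<Sum>i\<in>UNIV. \<Sum>j\<in>UNIV. C2 i j)"
  have D: "0 \<le> D1" "0 \<le> D2" unfolding D1_def D2_def by (intro sum_nonneg C1 C2)+
  show ?thesis
  proof (intro exI[of _ "D1 + D2"] conjI ballI allI)
    show "0 \<le> D1 + D2" using D by simp
    fix x a V assume x: "x \<in> K"
    then have xS: "x \<in> S" using assms(3) by auto
    note dif = smooth_on_imp_differentiable[OF _ xS]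
    have sm: "smooth_on (\<lambda>y. sesq (g y) V V) S" by (rule smooth_on_sesq[OF assms(1,4)])
    have "dd a (\<lambda>y. Re (sesq (g y) V V)) x = Re (sesq (\<chi> i j. dd a (\<lambda>y. g y $ i $ j) x) V V)"
      unfolding dd_sesq[OF dif[OF assms(4)], symmetric] by (rule dd_bounded_linear[OF bounded_linear_Re dif[OF sm]])
    then have "\<bar>dd a (\<lambda>y. Re (sesq (g y) V V)) x\<bar> \<le> norm (sesq (\<chi> i j. dd a (\<lambda>y. g y $ i $ j) x) V V)"
      by (simp add: abs_Re_le_cmod)
    also have "\<dots> \<le> (\<Sum>i\<in>UNIV. \<Sum>j\<in>UNIV. norm (dd a (\<lambda>y. g y $ i $ j) x)) * norm V * norm V"
      using norm_sesq_le[of "\<chi> i j. dd a (\<lambda>y. g y $ i $ j) x" V V] by simp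
    also have "\<dots> \<le> (\<Sum>i\<in>UNIV. \<Sum>j\<in>UNIV. C1 i j * norm a) * norm V * norm V"
      by (intro mult_right_mono sum_mono C1(2) x) auto
    also have "\<dots> = D1 * norm a * norm V ^ 2"
      by (simp add: D1_def sum_distrib_right power2_eq_square mult.assoc)
    also have "\<dots> \<le> (D1 + D2) * norm a * norm V ^ 2" using D by (intro mult_right_mono) auto
    finally show "\<bar>dd a (\<lambda>y. Re (sesq (g y) V V)) x\<bar> \<le> (D1 + D2) * norm a * norm V ^ 2" .
    have "dd a (dd a (\<lambda>y. Re (sesq (g y) V V))) x = dd a (\<lambda>y. Re (dd a (\<lambda>y. sesq (g y) V V) y)) x"
      by (rule dd_cong[OF assms(1) xS], rule dd_bounded_linear[OF bounded_linear_Re])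
        (rule smooth_on_imp_differentiable[OF sm])
    also have "\<dots> = Re (dd a (dd a (\<lambda>y. sesq (g y) V V)) x)"
      by (rule dd_bounded_linear[OF bounded_linear_Re dif[OF smooth_on_dd[OF sm]]])
    finally have "\<bar>dd a (dd a (\<lambda>y. Re (sesq (g y) V V))) x\<bar> \<le> norm (sesq (\<chi> i j. dd a (dd a (\<lambda>y. g y $ i $ j)) x) V V)"
      unfolding dd_dd_sesq[OF assms(1) xS assms(4)] by (simp add: abs_Re_le_cmod)
    also have "\<dots> \<le> (\<Sum>i\<in>UNIV. \<Sum>j\<in>UNIV. norm (dd a (dd a (\<lambda>y. g y $ i $ j)) x)) * norm V * norm V"
      using norm_sesq_le[of "\<chi> i j. dd a (dd a (\<lambda>y. g y $ i $ j)) x" V V] by simp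
    also have "\<dots> \<le> (\<Sum>i\<in>UNIV. \<Sum>j\<in>UNIV. C2 i j * norm a * norm a) * norm V * norm V"
      by (intro mult_right_mono sum_mono C2(2) x) auto
    also have "\<dots> = D2 * norm a ^ 2 * norm V ^ 2"
      by (simp add: D2_def sum_distrib_right power2_eq_square mult.assoc)
    also have "\<dots> \<le> (D1 + D2) * norm a ^ 2 * norm V ^ 2" using D by (intro mult_right_mono) auto
    finally show "\<bar>dd a (dd a (\<lambda>y. Re (sesq (g y) V V))) x\<bar> \<le> (D1 + D2) * norm a ^ 2 * norm V ^ 2" .
  qed
qed

lemma unit_vector_bounds:
  fixes g chi :: "complex^'n::finite \<Rightarrow> complex^'n^'n" and f :: "complex^'n \<Rightarrow> real"
  assumes S: "open S" "compact K" "K \<subseteq> S"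
    and sg: "\<And>i j. smooth_on (\<lambda>y. g y $ i $ j) S" and sc: "\<And>i j. smooth_on (\<lambda>y. chi y $ i $ j) S"
    and sf: "smooth_on f S" and pg: "\<And>y. y \<in> S \<Longrightarrow> pos_def (g y)"
  shows "\<exists>\<Lambda>\<ge>1. \<forall>x\<in>K. unit_bound g chi f x \<Lambda>"
proof -
  have cg: "continuous_on K (\<lambda>y. g y $ i $ j)" for i j
    using smooth_on_imp_continuous_on[OF sg] S(3) by (rule continuous_on_subset)
  have cc: "continuous_on K (\<lambda>y. chi y $ i $ j)" for i j
    using smooth_on_imp_continuous_on[OF sc] S(3) by (rule continuous_on_subset)
  obtain c where c: "0 < c" "\<And>y V. y \<in> K \<Longrightarrow> c * norm V ^ 2 \<le> Re (sesq (g y) V V)"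
    using sesq_lower_bound[OF S(2) cg] pg S(3) by (metis subsetD)
  obtain C1 where C1: "0 \<le> C1" "\<And>x a V. x \<in> K \<Longrightarrow> \<bar>dd a (\<lambda>y. Re (sesq (g y) V V)) x\<bar> \<le> C1 * norm a * norm V ^ 2"
     "\<And>x a V. x \<in> K \<Longrightarrow> \<bar>dd a (dd a (\<lambda>y. Re (sesq (g y) V V))) x\<bar> \<le> C1 * norm a ^ 2 * norm V ^ 2"
    using sesq_dd_bound[OF S sg] by metis
  obtain C2 where C2: "0 \<le> C2" "\<And>x a V. x \<in> K \<Longrightarrow> \<bar>dd a (\<lambda>y. Re (sesq (chi y) V V)) x\<bar> \<le> C2 * norm a * norm V ^ 2"
    using sesq_dd_bound[OF S sc] by metis
  obtain C3 where C3: "0 \<le> C3" "\<And>x a. x \<in> K \<Longrightarrow> norm (dd a f x) \<le> C3 * norm a"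
    using smooth_on_dd_bound[OF sf S(2,3)] by metis
  obtain C4 where C4: "0 < C4" "\<And>x V U. x \<in> K \<Longrightarrow> norm (sesq (chi x) V U) \<le> C4 * norm V * norm U"
    using sesq_upper_bound[OF S(2) cc] by metis
  define R where "R = max 1 (sqrt (1 / c))"
  have R: "1 \<le> R" by (simp add: R_def)
  have nR: "norm V \<le> R" if "x \<in> K" "Re (sesq (g x) V V) = 1" for x V
  proof -
    have "norm V ^ 2 \<le> 1 / c" using c(2)[OF that(1), of V] that(2) c(1) by (simp add: field_simps)
    then have "norm V \<le> sqrt (1 / c)" by (rule real_le_rsqrt)
    then show ?thesis by (simp add: R_def)
  qed
  define \<Lambda> where "\<Lambda> = 1 + C1 * R * R^2 + C1 * R^2 * R^2 + C2 * R * R^2 + C3 * R + C4 * R * R"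
  have nonneg: "0 \<le> C1 * R * R^2" "0 \<le> C1 * R^2 * R^2" "0 \<le> C2 * R * R^2" "0 \<le> C3 * R" "0 \<le> C4 * R * R"
    using C1(1) C2(1) C3(1) C4(1) R by auto
  show ?thesis
  proof (unfold unit_bound_def, intro exI[of _ \<Lambda>] conjI ballI allI impI)
    show "1 \<le> \<Lambda>" unfolding \<Lambda>_def using nonneg by linarith
    fix x V a assume x: "x \<in> K" and u: "Re (sesq (g x) V V) = 1" "Re (sesq (g x) a a) = 1"
    note n = nR[OF x u(1)] nR[OF x u(2)]
    have "C1 * norm a * norm V ^ 2 \<le> C1 * R * R^2" "C1 * norm a ^ 2 * norm V ^ 2 \<le> C1 * R^2 * R^2"
      "C2 * norm a * norm V ^ 2 \<le> C2 * R * R^2" "C3 * norm a \<le> C3 * R" "C4 * norm V * norm a \<le> C4 * R * R"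
      using n C1(1) C2(1) C3(1) C4(1) R by (auto intro!: mult_mono power_mono)
    then show "\<bar>dd a (\<lambda>y. Re (sesq (g y) V V)) x\<bar> \<le> \<Lambda>" "\<bar>dd a (dd a (\<lambda>y. Re (sesq (g y) V V))) x\<bar> \<le> \<Lambda>"
        "\<bar>dd a (\<lambda>y. Re (sesq (chi y) V V)) x\<bar> \<le> \<Lambda>" "\<bar>dd a f x\<bar> \<le> \<Lambda>" "norm (sesq (chi x) V a) \<le> \<Lambda>"
      using C1(2,3)[OF x, of a V] C2(2)[OF x, of a V] C3(2)[OF x, of a] C4(2)[OF x, of V a] nonneg
      unfolding \<Lambda>_def real_norm_def by linarith+
  qed
qed

text \<open>\<open>m\<close> is a lower bound of \<open>\<phi>\<close>, and \<open>|\<partial>\<^sub>V \<phi>|\<^sup>2 e\<^bsup>-lam t + 1/t\<^esup> / g(V, V)\<close>, with \<open>t = \<phi> - m + 1\<close> and \<open>V\<close> constant in the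
  chart, is maximal at \<open>x\<close>.\<close>

definition grad_estimate ::
    "(complex^'n::finite \<Rightarrow> complex^'n^'n) \<Rightarrow> (complex^'n \<Rightarrow> complex^'n^'n) \<Rightarrow> (complex^'n \<Rightarrow> real) \<Rightarrow>
      (complex^'n) set \<Rightarrow> (complex^'n) set \<Rightarrow> real \<Rightarrow> real \<Rightarrow> bool" where
  "grad_estimate g chi f S K lam B \<longleftrightarrow> (\<forall>\<phi> H m x V \<rho> N. x \<in> K \<longrightarrow> open N \<longrightarrow> x \<in> N \<longrightarrow> N \<subseteq> S \<longrightarrow> smooth_on \<phi> N \<longrightarrow>
     (\<forall>y\<in>N. pos_def (H y)) \<longrightarrow> (\<forall>y\<in>N. \<forall>V U. sesq (H y) V U = sesq (chi y) V U + chess \<phi> y V U) \<longrightarrow>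
     (\<forall>y\<in>N. \<forall>\<epsilon>. frame (H y) \<epsilon> \<longrightarrow> (\<Sum>k\<in>UNIV. sesq (g y) (\<epsilon> k) (\<epsilon> k)) = of_real (f y)) \<longrightarrow>
     Re (sesq (g x) V V) = 1 \<longrightarrow> dzdir V \<phi> x = of_real \<rho> \<longrightarrow> 0 < \<rho> \<longrightarrow> (\<forall>y\<in>N. m \<le> \<phi> y) \<longrightarrow>
     (\<forall>y\<in>N. norm (dzdir V \<phi> y) ^ 2 * exp (- lam * (\<phi> y - m + 1) + 1 / (\<phi> y - m + 1))
       \<le> \<rho>^2 * exp (- lam * (\<phi> x - m + 1) + 1 / (\<phi> x - m + 1)) * Re (sesq (g y) V V)) \<longrightarrow>
     \<rho>^2 \<le> B * (\<phi> x - m + 1) ^ 3)"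

text \<open>The threshold \<open>lam0\<close> precedes \<open>lam\<close>, and \<open>B\<close>
  follows it, so that finitely many patches can share one exponent. The constants come from
  compactness of \<open>K\<close> and are fixed before \<phi> appears.\<close>

lemma local_gradient_estimate:
  fixes g chi :: "complex^'n::finite \<Rightarrow> complex^'n^'n" and f :: "complex^'n \<Rightarrow> real"
  assumes S: "open S" "compact K" "K \<subseteq> S"
    and sg: "\<And>i j. smooth_on (\<lambda>y. g y $ i $ j) S" and sc: "\<And>i j. smooth_on (\<lambda>y. chi y $ i $ j) S"
    and sf: "smooth_on f S" and pg: "\<And>y. y \<in> S \<Longrightarrow> pos_def (g y)" and fpos: "\<And>y. y \<in> S \<Longrightarrow> 0 < f y"
    and cone: "\<And>y. y \<in> S \<Longrightarrow> pos_def (chi y - ((real CARD('n) - 1) / f y) *\<^sub>R g y)"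
  shows "\<exists>lam0>0. \<forall>lam\<ge>lam0. \<exists>B. grad_estimate g chi f S K lam B"
proof (cases "K = {}")
  case True
  then show ?thesis by (intro exI[of _ 1]) (auto simp: grad_estimate_def)
next
  case False
  have cg: "continuous_on K (\<lambda>y. g y $ i $ j)" for i j
    using smooth_on_imp_continuous_on[OF sg] S(3) by (rule continuous_on_subset)
  have cc: "continuous_on K (\<lambda>y. chi y $ i $ j)" for i j
    using smooth_on_imp_continuous_on[OF sc] S(3) by (rule continuous_on_subset)
  have cf: "continuous_on K f"
    using smooth_on_imp_continuous_on[OF sf] S(3) by (rule continuous_on_subset)
  have fne: "f y \<noteq> 0" if "y \<in> K" for y using fpos[of y] S(3) that by auto
  obtain y0 where y0: "y0 \<in> K" "\<And>y. y \<in> K \<Longrightarrow> f y0 \<le> f y"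
    using continuous_attains_inf[OF S(2) False cf] by blast
  obtain y1 where y1: "y1 \<in> K" "\<And>y. y \<in> K \<Longrightarrow> f y \<le> f y1"
    using continuous_attains_sup[OF S(2) False cf] by blast
  have f0: "0 < f y0" "f y0 \<le> f y1" using fpos[of y0] y0 y1 S(3) by auto
  have ck: "continuous_on K (\<lambda>y. (chi y - ((real CARD('n) - 1) / f y) *\<^sub>R g y) $ i $ j)" for i j
    unfolding vector_minus_component vector_scaleR_component using fne
    by (intro continuous_intros cc cg cf) auto
  obtain c where c: "0 < c" "\<And>y V. y \<in> K \<Longrightarrow> c * norm V ^ 2 \<le> Re (sesq (chi y - ((real CARD('n) - 1) / f y) *\<^sub>R g y) V V)"
    using sesq_lower_bound[OF S(2) ck] cone S(3) by (metis (no_types, lifting) subsetD)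
  obtain C where C: "0 < C" "\<And>y V U. y \<in> K \<Longrightarrow> norm (sesq (g y) V U) \<le> C * norm V * norm U"
    using sesq_upper_bound[OF S(2) cg] by metis
  \<comment> \<open>The margin \<open>c\<close> in the cone condition refers to coordinate length;
    dividing by \<open>C\<close> gives a margin for vectors of unit \<open>g\<close>-length.\<close>
  define \<epsilon> where "\<epsilon> = c / C"
  have \<epsilon>: "0 < \<epsilon>" using c(1) C(1) by (simp add: \<epsilon>_def)
  have cone': "(real CARD('n) - 1) / f x + \<epsilon> \<le> Re (sesq (chi x) V V)" if x: "x \<in> K" and V: "Re (sesq (g x) V V) = 1" for x V
  proof -
    have "1 \<le> norm (sesq (g x) V V)" using complex_Re_le_cmod[of "sesq (g x) V V"] V by simp
    also have "\<dots> \<le> C * norm V ^ 2" using C(2)[OF x, of V V] by (simp add: power2_eq_square mult.assoc)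
    finally have "\<epsilon> \<le> c * norm V ^ 2" using c(1) C(1) by (simp add: \<epsilon>_def field_simps)
    also have "\<dots> \<le> Re (sesq (chi x) V V) - (real CARD('n) - 1) / f x"
      using c(2)[OF x, of V] V unfolding sesq_matrix_diff sesq_matrix_scaleR by simp
    finally show ?thesis by simp
  qed
  obtain \<Lambda> where \<Lambda>0: "1 \<le> \<Lambda> \<and> (\<forall>x\<in>K. unit_bound g chi f x \<Lambda>)"
    by (rule exE[OF unit_vector_bounds[OF S sg sc sf pg]])
  note \<Lambda> = \<Lambda>0[THEN conjunct1] \<Lambda>0[THEN conjunct2, THEN bspec]
  \<comment> \<open>Both \<open>\<Lambda>\<close> and \<open>\<epsilon>\<close> depend on
    \<open>f\<close>, hence on F, and the threshold inherits this dependence.\<close>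
  define lam0 where "lam0 = (\<Lambda> / 2 + 2) / \<epsilon>"
  have lam0: "0 < lam0" using \<Lambda>(1) \<epsilon> by (simp add: lam0_def)
  show ?thesis
  proof (rule exI[of _ lam0], intro conjI allI impI)
    show "0 < lam0" by (rule lam0)
    fix lam assume l: "lam0 \<le> lam"
    then have lam: "0 < lam" using lam0 by simp
    have "\<Lambda> / 2 + 2 = lam0 * \<epsilon>" using \<epsilon> by (simp add: lam0_def)
    also have "\<dots> \<le> lam * \<epsilon>" using l \<epsilon> by simp
    finally have l2: "\<Lambda> / 2 + 2 \<le> lam * \<epsilon>" .
    obtain B where B: "\<forall>(\<mu>::'n \<Rightarrow> real) a r \<rho> t.
     (\<forall>k. 0 < \<mu> k) \<longrightarrow> (\<forall>k. 0 \<le> r k) \<longrightarrow> f y0 \<le> sum \<mu> UNIV \<longrightarrow> sum \<mu> UNIV \<le> f y1 \<longrightarrow>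
     0 < \<rho> \<longrightarrow> 1 \<le> t \<longrightarrow> \<rho>^2 \<le> (\<Sum>k\<in>UNIV. r k ^ 2) \<longrightarrow>
     (\<forall>k. (real CARD('n) - 1) / sum \<mu> UNIV + \<epsilon> \<le> a k) \<longrightarrow>
     max_point_ineq \<Lambda> lam \<rho> t \<mu> a r \<longrightarrow>
     \<rho>^2 \<le> B * t^3"
      by (rule exE[OF gradient_bound_arith[OF \<Lambda>(1) \<epsilon> f0 lam l2]])
    show "\<exists>B. grad_estimate g chi f S K lam B"
    proof (rule exI[of _ B], unfold grad_estimate_def, intro allI impI)
      fix \<phi> :: "complex^'n \<Rightarrow> real" and H m x V \<rho> N
      assume x: "x \<in> K" and N: "open N" "x \<in> N" "N \<subseteq> S" and s\<phi>: "smooth_on \<phi> N"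
        and pH: "\<forall>y\<in>N. pos_def (H y)" and H: "\<forall>y\<in>N. \<forall>V U. sesq (H y) V U = sesq (chi y) V U + chess \<phi> y V U"
        and tr: "\<forall>y\<in>N. \<forall>\<epsilon>. frame (H y) \<epsilon> \<longrightarrow> (\<Sum>k\<in>UNIV. sesq (g y) (\<epsilon> k) (\<epsilon> k)) = of_real (f y)"
        and V: "Re (sesq (g x) V V) = 1" "dzdir V \<phi> x = of_real \<rho>" "0 < \<rho>" and m: "\<forall>y\<in>N. m \<le> \<phi> y"
        and mx: "\<forall>y\<in>N. norm (dzdir V \<phi> y) ^ 2 * exp (- lam * (\<phi> y - m + 1) + 1 / (\<phi> y - m + 1))
       \<le> \<rho>^2 * exp (- lam * (\<phi> x - m + 1) + 1 / (\<phi> x - m + 1)) * Re (sesq (g y) V V)"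
      define t where "t = \<phi> x - m + 1"
      have t: "1 \<le> t" using m N(2) by (simp add: t_def)
      have pos: "0 < \<phi> y - m + 1" if "y \<in> N" for y using m that by (simp add: add_nonneg_pos)
      have sgN: "smooth_on (\<lambda>y. g y $ i $ j) N" for i j by (rule smooth_on_subset[OF sg N(3)])
      have scN: "smooth_on (\<lambda>y. chi y $ i $ j) N" for i j by (rule smooth_on_subset[OF sc N(3)])
      have sfN: "smooth_on f N" by (rule smooth_on_subset[OF sf N(3)])
      have pgN: "pos_def (g y)" if "y \<in> N" for y using pg N(3) that by auto
      have pH': "pos_def (H y)" if "y \<in> N" for y using pH that by blast
      have H': "sesq (H y) V U = sesq (chi y) V U + chess \<phi> y V U" if "y \<in> N" for y V U using H that by blast
      have tr': "(\<Sum>k\<in>UNIV. sesq (g y) (\<epsilon> k) (\<epsilon> k)) = of_real (f y)" if "y \<in> N" "frame (H y) \<epsilon>" for y \<epsilon>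
        using tr that by blast
      have mx': "norm (dzdir V \<phi> y) ^ 2 * exp (- lam * (\<phi> y - m + 1) + 1 / (\<phi> y - m + 1))
           \<le> \<rho>^2 * exp (- lam * t + 1 / t) * Re (sesq (g y) V V)" if "y \<in> N" for y
        unfolding t_def using mx that by blast
      have "\<exists>(\<mu>::'n \<Rightarrow> real) e. frame (g x) e \<and> (\<forall>k. 0 < \<mu> k) \<and> sum \<mu> UNIV = f x \<and>
        \<rho>^2 \<le> (\<Sum>k\<in>UNIV. norm (dzdir (e k) \<phi> x) ^ 2) \<and>
        max_point_ineq \<Lambda> lam \<rho> t \<mu> (\<lambda>k. Re (sesq (chi x) (e k) (e k))) (\<lambda>k. norm (dzdir (e k) \<phi> x))"
        by (rule max_point_inequality[OF N(1,2) sgN scN sfN s\<phi> pgN pH' H' tr' \<Lambda>(2)[OF x] V lam t_def pos mx'])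
      then obtain \<mu> :: "'n \<Rightarrow> real" and e where e: "frame (g x) e" and \<mu>: "\<forall>k. 0 < \<mu> k" "sum \<mu> UNIV = f x"
        and r: "\<rho>^2 \<le> (\<Sum>k\<in>UNIV. norm (dzdir (e k) \<phi> x) ^ 2)"
        and M: "max_point_ineq \<Lambda> lam \<rho> t \<mu> (\<lambda>k. Re (sesq (chi x) (e k) (e k))) (\<lambda>k. norm (dzdir (e k) \<phi> x))"
        by blast
      have "(real CARD('n) - 1) / sum \<mu> UNIV + \<epsilon> \<le> Re (sesq (chi x) (e k) (e k))" for k
        unfolding \<mu>(2) using e by (intro cone'[OF x]) (simp add: frame_def)
      moreover have "f y0 \<le> sum \<mu> UNIV" "sum \<mu> UNIV \<le> f y1" unfolding \<mu>(2) using y0(2)[OF x] y1(2)[OF x] by auto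
      ultimately show "\<rho>^2 \<le> B * (\<phi> x - m + 1) ^ 3"
        unfolding t_def[symmetric]
        using B[rule_format, of \<mu> "\<lambda>k. norm (dzdir (e k) \<phi> x)" \<rho> t "\<lambda>k. Re (sesq (chi x) (e k) (e k))"]
          \<mu>(1) V(3) t r M by simp
    qed
  qed
qed

section \<open>Propagation of gaps by a barrier\<close>

lemma exists_frame: "pos_def g \<Longrightarrow> \<exists>e. frame g e"
  by (rule simultaneous_diagonalization[of g g]) blast+

text \<open>The barrier is radial for the Euclidean inner product, but traces are taken in
  \<open>g\<close>-orthonormal frames. Expanding \<open>\<xi>\<close> in the frame and applying
  Cauchy-Schwarz compares the two, which bounds the positive part of the barrier's trace from
  below.\<close>

lemma frame_inner_lower_bound:
  fixes g :: "complex^'n^'n::finite"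
  assumes "frame g e" "hermitian_matrix g" and C: "Re (sesq g \<xi> \<xi>) \<le> C * norm \<xi> ^ 2"
  shows "norm \<xi> ^ 2 \<le> C * (\<Sum>k\<in>UNIV. (\<xi> \<bullet> e k)^2 + (\<xi> \<bullet> imul (e k))^2)"
proof (cases "\<xi> = 0")
  case True
  then show ?thesis by simp
next
  case False
  define c where "c k = sesq g \<xi> (e k)" for k
  define s where "s k = sqrt ((\<xi> \<bullet> e k)^2 + (\<xi> \<bullet> imul (e k))^2)" for k
  have sq: "s k ^ 2 = (\<xi> \<bullet> e k)^2 + (\<xi> \<bullet> imul (e k))^2" for k by (simp add: s_def)
  have split: "c k *s e k = Re (c k) *\<^sub>R e k + Im (c k) *\<^sub>R imul (e k)" for k
    by (simp add: vec_eq_iff complex_eq_iff)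
  have "norm \<xi> ^ 2 = \<xi> \<bullet> (\<Sum>k\<in>UNIV. c k *s e k)"
    unfolding c_def frame_expand[OF assms(1), of \<xi>, symmetric] by (simp add: power2_norm_eq_inner)
  also have "\<dots> = (\<Sum>k\<in>UNIV. Re (c k) * (\<xi> \<bullet> e k) + Im (c k) * (\<xi> \<bullet> imul (e k)))"
    by (simp add: inner_sum_right split inner_add_right)
  also have "\<dots> \<le> (\<Sum>k\<in>UNIV. norm (c k) * s k)"
  proof (rule sum_mono)
    fix k
    have "Re (c k) * (\<xi> \<bullet> e k) + Im (c k) * (\<xi> \<bullet> imul (e k)) = Re (c k * Complex (\<xi> \<bullet> e k) (- (\<xi> \<bullet> imul (e k))))"
      by simp
    also have "\<dots> \<le> norm (c k) * s k"
      using complex_Re_le_cmod[of "c k * Complex (\<xi> \<bullet> e k) (- (\<xi> \<bullet> imul (e k)))"]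
      by (simp add: norm_mult s_def complex_norm)
    finally show "Re (c k) * (\<xi> \<bullet> e k) + Im (c k) * (\<xi> \<bullet> imul (e k)) \<le> norm (c k) * s k" .
  qed
  finally have "(norm \<xi> ^ 2)^2 \<le> (\<Sum>k\<in>UNIV. norm (c k) * s k)^2" by (intro power_mono) auto
  also have "\<dots> \<le> (\<Sum>k\<in>UNIV. norm (c k) ^ 2) * (\<Sum>k\<in>UNIV. s k ^ 2)" by (rule Cauchy_Schwarz_ineq_sum)
  also have "\<dots> \<le> (C * norm \<xi> ^ 2) * (\<Sum>k\<in>UNIV. s k ^ 2)"
    unfolding c_def frame_coeff_norm[OF assms(1,2)] using C by (intro mult_right_mono) (auto intro: sum_nonneg)
  finally have "norm \<xi> ^ 2 * norm \<xi> ^ 2 \<le> norm \<xi> ^ 2 * (C * (\<Sum>k\<in>UNIV. s k ^ 2))"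
    by (simp only: power2_eq_square[of "norm \<xi> ^ 2"] mult_ac)
  then have "norm \<xi> ^ 2 \<le> C * (\<Sum>k\<in>UNIV. s k ^ 2)"
    by (rule mult_left_le_imp_le) (use False in simp)
  then show ?thesis by (simp only: sq)
qed

definition trace_hess_ge :: "(complex^'n::finite \<Rightarrow> complex^'n^'n) \<Rightarrow> real \<Rightarrow> (complex^'n \<Rightarrow> real) \<Rightarrow> (complex^'n) set \<Rightarrow> bool" where
  "trace_hess_ge g K \<phi> N \<longleftrightarrow> (\<forall>x\<in>N. \<forall>e. frame (g x) e \<longrightarrow> - K \<le> (\<Sum>k\<in>UNIV. Re (chess \<phi> x (e k) (e k))))"

text \<open>The second derivative test on a segment through \<open>x\<close>: along
  \<open>a\<close>, the exponential has as second derivative itself times the last factor.\<close>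

lemma barrier_max_direction:
  fixes \<phi> :: "'a::euclidean_space \<Rightarrow> real"
  assumes S: "open S" "x \<in> S" and sm: "smooth_on \<phi> S"
    and max: "\<And>y. y \<in> S \<Longrightarrow> \<phi> y + \<kappa> * exp (- \<alpha> * norm (y - z) ^ 2) \<le> \<phi> x + \<kappa> * exp (- \<alpha> * norm (x - z) ^ 2)"
  shows "dd a (dd a \<phi>) x + \<kappa> * exp (- \<alpha> * norm (x - z) ^ 2) * (4 * \<alpha>^2 * ((x - z) \<bullet> a)^2 - 2 * \<alpha> * norm a ^ 2) \<le> 0"
proof -
  obtain d0 where d0: "0 < d0" "ball x d0 \<subseteq> S" using S by (meson openE)
  define d where "d = d0 / (norm a + 1)"
  have na: "0 < norm a + 1" by (simp add: add_nonneg_pos)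
  have d: "0 < d" using d0 na by (simp add: d_def)
  have inS: "x + s *\<^sub>R a \<in> S" if "\<bar>s\<bar> < d" for s
  proof -
    have "\<bar>s\<bar> * norm a \<le> \<bar>s\<bar> * (norm a + 1)" by (simp add: mult_left_mono)
    also have "\<dots> < d * (norm a + 1)" using that na by (simp add: mult_strict_right_mono)
    also have "\<dots> = d0" using na by (simp add: d_def)
    finally show ?thesis using d0(2) by (auto simp: mem_ball dist_norm)
  qed
  define p where "p = norm (x - z) ^ 2"
  define b where "b = (x - z) \<bullet> a"
  define q where "q = norm a ^ 2"
  have nrm: "norm (x + s *\<^sub>R a - z) ^ 2 = p + 2 * s * b + s^2 * q" for s
  proof -
    define w where "w = x - z"
    have eq: "x + s *\<^sub>R a - z = w + s *\<^sub>R a" by (simp add: w_def)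
    have "norm (w + s *\<^sub>R a) ^ 2 = norm w ^ 2 + 2 * s * (w \<bullet> a) + s^2 * norm a ^ 2"
      unfolding power2_norm_eq_inner
      by (simp add: inner_add_left inner_add_right inner_commute[of a w] power2_eq_square algebra_simps)
    then show ?thesis unfolding eq p_def b_def q_def w_def[symmetric] .
  qed
  define E where "E s = exp (- \<alpha> * (p + 2 * s * b + s^2 * q))" for s
  define P where "P s = \<phi> (x + s *\<^sub>R a) + \<kappa> * E s" for s
  define P' where "P' s = dd a \<phi> (x + s *\<^sub>R a) + \<kappa> * (E s * (- \<alpha> * (2 * b + 2 * s * q)))" for s
  have E: "(E has_real_derivative E s * (- \<alpha> * (2 * b + 2 * s * q))) (at s)" for s
    unfolding E_def[abs_def] by (auto intro!: derivative_eq_intros simp: algebra_simps power2_eq_square)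
  have D1: "((\<lambda>s. \<phi> (x + s *\<^sub>R a)) has_real_derivative dd a \<phi> (x + s *\<^sub>R a)) (at s)" if "\<bar>s\<bar> < d" for s
    by (rule dd_line_real[OF smooth_on_imp_differentiable[OF sm inS[OF that]]])
  have D2: "((\<lambda>s. dd a \<phi> (x + s *\<^sub>R a)) has_real_derivative dd a (dd a \<phi>) x) (at 0)"
    using dd_line_real[OF smooth_on_imp_differentiable[OF smooth_on_dd[OF sm] inS[of 0]], of a] d by simp
  have P1: "(P has_real_derivative P' s) (at s)" if "\<bar>s\<bar> < d" for s
    unfolding P_def[abs_def] P'_def by (intro DERIV_add D1[OF that] DERIV_cmult E)
  have E2: "((\<lambda>s. E s * (- \<alpha> * (2 * b + 2 * s * q))) has_real_derivative E 0 * (4 * \<alpha>^2 * b^2 - 2 * \<alpha> * q)) (at 0)"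
    using E[of 0] by (auto intro!: derivative_eq_intros simp: algebra_simps power2_eq_square)
  have P2: "(P' has_real_derivative dd a (dd a \<phi>) x + \<kappa> * (E 0 * (4 * \<alpha>^2 * b^2 - 2 * \<alpha> * q))) (at 0)"
    unfolding P'_def[abs_def] by (intro DERIV_add D2 DERIV_cmult E2)
  have mx: "P s \<le> P 0" if "\<bar>s\<bar> < d" for s
    using max[OF inS[OF that]] unfolding P_def E_def nrm by (simp add: p_def)
  have "dd a (dd a \<phi>) x + \<kappa> * (E 0 * (4 * \<alpha>^2 * b^2 - 2 * \<alpha> * q)) \<le> 0"
    by (rule second_derivative_test(2)[OF d P1 P2 mx])
  then show ?thesis by (simp add: E_def p_def b_def q_def mult.assoc)
qed

text \<open>Comparison with the barrier \<open>exp (- \<alpha> |y - z|\<^sup>2)\<close> on an annulus.\<close>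

lemma gap_propagation:
  fixes r0 R2 R1 Rb Cg K :: real
  assumes r: "0 < r0" "r0 < R1" "R2 < R1" "0 \<le> R2" and C: "0 < Rb" "0 < Cg" "0 \<le> K"
  shows "\<exists>\<theta>>0. \<exists>D. \<forall>(g :: complex^'n::finite \<Rightarrow> complex^'n^'n) \<phi> z s d N.
    open N \<longrightarrow> cball z R1 \<subseteq> N \<longrightarrow> smooth_on \<phi> N \<longrightarrow> (\<forall>y\<in>cball z R1. pos_def (g y)) \<longrightarrow>
    (\<forall>y\<in>cball z R1. \<forall>V. Re (sesq (g y) V V) \<le> Cg * norm V ^ 2) \<longrightarrow>
    (\<forall>y\<in>cball z R1. \<forall>V. Re (sesq (g y) V V) = 1 \<longrightarrow> norm V \<le> Rb) \<longrightarrow>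
    trace_hess_ge g K \<phi> (cball z R1) \<longrightarrow> D \<le> d \<longrightarrow> 0 \<le> d \<longrightarrow>
    (\<forall>y\<in>cball z R1. \<phi> y \<le> s) \<longrightarrow> (\<forall>y\<in>cball z r0. \<phi> y \<le> s - d) \<longrightarrow>
    (\<forall>y\<in>cball z R2. \<phi> y \<le> s - \<theta> * d)"
proof -
  define n where "n = real CARD('n)"
  have n: "1 \<le> n" unfolding n_def using finite_UNIV_card_ge_0[where 'a='n] by simp
  define \<beta> where "\<beta> = r0^2 / Cg"
  have \<beta>: "0 < \<beta>" using r C by (simp add: \<beta>_def)
  \<comment> \<open>Large enough for \<open>\<alpha>\<beta>\<close>: outside the ball of radius
    \<open>r0\<close> the quadratic term in \<open>\<alpha>\<close> outweighs the linear one, so the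
    barrier has positive trace there.\<close>
  define \<alpha> where "\<alpha> = (4 * n * Rb^2 + 1) / (4 * \<beta>) + 1"
  have \<alpha>: "1 \<le> \<alpha>" using n C \<beta> by (simp add: \<alpha>_def add_nonneg_nonneg)
  have \<alpha>\<beta>: "1 \<le> 4 * \<alpha>^2 * \<beta> - 4 * \<alpha> * n * Rb^2"
  proof -
    have "1 \<le> 4 * \<alpha> * \<beta> - 4 * n * Rb^2" using \<beta> by (simp add: \<alpha>_def field_simps)
    also have "\<dots> \<le> \<alpha> * (4 * \<alpha> * \<beta> - 4 * n * Rb^2)"
      using \<alpha> \<open>1 \<le> 4 * \<alpha> * \<beta> - 4 * n * Rb^2\<close> by (simp add: mult_le_cancel_right1)
    finally show ?thesis by (simp add: algebra_simps power2_eq_square)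
  qed
  \<comment> \<open>The drop of the barrier from the sphere of radius \<open>R2\<close> to that of
    radius \<open>R1\<close>.\<close>
  define \<theta> where "\<theta> = exp (- \<alpha> * R2^2) - exp (- \<alpha> * R1^2)"
  \<comment> \<open>For gaps beyond \<open>D\<close> the trace of the barrier outweighs
    \<open>K\<close>; the 4 stems from the quarter in \<open>chess\<close>.\<close>
  define D where "D = 4 * K / exp (- \<alpha> * R1^2) + 1"
  have "R2^2 < R1^2" using r by (intro power_strict_mono) auto
  then have \<theta>: "0 < \<theta>" using \<alpha> by (simp add: \<theta>_def)
  have \<theta>1: "\<theta> \<le> 1"
  proof -
    have "exp (- \<alpha> * R2^2) \<le> 1" using \<alpha> by simp
    moreover have "0 < exp (- \<alpha> * R1^2)" by simp
    ultimately show ?thesis unfolding \<theta>_def by linarith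
  qed
  show ?thesis
  proof (rule exI[of _ \<theta>], intro conjI, rule \<theta>, rule exI[of _ D], intro allI impI ballI)
    fix g :: "complex^'n \<Rightarrow> complex^'n^'n" and \<phi> z s d N y
    assume N: "open N" "cball z R1 \<subseteq> N" "smooth_on \<phi> N" and g: "\<forall>y\<in>cball z R1. pos_def (g y)"
      and Cg: "\<forall>y\<in>cball z R1. \<forall>V. Re (sesq (g y) V V) \<le> Cg * norm V ^ 2"
      and Rb: "\<forall>y\<in>cball z R1. \<forall>V. Re (sesq (g y) V V) = 1 \<longrightarrow> norm V \<le> Rb"
      and sub: "trace_hess_ge g K \<phi> (cball z R1)" and d: "D \<le> d" "0 \<le> d"
      and s: "\<forall>y\<in>cball z R1. \<phi> y \<le> s" "\<forall>y\<in>cball z r0. \<phi> y \<le> s - d" and y: "y \<in> cball z R2"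
    have dpos: "4 * K < d * exp (- \<alpha> * R1^2)"
    proof -
      have "4 * K = 4 * K / exp (- \<alpha> * R1^2) * exp (- \<alpha> * R1^2)" by simp
      also have "\<dots> < d * exp (- \<alpha> * R1^2)" using d by (intro mult_strict_right_mono) (auto simp: D_def)
      finally show ?thesis .
    qed
    define h where "h y = \<phi> y + d * exp (- \<alpha> * norm (y - z) ^ 2)" for y
    define A where "A = cball z R1 - ball z r0"
    have "compact A" unfolding A_def by (intro compact_diff) auto
    moreover have "A \<noteq> {}"
    proof -
      obtain b :: "complex^'n" where b: "b \<in> Basis" using nonempty_Basis by blast
      have "z + R1 *\<^sub>R b \<in> A" using b r by (simp add: A_def dist_norm)
      then show ?thesis by blast
    qed
    moreover have "continuous_on A h"
    proof -
      have "continuous_on A \<phi>"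
        by (rule continuous_on_subset[OF smooth_on_imp_continuous_on[OF N(3)]]) (use N(2) in \<open>auto simp: A_def\<close>)
      then show ?thesis unfolding h_def by (intro continuous_intros)
    qed
    ultimately obtain x where x: "x \<in> A" "\<And>y. y \<in> A \<Longrightarrow> h y \<le> h x"
      using continuous_attains_sup by metis
    have xn: "r0 \<le> norm (x - z)" "norm (x - z) \<le> R1"
      using x(1) by (auto simp: A_def dist_norm norm_minus_commute)
    have bnd: "h x \<le> s + d * exp (- \<alpha> * R1^2)"
    proof -
      \<comment> \<open>On the inner sphere the gap \<open>d\<close> pays for the barrier, on the
        outer sphere the bound is immediate, and a maximum in between contradicts the choice of
        \<open>\<alpha>\<close> and \<open>D\<close>.\<close>
      consider "norm (x - z) = r0" | "norm (x - z) = R1" | "r0 < norm (x - z)" "norm (x - z) < R1"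
        using xn by linarith
      then show ?thesis
      proof cases
        case 1
        then have "x \<in> cball z r0" by (simp add: dist_norm norm_minus_commute)
        then have "\<phi> x \<le> s - d" using s(2) by blast
        moreover have "d * exp (- \<alpha> * norm (x - z) ^ 2) \<le> d * 1" using \<alpha> d(2) by (intro mult_left_mono) auto
        moreover have "0 \<le> d * exp (- \<alpha> * R1^2)" using d(2) by simp
        ultimately show ?thesis unfolding h_def by linarith
      next
        case 2
        then have "x \<in> cball z R1" by (simp add: dist_norm norm_minus_commute)
        then show ?thesis using s(1) 2 by (simp add: h_def)
      next
        case 3
        define S where "S = ball z R1 - cball z r0"
        have oS: "open S" unfolding S_def by (intro open_Diff) auto
        have xS: "x \<in> S" using 3 by (simp add: S_def dist_norm norm_minus_commute)
        have SA: "S \<subseteq> A" unfolding S_def A_def by auto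
        have xc: "x \<in> cball z R1" using xn by (simp add: dist_norm norm_minus_commute)
        have smS: "smooth_on \<phi> S" by (rule smooth_on_subset[OF N(3)]) (use SA N(2) in \<open>auto simp: A_def\<close>)
        have "pos_def (g x)" using g xc by blast
        then have hg: "hermitian_matrix (g x)" by (simp add: pos_def_def)
        obtain e where e: "frame (g x) e" using exists_frame[OF \<open>pos_def (g x)\<close>] by (rule exE)
        define v where "v = d * exp (- \<alpha> * norm (x - z) ^ 2)"
        have v0: "0 \<le> v" using d(2) by (simp add: v_def)
        have dir: "dd a (dd a \<phi>) x + v * (4 * \<alpha>^2 * ((x - z) \<bullet> a)^2 - 2 * \<alpha> * norm a ^ 2) \<le> 0" for a
          unfolding v_def using x(2) SA by (intro barrier_max_direction[OF oS xS smS]) (auto simp: h_def)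
        have unit: "Re (sesq (g x) (e k) (e k)) = 1" "Re (sesq (g x) (imul (e k)) (imul (e k))) = 1" for k
          using e by (simp_all add: sesq_imul frame_def)
        have ne: "norm (e k) ^ 2 \<le> Rb^2" "norm (imul (e k)) ^ 2 \<le> Rb^2" for k
          using Rb xc unit[of k] by (auto intro!: power_mono)
        define q where "q k = (((x - z) \<bullet> e k)^2 + ((x - z) \<bullet> imul (e k))^2)" for k
        have perk: "4 * Re (chess \<phi> x (e k) (e k)) + v * (4 * \<alpha>^2 * q k - 4 * \<alpha> * Rb^2) \<le> 0" for k
        proof -
          have "4 * Re (chess \<phi> x (e k) (e k)) = dd (e k) (dd (e k) \<phi>) x + dd (imul (e k)) (dd (imul (e k)) \<phi>) x"
            by (simp add: chess_def)
          moreover have "v * (4 * \<alpha>^2 * q k - 4 * \<alpha> * Rb^2) \<le>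
            v * (4 * \<alpha>^2 * q k - 2 * \<alpha> * (norm (e k) ^ 2 + norm (imul (e k)) ^ 2))"
          proof (rule mult_left_mono[OF _ v0])
            have "2 * \<alpha> * (norm (e k) ^ 2 + norm (imul (e k)) ^ 2) \<le> 2 * \<alpha> * (Rb^2 + Rb^2)"
              using ne[of k] \<alpha> by (intro mult_left_mono add_mono) auto
            then show "4 * \<alpha>^2 * q k - 4 * \<alpha> * Rb^2 \<le> 4 * \<alpha>^2 * q k - 2 * \<alpha> * (norm (e k) ^ 2 + norm (imul (e k)) ^ 2)" by simp
          qed
          ultimately show ?thesis using dir[of "e k"] dir[of "imul (e k)"] by (simp add: q_def algebra_simps)
        qed
        have "(\<Sum>k\<in>UNIV. 4 * Re (chess \<phi> x (e k) (e k)) + v * (4 * \<alpha>^2 * q k - 4 * \<alpha> * Rb^2)) \<le> (\<Sum>k\<in>(UNIV::'n set). 0)"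
          by (intro sum_mono perk)
        moreover have "(\<Sum>k\<in>UNIV. 4 * Re (chess \<phi> x (e k) (e k)) + v * (4 * \<alpha>^2 * q k - 4 * \<alpha> * Rb^2))
          = 4 * (\<Sum>k\<in>UNIV. Re (chess \<phi> x (e k) (e k))) + v * (4 * \<alpha>^2 * (\<Sum>k\<in>UNIV. q k) - 4 * \<alpha> * n * Rb^2)"
          unfolding sum.distrib sum_distrib_left[symmetric] sum_subtractf by (simp add: n_def)
        moreover have "- K \<le> (\<Sum>k\<in>UNIV. Re (chess \<phi> x (e k) (e k)))"
          using sub e xc unfolding trace_hess_ge_def by blast
        ultimately have le: "v * (4 * \<alpha>^2 * (\<Sum>k\<in>UNIV. q k) - 4 * \<alpha> * n * Rb^2) \<le> 4 * K" by simp
        have "Re (sesq (g x) (x - z) (x - z)) \<le> Cg * norm (x - z) ^ 2" using Cg xc by blast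
        from frame_inner_lower_bound[OF e hg this]
        have "norm (x - z) ^ 2 \<le> Cg * (\<Sum>k\<in>UNIV. q k)" by (simp add: q_def)
        moreover have "r0^2 \<le> norm (x - z) ^ 2" using xn r by (intro power_mono) auto
        ultimately have "\<beta> \<le> (\<Sum>k\<in>UNIV. q k)" using C by (simp add: \<beta>_def field_simps)
        then have "4 * \<alpha>^2 * \<beta> \<le> 4 * \<alpha>^2 * (\<Sum>k\<in>UNIV. q k)" by (intro mult_left_mono) auto
        then have "1 \<le> 4 * \<alpha>^2 * (\<Sum>k\<in>UNIV. q k) - 4 * \<alpha> * n * Rb^2" using \<alpha>\<beta> by linarith
        then have "v * 1 \<le> v * (4 * \<alpha>^2 * (\<Sum>k\<in>UNIV. q k) - 4 * \<alpha> * n * Rb^2)" using v0 by (rule mult_left_mono)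
        moreover have "d * exp (- \<alpha> * R1^2) \<le> v"
        proof -
          have "norm (x - z) ^ 2 \<le> R1^2" using xn by (intro power_mono) auto
          then show ?thesis unfolding v_def using d(2) \<alpha> by (intro mult_left_mono) auto
        qed
        ultimately show ?thesis using le dpos by linarith
      qed
    qed
    have yn: "norm (y - z) \<le> R2" using y by (simp add: dist_norm norm_minus_commute)
    show "\<phi> y \<le> s - \<theta> * d"
    proof (cases "y \<in> ball z r0")
      case True
      then have "\<phi> y \<le> s - d" using s(2) by auto
      moreover have "\<theta> * d \<le> 1 * d" using \<theta>1 d(2) by (rule mult_right_mono)
      ultimately show ?thesis by simp
    next
      case False
      then have "y \<in> A" using y r by (auto simp: A_def)
      then have "\<phi> y + d * exp (- \<alpha> * norm (y - z) ^ 2) \<le> s + d * exp (- \<alpha> * R1^2)"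
        using x(2)[of y] bnd by (simp add: h_def)
      moreover have "d * exp (- \<alpha> * R2^2) \<le> d * exp (- \<alpha> * norm (y - z) ^ 2)"
      proof -
        have "norm (y - z) ^ 2 \<le> R2^2" using yn by (intro power_mono) auto
        then show ?thesis using d(2) \<alpha> by (intro mult_left_mono) auto
      qed
      ultimately show ?thesis by (simp add: \<theta>_def algebra_simps)
    qed
  qed
qed

text \<open>An exponential gradient bound makes \<open>exp (- lam (\<phi> - m) / 2)\<close> Lipschitz.\<close>

lemma exp_gradient_bound_near_min:
  fixes \<phi> :: "'a::real_normed_vector \<Rightarrow> real"
  assumes B: "convex B" "x \<in> B" "y \<in> B" and d: "\<And>p. p \<in> B \<Longrightarrow> \<phi> differentiable (at p)"
    and L: "0 < L" "\<And>p a. p \<in> B \<Longrightarrow> \<bar>dd a \<phi> p\<bar> \<le> L * norm a * exp (lam * (\<phi> p - m) / 2)"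
    and lam: "0 < lam" and near: "norm (y - x) \<le> 1 / (lam * L)" and x: "\<phi> x = m"
  shows "\<phi> y \<le> m + 2 * ln 2 / lam"
proof -
  define a where "a = y - x"
  \<comment> \<open>In the derivative of \<open>u\<close> this exponential cancels the one in the
    gradient bound.\<close>
  define u where "u s = exp (- lam * (\<phi> (x + s *\<^sub>R a) - m) / 2)" for s
  have inB: "x + s *\<^sub>R a \<in> B" if "0 \<le> s" "s \<le> 1" for s
  proof -
    have "(1 - s) *\<^sub>R x + s *\<^sub>R y \<in> B" using B that by (intro convexD) auto
    moreover have "(1 - s) *\<^sub>R x + s *\<^sub>R y = x + s *\<^sub>R a" by (simp add: a_def algebra_simps)
    ultimately show ?thesis by simp
  qed
  define u' where "u' s = u s * (- lam * dd a \<phi> (x + s *\<^sub>R a) / 2)" for s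
  have du: "(u has_real_derivative u' s) (at s)" if "0 \<le> s" "s \<le> 1" for s
    unfolding u_def[abs_def] u'_def
    using dd_line_real[OF d[OF inB[OF that]]] by (auto intro!: derivative_eq_intros)
  have "\<exists>z. 0 < z \<and> z < 1 \<and> u 1 - u 0 = (1 - 0) * u' z" by (rule MVT2) (use du in auto)
  then obtain z where z: "0 < z" "z < 1" "u 1 - u 0 = u' z" by auto
  have "\<bar>u' z\<bar> = u z * (lam / 2) * \<bar>dd a \<phi> (x + z *\<^sub>R a)\<bar>"
    using lam by (simp add: u'_def abs_mult u_def)
  also have "\<dots> \<le> u z * (lam / 2) * (L * norm a * exp (lam * (\<phi> (x + z *\<^sub>R a) - m) / 2))"
    using L(2)[OF inB[of z]] z lam by (intro mult_left_mono) (auto simp: u_def)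
  also have "\<dots> = (lam / 2) * L * norm a * (u z * exp (lam * (\<phi> (x + z *\<^sub>R a) - m) / 2))" by simp
  also have "u z * exp (lam * (\<phi> (x + z *\<^sub>R a) - m) / 2) = 1" by (simp add: u_def exp_add[symmetric])
  also have "(lam / 2) * L * norm a * 1 \<le> (lam / 2) * L * (1 / (lam * L))"
    using near lam L(1) unfolding a_def mult_1_right by (intro mult_left_mono) auto
  also have "\<dots> = 1 / 2" using lam L(1) by simp
  \<comment> \<open>The radius \<open>1 / (lam * L)\<close> lets \<open>u\<close> fall at most from
    1 to 1/2, which means that \<open>\<phi>\<close> rises by at most
    \<open>2 * ln 2 / lam\<close>.\<close>
  finally have "u 1 \<ge> u 0 - 1 / 2" using z(3) by linarith
  moreover have "u 0 = 1" by (simp add: u_def x)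
  ultimately have "exp (- ln 2) \<le> u 1" by (simp add: exp_minus)
  then have "- ln 2 \<le> - lam * (\<phi> y - m) / 2" by (simp add: u_def a_def)
  then show ?thesis using lam by (simp add: field_simps)
qed

section \<open>Charts\<close>

lemma Ck_on_Suc_imp: "Ck_on (Suc k) u S \<Longrightarrow> Ck_on k u S"
proof (induction k arbitrary: u)
  case 0
  then show ?case by (auto intro!: continuous_at_imp_continuous_on differentiable_imp_continuous_within)
next
  case (Suc k)
  then show ?case unfolding Ck_on_Suc_dd[of "Suc k"] Ck_on_Suc_dd[of k] by blast
qed

lemma dd_mult:
  fixes u v :: "'a::real_normed_vector \<Rightarrow> real"
  assumes "u differentiable (at x)" "v differentiable (at x)"
  shows "dd a (\<lambda>y. u y * v y) x = u x * dd a v x + dd a u x * v x"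
  by (rule dd_eqI[OF has_derivative_mult[OF has_derivative_dd has_derivative_dd, OF assms]])

lemma Ck_on_mult:
  fixes u v :: "'a::real_normed_vector \<Rightarrow> real"
  assumes "open S" "Ck_on k u S" "Ck_on k v S"
  shows "Ck_on k (\<lambda>y. u y * v y) S"
  using assms(2,3)
proof (induction k arbitrary: u v)
  case 0 then show ?case by (simp add: continuous_on_mult)
next
  case (Suc k)
  have d: "\<forall>x\<in>S. u differentiable (at x)" "\<forall>x\<in>S. v differentiable (at x)"
    and c: "\<And>a. Ck_on k (dd a u) S" "\<And>a. Ck_on k (dd a v) S"
    using Suc.prems unfolding Ck_on_Suc_dd by auto
  have "Ck_on k (dd a (\<lambda>y. u y * v y)) S" for a
  proof -
    have "Ck_on k (\<lambda>y. u y * dd a v y + dd a u y * v y) S"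
      by (intro Ck_on_add[OF assms(1)] Suc.IH c Ck_on_Suc_imp[OF Suc.prems(1)] Ck_on_Suc_imp[OF Suc.prems(2)])
    moreover have "Ck_on k (dd a (\<lambda>y. u y * v y)) S = Ck_on k (\<lambda>y. u y * dd a v y + dd a u y * v y) S"
      by (rule Ck_on_cong[OF assms(1)]) (use d dd_mult in blast)
    ultimately show ?thesis by simp
  qed
  then show ?case unfolding Ck_on_Suc_dd using d by (auto intro: differentiable_mult)
qed

lemma has_derivative_exp_dd:
  fixes u :: "'a::real_normed_vector \<Rightarrow> real"
  assumes "u differentiable (at x)"
  shows "((\<lambda>y. exp (u y)) has_derivative (\<lambda>a. exp (u x) * dd a u x)) (at x)"
  using has_derivative_exp[OF has_derivative_dd[OF assms]] by (simp add: mult.commute)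

lemma Ck_on_exp:
  fixes u :: "'a::real_normed_vector \<Rightarrow> real"
  assumes "open S" "Ck_on k u S"
  shows "Ck_on k (\<lambda>y. exp (u y)) S"
  using assms(2)
proof (induction k)
  case 0 then show ?case by (simp add: continuous_on_exp)
next
  case (Suc k)
  have d: "\<forall>x\<in>S. u differentiable (at x)" and c: "\<And>a. Ck_on k (dd a u) S"
    using Suc.prems unfolding Ck_on_Suc_dd by auto
  have "Ck_on k (dd a (\<lambda>y. exp (u y))) S" for a
  proof -
    have "Ck_on k (\<lambda>y. exp (u y) * dd a u y) S"
      by (intro Ck_on_mult[OF assms(1)] Suc.IH c Ck_on_Suc_imp[OF Suc.prems])
    moreover have "Ck_on k (dd a (\<lambda>y. exp (u y))) S = Ck_on k (\<lambda>y. exp (u y) * dd a u y) S"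
      by (rule Ck_on_cong[OF assms(1)], rule dd_eqI, rule has_derivative_exp_dd) (use d in blast)
    ultimately show ?thesis by simp
  qed
  moreover have "\<forall>x\<in>S. (\<lambda>y. exp (u y)) differentiable (at x)"
    using d has_derivative_exp_dd unfolding differentiable_def by blast
  ultimately show ?case unfolding Ck_on_Suc_dd by blast
qed

lemma smooth_on_exp:
  fixes u :: "'a::real_normed_vector \<Rightarrow> real"
  shows "open S \<Longrightarrow> smooth_on u S \<Longrightarrow> smooth_on (\<lambda>y. exp (u y)) S"
  unfolding smooth_on_def using Ck_on_exp by blast

section \<open>Coordinate charts and changes of chart\<close>

lemma chart_open:
  assumes "complex_manifold X A" "c \<in> A"
  shows "openin X (cdom c)" "open (cimg c)" "cdom c \<subseteq> topspace X"
  using assms openin_subset unfolding complex_manifold_def by blast+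

lemma chart_homeo:
  assumes "complex_manifold X A" "c \<in> A"
  shows "homeomorphic_map (subtopology X (cdom c)) (top_of_set (cimg c)) (cmap c)"
  using assms unfolding complex_manifold_def by blast

lemma chart_topspace:
  assumes "complex_manifold X A" "c \<in> A"
  shows "topspace (subtopology X (cdom c)) = cdom c"
  using chart_open(3)[OF assms] by (simp add: Int_absorb1)

lemma cinv_cmap:
  assumes "complex_manifold X A" "c \<in> A" "p \<in> cdom c"
  shows "cinv c (cmap c p) = p" "cmap c p \<in> cimg c"
proof -
  have "inj_on (cmap c) (cdom c)"
    using homeomorphic_imp_injective_map[OF chart_homeo[OF assms(1,2)]] chart_topspace[OF assms(1,2)] by simp
  then show "cinv c (cmap c p) = p" using assms(3) by (simp add: cinv_def)
  show "cmap c p \<in> cimg c" using assms(3) by (simp add: cimg_def)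
qed

lemma cmap_cinv:
  assumes "y \<in> cimg c"
  shows "cinv c y \<in> cdom c" "cmap c (cinv c y) = y"
  using assms unfolding cinv_def cimg_def by (simp_all add: inv_into_into f_inv_into_f)

lemma openin_cinv_image:
  assumes "complex_manifold X A" "c \<in> A" "open U" "U \<subseteq> cimg c"
  shows "openin X (cinv c ` U)"
proof -
  have "continuous_map (subtopology X (cdom c)) (top_of_set (cimg c)) (cmap c)"
    by (rule homeomorphic_imp_continuous_map[OF chart_homeo[OF assms(1,2)]])
  moreover have "openin (top_of_set (cimg c)) U"
    using assms(3,4) by (simp add: openin_open_eq chart_open(2)[OF assms(1,2)])
  ultimately have "openin (subtopology X (cdom c)) {p \<in> topspace (subtopology X (cdom c)). cmap c p \<in> U}"
    by (rule openin_continuous_map_preimage)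
  then have "openin X {p \<in> cdom c. cmap c p \<in> U}"
    unfolding chart_topspace[OF assms(1,2)] by (simp add: openin_open_subtopology chart_open(1)[OF assms(1,2)])
  moreover have "{p \<in> cdom c. cmap c p \<in> U} = cinv c ` U"
    using cmap_cinv[of _ c] cinv_cmap[OF assms(1,2)] assms(4) by (force simp: image_iff)
  ultimately show ?thesis by simp
qed

lemma open_cmap_image:
  assumes "complex_manifold X A" "c \<in> A" "openin X W" "W \<subseteq> cdom c"
  shows "open (cmap c ` W)"
proof -
  have "openin (subtopology X (cdom c)) W"
    using assms(3,4) by (simp add: openin_open_subtopology chart_open(1)[OF assms(1,2)])
  then have "openin (top_of_set (cimg c)) (cmap c ` W)"
    using homeomorphic_imp_open_map[OF chart_homeo[OF assms(1,2)]] unfolding open_map_def by blast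
  then show ?thesis by (simp add: openin_open_eq chart_open(2)[OF assms(1,2)])
qed

lemma in_chart_cmap:
  assumes "complex_manifold X A" "c \<in> A" "p \<in> cdom c"
  shows "in_chart c u (cmap c p) = u p"
  by (simp add: in_chart_def cinv_cmap[OF assms])

lemma smooth_fun_differentiable:
  assumes "smooth_fun A u" "c \<in> A" "y \<in> cimg c"
  shows "in_chart c u differentiable (at y)"
  using assms smooth_on_imp_differentiable unfolding smooth_fun_def by blast

text \<open>\<open>D\<close> is the complex-linear derivative of the transition map. One
  \<open>D\<close> serves all functions and all forms, so the quotient |\<partial>_V u|^2 / g(V, V)
  can be carried from chart to chart.\<close>

lemma chart_change:
  assumes M: "complex_manifold X A" and c: "c \<in> A" "p \<in> cdom c" and d: "d \<in> A" "p \<in> cdom d"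
  shows "\<exists>D. (\<forall>u V. smooth_fun A u \<longrightarrow> dzdir V (in_chart c u) (cmap c p) = dzdir (D V) (in_chart d u) (cmap d p)) \<and>
    (\<forall>h V. real_form11 A h \<longrightarrow> sesq (h d (cmap d p)) (D V) (D V) = sesq (h c (cmap c p)) V V)"
proof -
  define z where "z = cmap c p"
  define W where "W = cmap c ` (cdom c \<inter> cdom d)"
  have zW: "z \<in> W" using c d by (simp add: z_def W_def)
  have oW: "open W"
    unfolding W_def using chart_open(1)[OF M] c d by (intro open_cmap_image[OF M] openin_Int) auto
  have tz: "transition c d z = cmap d p" by (simp add: transition_def z_def cinv_cmap[OF M c])
  have "holomorphic_map_on (transition c d) W"
    using M c d unfolding complex_manifold_def W_def by blast
  then obtain D where D: "(transition c d has_derivative D) (at z)" "\<And>a v. D (a *s v) = a *s D v"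
    using zW unfolding holomorphic_map_on_def by blast
  have fD: "frechet_derivative (transition c d) (at z) = D" using frechet_derivative_at[OF D(1)] by simp
  have 1: "dzdir V (in_chart c u) z = dzdir (D V) (in_chart d u) (cmap d p)" if u: "smooth_fun A u" for u V
  proof -
    have eq: "in_chart c u y = in_chart d u (transition c d y)" if yW: "y \<in> W" for y
    proof -
      obtain q where q: "q \<in> cdom c" "q \<in> cdom d" "y = cmap c q" using yW by (auto simp: W_def)
      then show ?thesis
        by (simp add: transition_def in_chart_cmap[OF M c(1) q(1)] cinv_cmap[OF M c(1) q(1)] in_chart_cmap[OF M d(1) q(2)])
    qed
    have dif: "in_chart d u differentiable (at (transition c d z))"
      unfolding tz by (rule smooth_fun_differentiable[OF u d(1) cinv_cmap(2)[OF M d]])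
    have "dd a (in_chart c u) z = dd (D a) (in_chart d u) (cmap d p)" for a
    proof -
      have "dd a (in_chart c u) z = dd a (\<lambda>y. in_chart d u (transition c d y)) z"
        by (rule dd_cong[OF oW zW eq])
      also have "\<dots> = dd (D a) (in_chart d u) (transition c d z)"
        by (rule dd_eqI[OF has_derivative_compose[OF D(1) has_derivative_dd[OF dif]]])
      finally show ?thesis by (simp only: tz)
    qed
    then show ?thesis by (simp add: dzdir_def D(2))
  qed
  have 2: "sesq (h d (cmap d p)) (D V) (D V) = sesq (h c z) V V" if h: "real_form11 A h" for h V
  proof -
    have e: "form11 (h d (transition c d z)) (\<lambda>i. D (v i)) = form11 (h c z) v" for v
      using h c d zW unfolding real_form11_def fD[symmetric] W_def by blast
    \<comment> \<open>Evaluating the two-form on a vector and its multiple by \<i> recovers the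
      Hermitian form on the diagonal.\<close>
    have "\<i> * (sesq B V' (imul V') - sesq B (imul V') V') = 2 * sesq B V' V'" for B :: "complex^'b^'b" and V'
      by (simp add: sesq_scale_left sesq_scale_right complex_eq_iff)
    note f = this
    have "2 * sesq (h d (cmap d p)) (D V) (D V) = 2 * sesq (h c z) V V"
      using e[of "\<lambda>i. if i = 0 then V else imul V"] unfolding form11_sesq tz by (simp add: D(2) f)
    then show ?thesis by simp
  qed
  show ?thesis using 1 2 unfolding z_def by blast
qed

text \<open>The maximizing vector of one chart is a competitor in the other. One inequality suffices
  because the charts may be exchanged.\<close>

lemma grad_sq_chart_le:
  assumes M: "complex_manifold X A" and \<omega>: "hermitian_metric A \<omega>" and u: "smooth_fun A u"
    and c: "c \<in> A" "p \<in> cdom c" and d: "d \<in> A" "p \<in> cdom d"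
  shows "grad_sq \<omega> u c (cmap c p) \<le> grad_sq \<omega> u d (cmap d p)"
proof -
  have g: "pos_def (\<omega> c (cmap c p))" "pos_def (\<omega> d (cmap d p))"
    using \<omega> c d cinv_cmap(2)[OF M] unfolding hermitian_metric_def positive11_def by blast+
  have dif: "in_chart c u differentiable (at (cmap c p))" "in_chart d u differentiable (at (cmap d p))"
    using smooth_fun_differentiable[OF u] c d cinv_cmap(2)[OF M] by blast+
  define w where "w = grad_sq \<omega> u c (cmap c p)"
  define w' where "w' = grad_sq \<omega> u d (cmap d p)"
  obtain V where V: "dzdir V (in_chart c u) (cmap c p) = of_real w" "Re (sesq (\<omega> c (cmap c p)) V V) = w"
    using grad_sq_extremal(2)[of \<omega> c, OF g(1) dif(1)] unfolding w_def by blast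
  obtain V' where V': "Re (sesq (\<omega> d (cmap d p)) V' V') = w'"
    using grad_sq_extremal(2)[of \<omega> d, OF g(2) dif(2)] unfolding w'_def by blast
  have w0: "0 \<le> w" "0 \<le> w'" using pos_def_nonneg[OF g(1), of V] pos_def_nonneg[OF g(2), of V'] V V' by auto
  obtain D where D: "\<forall>u V. smooth_fun A u \<longrightarrow> dzdir V (in_chart c u) (cmap c p) = dzdir (D V) (in_chart d u) (cmap d p)"
    "\<forall>h V. real_form11 A h \<longrightarrow> sesq (h d (cmap d p)) (D V) (D V) = sesq (h c (cmap c p)) V V"
    using chart_change[OF M c d] by (elim exE conjE)
  have "real_form11 A \<omega>" using \<omega> by (simp add: hermitian_metric_def)
  then have "norm (dzdir (D V) (in_chart d u) (cmap d p)) ^ 2 \<le> w' * Re (sesq (\<omega> c (cmap c p)) V V)"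
    using grad_sq_extremal(1)[of \<omega> d, OF g(2) dif(2), of "D V"] D(2) unfolding w'_def by metis
  moreover have "dzdir (D V) (in_chart d u) (cmap d p) = of_real w" using D(1) u V(1) by metis
  ultimately have "w * w \<le> w' * w" using V(2) w0 by (simp add: power2_eq_square)
  then show ?thesis unfolding w_def[symmetric] w'_def[symmetric] using w0 mult_right_le_imp_le[of w w w'] by (cases "w = 0") auto
qed

text \<open>The factor 8 leaves room in the chart for a ball of radius \<open>3 * r i\<close> around
  every point of the covering ball.\<close>

lemma finite_chart_cover:
  fixes A :: "('a, 'n::finite) chart set"
  assumes M: "complex_manifold X A" and "compact_space X"
  shows "\<exists>I ch r. finite I \<and> I \<subseteq> topspace X \<and>
    (\<forall>i\<in>I. ch i \<in> A \<and> i \<in> cdom (ch i) \<and> 0 < (r i :: real) \<and> cball (cmap (ch i) i) (8 * r i) \<subseteq> cimg (ch i)) \<and>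
    topspace X = (\<Union>i\<in>I. cinv (ch i) ` ball (cmap (ch i) i) (r i))"
proof -
  have "\<exists>c\<in>A. p \<in> cdom c" if "p \<in> topspace X" for p
    using M that unfolding complex_manifold_def by auto
  then obtain ch where ch: "\<And>p. p \<in> topspace X \<Longrightarrow> ch p \<in> A \<and> p \<in> cdom (ch p)" by metis
  have "\<exists>r>0. cball (cmap (ch p) p) (8 * r) \<subseteq> cimg (ch p)" if p: "p \<in> topspace X" for p
  proof -
    have "open (cimg (ch p))" "cmap (ch p) p \<in> cimg (ch p)"
      using ch[OF p] chart_open(2)[OF M] cinv_cmap(2)[OF M] by auto
    then obtain e where e: "0 < e" "cball (cmap (ch p) p) e \<subseteq> cimg (ch p)" using open_contains_cball by metis
    then show ?thesis by (intro exI[of _ "e / 8"]) auto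
  qed
  then obtain r where r: "\<And>p. p \<in> topspace X \<Longrightarrow> 0 < r p \<and> cball (cmap (ch p) p) (8 * r p) \<subseteq> cimg (ch p)" by metis
  define U where "U p = cinv (ch p) ` ball (cmap (ch p) p) (r p)" for p
  have bs: "ball (cmap (ch p) p) (r p) \<subseteq> cimg (ch p)" if "p \<in> topspace X" for p
    using r[OF that] by (auto simp: subset_iff)
  have oU: "openin X (U p)" if "p \<in> topspace X" for p
    unfolding U_def using ch[OF that] bs[OF that] by (intro openin_cinv_image[OF M]) auto
  have pU: "p \<in> U p" if "p \<in> topspace X" for p
  proof -
    have "cinv (ch p) (cmap (ch p) p) = p" using ch[OF that] cinv_cmap(1)[OF M] by blast
    then show ?thesis unfolding U_def using r[OF that] by (metis centre_in_ball image_eqI)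
  qed
  have "compactin X (topspace X)" using assms(2) by (simp add: compact_space_def)
  moreover have "topspace X \<subseteq> \<Union>(U ` topspace X)" using pU by blast
  ultimately have "\<exists>\<F>. finite \<F> \<and> \<F> \<subseteq> U ` topspace X \<and> topspace X \<subseteq> \<Union>\<F>"
    using oU unfolding compactin_def by (metis (no_types, lifting) imageE)
  then obtain \<F> where "finite \<F>" "\<F> \<subseteq> U ` topspace X" "topspace X \<subseteq> \<Union>\<F>" by blast
  then obtain I where I: "finite I" "I \<subseteq> topspace X" "\<F> = U ` I" by (metis finite_subset_image)
  have "topspace X = (\<Union>i\<in>I. U i)"
    using \<open>topspace X \<subseteq> \<Union>\<F>\<close> I oU openin_subset by blast
  then have cov: "topspace X = (\<Union>i\<in>I. cinv (ch i) ` ball (cmap (ch i) i) (r i))" by (simp only: U_def)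
  have "ch i \<in> A \<and> i \<in> cdom (ch i) \<and> 0 < r i \<and> cball (cmap (ch i) i) (8 * r i) \<subseteq> cimg (ch i)" if "i \<in> I" for i
    using ch[of i] r[of i] I(2) that by blast
  then show ?thesis using I(1,2) cov by blast
qed

section \<open>Estimates on a compact manifold\<close>

lemma dzdir_scale:
  fixes u :: "complex^'n::finite \<Rightarrow> real"
  assumes "u differentiable (at x)"
  shows "dzdir (c *s V) u x = c * dzdir V u x"
  unfolding dzdir_sum[OF assms, symmetric] by (simp add: sum_distrib_left mult.assoc)

text \<open>The direction varies together with the point; a basis expansion reduces this to
  derivatives in fixed directions.\<close>

lemma continuous_on_dd:
  fixes u :: "'a::euclidean_space \<Rightarrow> real"
  assumes "smooth_on u S" "K \<subseteq> S" "continuous_on T L"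
  shows "continuous_on (K \<times> T) (\<lambda>(y, V). dd (L V) u y)"
proof -
  have eq: "(\<Sum>b\<in>Basis. (L V \<bullet> b) * dd b u y) = dd (L V) u y" if "y \<in> K" for y V
  proof -
    have du: "u differentiable (at y)" using smooth_on_imp_differentiable[OF assms(1)] that assms(2) by auto
    have "dd (L V) u y = dd (\<Sum>b\<in>Basis. (L V \<bullet> b) *\<^sub>R b) u y" by (simp add: euclidean_representation)
    then show ?thesis by (simp add: dd_sum_dir du dd_scaleR_dir)
  qed
  have c: "continuous_on (K \<times> T) (\<lambda>p. dd b u (fst p))" for b
    by (rule continuous_on_compose2[OF smooth_on_imp_continuous_on[OF smooth_on_dd[OF assms(1)]]])
      (use assms(2) in \<open>auto intro: continuous_intros\<close>)
  have l: "continuous_on (K \<times> T) (\<lambda>p. L (snd p))"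
    by (rule continuous_on_compose2[OF assms(3)]) (auto intro: continuous_intros)
  have "continuous_on (K \<times> T) (\<lambda>p. \<Sum>b\<in>Basis. (L (snd p) \<bullet> b) * dd b u (fst p))"
    by (intro continuous_intros c l)
  then show ?thesis
    by (rule continuous_on_eq) (use eq in \<open>auto simp: case_prod_beta\<close>)
qed

lemma continuous_on_imul: "continuous_on T (imul :: complex^'n::finite \<Rightarrow> _)"
  unfolding vector_scalar_mult_def by (intro continuous_intros)

text \<open>The cube of x \<le> e^x at x = lam t / 3. It absorbs the factor t^3 of the local
  estimate.\<close>

lemma cube_exp_le: "0 < lam \<Longrightarrow> 0 \<le> t \<Longrightarrow> t^3 * exp (- lam * t) \<le> 27 / lam^3" for t lam :: real
proof -
  assume l: "0 < lam" and t: "0 \<le> t"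
  have "lam * t / 3 \<le> exp (lam * t / 3)" using exp_ge_add_one_self[of "lam * t / 3"] by linarith
  then have "(lam * t / 3)^3 \<le> exp (lam * t / 3)^3" using l t by (intro power_mono) auto
  also have "\<dots> = exp (lam * t)" by (simp add: exp_of_nat_mult[symmetric])
  finally have "lam^3 * t^3 \<le> 27 * exp (lam * t)" by (simp add: power_mult_distrib power_divide)
  then have "lam^3 * t^3 * exp (- lam * t) \<le> 27 * exp (lam * t) * exp (- lam * t)" by (intro mult_right_mono) auto
  also have "\<dots> = 27" by (simp add: exp_add[symmetric])
  finally show ?thesis using l by (simp add: field_simps)
qed

section \<open>Patches of a finite cover and connected components\<close>

locale kaehler_cover =
  fixes X :: "'a topology" and A :: "('a, 'n::finite) chart set" and \<omega> chi :: "('a, 'n) coeffs"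
    and I :: "'a set" and ch :: "'a \<Rightarrow> ('a, 'n) chart" and r :: "'a \<Rightarrow> real"
  assumes M: "complex_manifold X A" and \<omega>: "hermitian_metric A \<omega>" and chi: "hermitian_metric A chi"
    and I: "finite I" "I \<subseteq> topspace X"
    and ch: "\<And>i. i \<in> I \<Longrightarrow> ch i \<in> A" "\<And>i. i \<in> I \<Longrightarrow> i \<in> cdom (ch i)"
    and r: "\<And>i. i \<in> I \<Longrightarrow> 0 < r i" "\<And>i. i \<in> I \<Longrightarrow> cball (cmap (ch i) i) (8 * r i) \<subseteq> cimg (ch i)"
    and cover: "topspace X = (\<Union>i\<in>I. cinv (ch i) ` ball (cmap (ch i) i) (r i))"
begin

definition center :: "'a \<Rightarrow> complex^'n" where "center i = cmap (ch i) i"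
definition patch :: "'a \<Rightarrow> 'a set" where "patch i = cinv (ch i) ` ball (center i) (r i)"
text \<open>Chains of overlapping patches give a finite description of components: for
  \<open>i \<in> I\<close>, \<open>comp i\<close> is the connected component that contains
  \<open>patch i\<close>.\<close>

definition overlap :: "('a \<times> 'a) set" where
  "overlap = {(i, j). i \<in> I \<and> j \<in> I \<and> patch i \<inter> patch j \<noteq> {}}"
definition cls :: "'a \<Rightarrow> 'a set" where "cls i = {j. (i, j) \<in> overlap\<^sup>*}"
definition comp :: "'a \<Rightarrow> 'a set" where "comp i = (\<Union>j\<in>cls i. patch j)"

lemma cls: "i \<in> I \<Longrightarrow> cls i \<subseteq> I" "i \<in> cls i"
proof -
  assume i: "i \<in> I"
  have "j \<in> I" if "(i, j) \<in> overlap\<^sup>*" for j using that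
    by (induction rule: rtrancl_induct) (use i in \<open>auto simp: overlap_def\<close>)
  then show "cls i \<subseteq> I" by (auto simp: cls_def)
next
  show "i \<in> cls i" by (simp add: cls_def)
qed

lemma cball_cimg: "i \<in> I \<Longrightarrow> s \<le> 8 * r i \<Longrightarrow> cball (center i) s \<subseteq> cimg (ch i)"
  using r(2)[of i] unfolding center_def by (auto simp: subset_iff)

lemma ball_cimg: "i \<in> I \<Longrightarrow> s \<le> 8 * r i \<Longrightarrow> ball (center i) s \<subseteq> cimg (ch i)"
  using cball_cimg[of i s] ball_subset_cball by blast

lemma openin_patch: "i \<in> I \<Longrightarrow> openin X (patch i)"
  unfolding patch_def using r(1)[of i] by (intro openin_cinv_image[OF M ch(1)] ball_cimg) auto

lemma patchD:
  assumes "i \<in> I" "p \<in> patch i"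
  shows "p \<in> cdom (ch i)" "cmap (ch i) p \<in> ball (center i) (r i)" "cinv (ch i) (cmap (ch i) p) = p"
proof -
  obtain y where y: "y \<in> ball (center i) (r i)" "p = cinv (ch i) y" using assms(2) by (auto simp: patch_def)
  have "y \<in> cimg (ch i)" using ball_cimg[OF assms(1), of "r i"] r(1)[OF assms(1)] y(1) by auto
  then show "p \<in> cdom (ch i)" "cmap (ch i) p \<in> ball (center i) (r i)" "cinv (ch i) (cmap (ch i) p) = p"
    using y(1) cmap_cinv[OF \<open>y \<in> cimg (ch i)\<close>] unfolding y(2) by simp_all
qed

lemma ex_patch: "p \<in> topspace X \<Longrightarrow> \<exists>i\<in>I. p \<in> patch i"
  unfolding cover patch_def center_def by blast

lemma comp_patch:
  assumes "i \<in> I" "p \<in> comp i" "k \<in> I" "p \<in> patch k"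
  shows "k \<in> cls i"
proof -
  obtain j where j: "j \<in> cls i" "p \<in> patch j" using assms(2) by (auto simp: comp_def)
  then have "(j, k) \<in> overlap" using assms cls(1)[OF assms(1)] by (auto simp: overlap_def)
  then show ?thesis using j(1) unfolding cls_def by (auto intro: rtrancl_into_rtrancl)
qed

text \<open>The coordinate ball is connected, and \<open>comp i\<close> and its complement are both unions of patches.\<close>

lemma big_ball_comp:
  assumes i: "i \<in> I" and j: "j \<in> cls i" and y: "y \<in> ball (center j) (8 * r j)"
  shows "cinv (ch j) y \<in> comp i"
proof -
  have jI: "j \<in> I" using cls(1)[OF i] j by auto
  let ?T = "ball (center j) (8 * r j)"
  define W where "W = (\<Union>k\<in>I - cls i. patch k)"
  have sub: "?T \<subseteq> cimg (ch j)" by (rule ball_cimg[OF jI]) simp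
  have oS: "openin X (comp i)" unfolding comp_def using cls(1)[OF i] openin_patch by (intro openin_Union) auto
  have oW: "openin X W" unfolding W_def using openin_patch by (intro openin_Union) auto
  define S' where "S' = cmap (ch j) ` (comp i \<inter> cdom (ch j))"
  define W' where "W' = cmap (ch j) ` (W \<inter> cdom (ch j))"
  have o: "open S'" "open W'"
    unfolding S'_def W'_def using chart_open(1)[OF M ch(1)[OF jI]] oS oW
    by (auto intro!: open_cmap_image[OF M ch(1)[OF jI]])
  have disj: "comp i \<inter> W = {}" using comp_patch[OF i] by (auto simp: W_def)
  have "S' \<inter> W' \<inter> ?T = {}"
  proof -
    have False if xS: "x \<in> S'" and xW: "x \<in> W'" for x
    proof -
      obtain p where p: "p \<in> comp i" "p \<in> cdom (ch j)" "x = cmap (ch j) p" using xS unfolding S'_def by blast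
      obtain q where q: "q \<in> W" "q \<in> cdom (ch j)" "x = cmap (ch j) q" using xW unfolding W'_def by blast
      have "p = q" using cinv_cmap(1)[OF M ch(1)[OF jI] p(2)] cinv_cmap(1)[OF M ch(1)[OF jI] q(2)] p(3) q(3) by simp
      then show False using p(1) q(1) disj by blast
    qed
    then show ?thesis by blast
  qed
  moreover have "?T \<subseteq> S' \<union> W'"
  proof
    fix x assume x: "x \<in> ?T"
    then have c: "cinv (ch j) x \<in> cdom (ch j)" "cmap (ch j) (cinv (ch j) x) = x" using sub cmap_cinv by blast+
    then have "cinv (ch j) x \<in> topspace X" using chart_open(3)[OF M ch(1)[OF jI]] by blast
    then obtain k where "k \<in> I" "cinv (ch j) x \<in> patch k" using ex_patch by blast
    then have "cinv (ch j) x \<in> comp i \<or> cinv (ch j) x \<in> W" by (auto simp: comp_def W_def)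
    then show "x \<in> S' \<union> W'" unfolding S'_def W'_def using c by (metis Int_iff UnCI image_eqI)
  qed
  ultimately have "S' \<inter> ?T = {} \<or> W' \<inter> ?T = {}"
    using connectedD[OF connected_ball o] by blast
  moreover have "center j \<in> S' \<inter> ?T"
  proof -
    have "j \<in> patch j" unfolding patch_def using r(1)[OF jI] cinv_cmap(1)[OF M ch[OF jI]]
      by (metis center_def centre_in_ball image_eqI)
    then have "j \<in> comp i" using j by (auto simp: comp_def)
    then show ?thesis using ch(2)[OF jI] r(1)[OF jI] by (auto simp: S'_def center_def)
  qed
  ultimately have "W' \<inter> ?T = {}" by blast
  then have "y \<in> S'" using y \<open>?T \<subseteq> S' \<union> W'\<close> by blast
  then show ?thesis using cinv_cmap(1)[OF M ch(1)[OF jI]] by (auto simp: S'_def)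
qed

section \<open>The exponential gradient estimate on a component\<close>

lemma \<omega>_pos: "i \<in> I \<Longrightarrow> y \<in> cimg (ch i) \<Longrightarrow> pos_def (\<omega> (ch i) y)"
  using \<omega> ch(1) unfolding hermitian_metric_def positive11_def by blast

lemma metric_smooth:
  "i \<in> I \<Longrightarrow> smooth_on (\<lambda>y. \<omega> (ch i) y $ k $ l) (cimg (ch i))"
  "i \<in> I \<Longrightarrow> smooth_on (\<lambda>y. chi (ch i) y $ k $ l) (cimg (ch i))"
  using \<omega> chi ch(1) unfolding hermitian_metric_def real_form11_def by blast+

lemma open_cimg: "i \<in> I \<Longrightarrow> open (cimg (ch i))"
  by (rule chart_open(2)[OF M ch(1)])

lemma potentialsD:
  assumes "\<phi> \<in> potentials A chi" "i \<in> I"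
  shows "smooth_on (in_chart (ch i) \<phi>) (cimg (ch i))"
    "y \<in> cimg (ch i) \<Longrightarrow> pos_def (perturb chi \<phi> (ch i) y)"
    "y \<in> cimg (ch i) \<Longrightarrow> sesq (perturb chi \<phi> (ch i) y) V U = sesq (chi (ch i) y) V U + chess (in_chart (ch i) \<phi>) y V U"
proof -
  show s: "smooth_on (in_chart (ch i) \<phi>) (cimg (ch i))" using assms ch(1) unfolding potentials_def smooth_fun_def by blast
  show "y \<in> cimg (ch i) \<Longrightarrow> pos_def (perturb chi \<phi> (ch i) y)"
    using assms ch(1) unfolding potentials_def positive11_def by blast
  show "y \<in> cimg (ch i) \<Longrightarrow> sesq (perturb chi \<phi> (ch i) y) V U = sesq (chi (ch i) y) V U + chess (in_chart (ch i) \<phi>) y V U"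
    by (rule sesq_perturb[OF open_cimg[OF assms(2)] s])
qed

text \<open>The quotient \<open>N / G\<close> is maximized over unit vectors and over all closed
  balls of the component. The maximum point may lie on the boundary of its ball;
  \<open>chart_change\<close> then moves it to a patch that has it in the interior, where the local
  estimate applies.\<close>

lemma comp_gradient_estimate:
  assumes i0: "i0 \<in> I" and \<phi>: "\<phi> \<in> potentials A chi" and eq: "donaldson_eq A \<omega> chi F \<phi>"
    and lam: "0 < lam" and B: "0 \<le> B"
    and est: "\<And>i. i \<in> I \<Longrightarrow> grad_estimate (\<omega> (ch i)) (chi (ch i)) (\<lambda>y. real CARD('n) * exp (in_chart (ch i) F y))
      (cimg (ch i)) (cball (center i) (r i)) lam (b i)" "\<And>i. i \<in> I \<Longrightarrow> b i \<le> B"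
    and m: "\<And>q. q \<in> comp i0 \<Longrightarrow> m \<le> \<phi> q"
    and p: "p \<in> comp i0" "c \<in> A" "p \<in> cdom c"
  shows "grad_sq \<omega> \<phi> c (cmap c p) \<le> B * (27 / lam^3) * exp 1 * exp (lam * (\<phi> p - m + 1))"
proof -
  let ?J = "cls i0"
  have JI: "?J \<subseteq> I" by (rule cls(1)[OF i0])
  have fJ: "finite ?J" using JI I(1) by (rule finite_subset)
  have s\<phi>: "smooth_fun A \<phi>" using \<phi> by (simp add: potentials_def)
  define E where "E t = exp (- lam * t + 1 / t)" for t :: real
  define N where "N i y V = norm (dzdir V (in_chart (ch i) \<phi>) y) ^ 2 * E (in_chart (ch i) \<phi> y - m + 1)" for i y V
  define G where "G i y V = Re (sesq (\<omega> (ch i) y) V V)" for i y V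
  have tpos: "1 \<le> in_chart (ch i) \<phi> y - m + 1" if "i \<in> ?J" "y \<in> ball (center i) (8 * r i)" for i y
    using m[OF big_ball_comp[OF i0 that]] by (simp add: in_chart_def)
  have small: "cball (center i) (r i) \<subseteq> ball (center i) (8 * r i)" if "i \<in> I" for i
    using r(1)[OF that] by auto
  have Gpos: "0 < G i y V" if "i \<in> I" "y \<in> cimg (ch i)" "V \<noteq> 0" for i y V
    using \<omega>_pos[OF that(1,2)] that(3) by (simp add: G_def pos_def_sesq)
  have dif: "in_chart (ch i) \<phi> differentiable (at y)" if "i \<in> I" "y \<in> cimg (ch i)" for i y
    by (rule smooth_fun_differentiable[OF s\<phi> ch(1)[OF that(1)] that(2)])
  have "\<exists>q\<in>cball (center i) (r i) \<times> sphere 0 1. \<forall>q'\<in>cball (center i) (r i) \<times> sphere 0 1.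
      N i (fst q') (snd q') / G i (fst q') (snd q') \<le> N i (fst q) (snd q) / G i (fst q) (snd q)" if i: "i \<in> ?J" for i
  proof (rule continuous_attains_sup)
    have iI: "i \<in> I" using i JI by auto
    have Kc: "cball (center i) (r i) \<subseteq> cimg (ch i)" using r(1)[OF iI] by (intro cball_cimg[OF iI]) auto
    show "compact (cball (center i) (r i) \<times> sphere (0::complex^'n) 1)" by (intro compact_Times) auto
    have "axis undefined 1 \<in> sphere (0::complex^'n) 1" by simp
    moreover have "center i \<in> cball (center i) (r i)" using r(1)[OF iI] by simp
    ultimately show "cball (center i) (r i) \<times> sphere (0::complex^'n) 1 \<noteq> {}" by blast
    have sm: "smooth_on (in_chart (ch i) \<phi>) (cimg (ch i))" by (rule potentialsD(1)[OF \<phi> iI])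
    have c1: "continuous_on (cball (center i) (r i) \<times> sphere 0 1) (\<lambda>q. dd (snd q) (in_chart (ch i) \<phi>) (fst q))"
      using continuous_on_dd[OF sm Kc continuous_on_id] by (simp add: case_prod_beta)
    have c2: "continuous_on (cball (center i) (r i) \<times> sphere 0 1) (\<lambda>q. dd (imul (snd q)) (in_chart (ch i) \<phi>) (fst q))"
      using continuous_on_dd[OF sm Kc continuous_on_imul] by (simp add: case_prod_beta)
    have c3: "continuous_on (cball (center i) (r i) \<times> sphere (0::complex^'n) 1) (\<lambda>q. in_chart (ch i) \<phi> (fst q))"
      by (rule continuous_on_compose2[OF smooth_on_imp_continuous_on[OF sm]]) (use Kc in \<open>auto intro: continuous_intros\<close>)
    have c4: "continuous_on (cball (center i) (r i) \<times> sphere 0 1) (\<lambda>q. sesq (\<omega> (ch i) (fst q)) (snd q) (snd q))"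
      using continuous_on_sesq[of "cball (center i) (r i)" "\<omega> (ch i)" "sphere 0 1"]
        continuous_on_subset[OF smooth_on_imp_continuous_on[OF metric_smooth(1)[OF iI]] Kc]
      by (simp add: case_prod_beta)
    have t0: "in_chart (ch i) \<phi> y - m + 1 \<noteq> 0" if "y \<in> cball (center i) (r i)" for y
      using tpos[OF i, of y] small[OF iI] that by auto
    have g0: "Re (sesq (\<omega> (ch i) y) V V) \<noteq> 0" if "y \<in> cball (center i) (r i)" "norm V = 1" for y V
    proof -
      have "V \<noteq> 0" "y \<in> cimg (ch i)" using that Kc by auto
      then show ?thesis using Gpos[OF iI] unfolding G_def by force
    qed
    show "continuous_on (cball (center i) (r i) \<times> sphere 0 1) (\<lambda>q. N i (fst q) (snd q) / G i (fst q) (snd q))"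
      unfolding N_def G_def E_def norm_dzdir_square
      by (intro continuous_on_divide continuous_on_mult continuous_on_add continuous_on_power continuous_on_minus
          continuous_on_diff continuous_on_exp continuous_on_const continuous_on_Re c1 c2 c3 c4)
        (use t0 g0 in \<open>auto simp: mem_Times_iff\<close>)
  qed
  then obtain Q where Q: "\<And>i. i \<in> ?J \<Longrightarrow> Q i \<in> cball (center i) (r i) \<times> sphere 0 1"
    "\<And>i y V. i \<in> ?J \<Longrightarrow> y \<in> cball (center i) (r i) \<Longrightarrow> norm V = 1 \<Longrightarrow>
       N i y V / G i y V \<le> N i (fst (Q i)) (snd (Q i)) / G i (fst (Q i)) (snd (Q i))"
    by (metis (no_types, lifting) dist_0_norm fst_conv mem_Sigma_iff mem_sphere snd_conv)
  define v where "v i = N i (fst (Q i)) (snd (Q i)) / G i (fst (Q i)) (snd (Q i))" for i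
  define mx where "mx = Max (v ` ?J)"
  have "mx \<in> v ` ?J" unfolding mx_def using fJ cls(2)[of i0] by (intro Max_in) auto
  then obtain i1 where i1: "i1 \<in> ?J" "v i1 = mx" by auto
  have vle: "v i \<le> mx" if "i \<in> ?J" for i unfolding mx_def using fJ that by simp
  \<comment> \<open>Both sides are homogeneous of degree 2 in \<open>V\<close>, so the bound for
    unit vectors extends to all vectors.\<close>
  have all: "N i y V \<le> mx * G i y V" if i: "i \<in> ?J" and y: "y \<in> cball (center i) (r i)" for i y V
  proof (cases "V = 0")
    case True
    have iI: "i \<in> I" using i JI by auto
    have "y \<in> cimg (ch i)" using y r(1)[OF iI] cball_cimg[OF iI, of "r i"] by auto
    then show ?thesis using dzdir_scale[OF dif[OF iI], of y 0 V] True by (simp add: N_def G_def)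
  next
    case False
    have iI: "i \<in> I" using i JI by auto
    have yc: "y \<in> cimg (ch i)" using y r(1)[OF iI] cball_cimg[OF iI, of "r i"] by auto
    define W where "W = of_real (1 / norm V) *s V"
    have "norm W = 1" using False unfolding W_def scaleR_eq_smult[symmetric] by simp
    then have "N i y W / G i y W \<le> mx" using Q(2)[OF i y] vle[OF i] by (fastforce simp: v_def)
    moreover have "W \<noteq> 0" using \<open>norm W = 1\<close> by auto
    then have "0 < G i y W" by (rule Gpos[OF iI yc])
    ultimately have le: "N i y W \<le> mx * G i y W" by (simp add: field_simps)
    have VW: "V = of_real (norm V) *s W" using False by (simp add: W_def)
    have "N i y V = norm V ^ 2 * N i y W"
      by (subst VW) (simp add: N_def dzdir_scale[OF dif[OF iI yc]] norm_mult power_mult_distrib)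
    moreover have "G i y V = norm V ^ 2 * G i y W"
      unfolding G_def by (subst (1 2) VW) (simp only: scaleR_eq_smult[symmetric] Re_sesq_scaleR)
    ultimately show ?thesis using mult_left_mono[OF le, of "norm V ^ 2"] by (simp add: mult_ac)
  qed
  obtain y1 V1 where Q1: "Q i1 = (y1, V1)" by (cases "Q i1")
  have i1I: "i1 \<in> I" using i1 JI by auto
  have y1: "y1 \<in> cball (center i1) (r i1)" "norm V1 = 1" using Q(1)[OF i1(1)] Q1 by auto
  have y1c: "y1 \<in> cimg (ch i1)" using y1 r(1)[OF i1I] cball_cimg[OF i1I, of "r i1"] by auto
  have "V1 \<noteq> 0" using y1(2) by auto
  then have G1pos: "0 < G i1 y1 V1" by (rule Gpos[OF i1I y1c])
  have mx_eq: "N i1 y1 V1 = mx * G i1 y1 V1"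
    unfolding i1(2)[symmetric] v_def Q1 using G1pos by simp
  have mx0: "0 \<le> mx" unfolding i1(2)[symmetric] v_def Q1 using G1pos by (simp add: N_def E_def)
  define p1 where "p1 = cinv (ch i1) y1"
  have p1c: "p1 \<in> comp i0" unfolding p1_def using y1 small[OF i1I] by (intro big_ball_comp[OF i0 i1(1)]) auto
  have p1d: "p1 \<in> cdom (ch i1)" "cmap (ch i1) p1 = y1" using cmap_cinv[OF y1c] by (simp_all add: p1_def)
  obtain j where j: "j \<in> ?J" "p1 \<in> patch j" using p1c by (auto simp: comp_def)
  have jI: "j \<in> I" using j JI by auto
  note pj = patchD[OF jI j(2)]
  define y2 where "y2 = cmap (ch j) p1"
  have y2: "y2 \<in> ball (center j) (r j)" using pj by (simp add: y2_def)
  have y2c: "y2 \<in> cimg (ch j)" using y2 r(1)[OF jI] ball_cimg[OF jI, of "r j"] by auto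
  obtain D where D: "\<forall>u V. smooth_fun A u \<longrightarrow> dzdir V (in_chart (ch i1) u) (cmap (ch i1) p1) = dzdir (D V) (in_chart (ch j) u) (cmap (ch j) p1)"
    "\<forall>h V. real_form11 A h \<longrightarrow> sesq (h (ch j) (cmap (ch j) p1)) (D V) (D V) = sesq (h (ch i1) (cmap (ch i1) p1)) V V"
    using chart_change[OF M ch(1)[OF i1I] p1d(1) ch(1)[OF jI] pj(1)] by (elim exE conjE)
  define V2 where "V2 = D V1"
  have "real_form11 A \<omega>" using \<omega> by (simp add: hermitian_metric_def)
  then have G2: "G j y2 V2 = G i1 y1 V1" using D(2) unfolding G_def y2_def V2_def p1d(2) by metis
  have val: "in_chart (ch j) \<phi> y2 = \<phi> p1" "in_chart (ch i1) \<phi> y1 = \<phi> p1"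
    unfolding y2_def p1d(2)[symmetric] using in_chart_cmap[OF M] ch(1) jI i1I pj(1) p1d(1) by blast+
  have dz: "dzdir V2 (in_chart (ch j) \<phi>) y2 = dzdir V1 (in_chart (ch i1) \<phi>) y1"
    using D(1) s\<phi> unfolding V2_def y2_def p1d(2) by metis
  then have N2: "N j y2 V2 = mx * G j y2 V2" using mx_eq G2 by (simp add: N_def val)
  have G2pos: "0 < G j y2 V2" unfolding G2 by (rule G1pos)
  define t where "t = \<phi> p1 - m + 1"
  have t: "1 \<le> t" using m[OF p1c] by (simp add: t_def)
  have mx_bound: "mx \<le> B * (27 / lam^3) * exp 1"
  proof (cases "mx = 0")
    case True
    then show ?thesis using B lam by simp
  next
    case False
    define w where "w = dzdir V2 (in_chart (ch j) \<phi>) y2"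
    have w0: "w \<noteq> 0"
    proof
      assume "w = 0"
      then have "N j y2 V2 = 0" by (simp add: N_def w_def)
      then show False using N2 False G2pos by simp
    qed
    define \<rho> where "\<rho> = norm w / sqrt (G j y2 V2)"
    have \<rho>: "0 < \<rho>" using w0 G2pos by (simp add: \<rho>_def)
    \<comment> \<open>Scaled to unit \<open>g\<close>-length and rotated by a phase, so that the
      derivative along \<open>V\<close> is real and positive, as \<open>grad_estimate\<close>
      requires.\<close>
    define V where "V = (cnj w / of_real (norm w * sqrt (G j y2 V2))) *s V2"
    have dV: "dzdir V (in_chart (ch j) \<phi>) y2 = of_real \<rho>"
    proof -
      have "dzdir V (in_chart (ch j) \<phi>) y2 = (w * cnj w) / of_real (norm w * sqrt (G j y2 V2))"
        unfolding V_def dzdir_scale[OF dif[OF jI y2c]] w_def[symmetric] by (simp add: mult.commute)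
      also have "w * cnj w = of_real (norm w * norm w)" by (metis complex_norm_square power2_eq_square)
      finally show ?thesis using w0 unfolding \<rho>_def of_real_divide[symmetric] by simp
    qed
    have gV: "Re (sesq (\<omega> (ch j) y2) V V) = 1"
    proof -
      define c where "c = cnj w / of_real (norm w * sqrt (G j y2 V2))"
      have cc: "c * cnj c = of_real (norm c ^ 2)" by (metis complex_norm_square)
      have nc: "norm c ^ 2 = 1 / G j y2 V2"
        using w0 G2pos by (simp add: c_def norm_divide norm_mult power_divide power_mult_distrib)
      have "sesq (\<omega> (ch j) y2) V V = c * cnj c * sesq (\<omega> (ch j) y2) V2 V2"
        unfolding V_def c_def[symmetric] sesq_scale_left sesq_scale_right mult.assoc by (rule mult.left_commute)
      also have "\<dots> = of_real (1 / G j y2 V2) * sesq (\<omega> (ch j) y2) V2 V2" by (simp only: cc nc)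
      finally have "Re (sesq (\<omega> (ch j) y2) V V) = (1 / G j y2 V2) * G j y2 V2"
        by (simp only: times_complex.sel Re_complex_of_real Im_complex_of_real mult_zero_left diff_zero G_def)
      then show ?thesis using G2pos by simp
    qed
    have \<rho>E: "\<rho>^2 * E t = mx"
    proof -
      have "norm w ^ 2 * E t = mx * G j y2 V2" using N2 by (simp add: N_def w_def val t_def)
      then show ?thesis using G2pos by (simp add: \<rho>_def power_divide field_simps)
    qed
    let ?N = "ball (center j) (r j)"
    have Nc: "?N \<subseteq> cimg (ch j)" using r(1)[OF jI] by (intro ball_cimg[OF jI]) auto
    have "\<rho>^2 \<le> b j * (in_chart (ch j) \<phi> y2 - m + 1) ^ 3"
    proof (rule est(1)[OF jI, unfolded grad_estimate_def, rule_format, where N = ?N and H = "perturb chi \<phi> (ch j)" and V = V])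
      show "y2 \<in> cball (center j) (r j)" using y2 by auto
      show "open ?N" by simp
      show "y2 \<in> ?N" by (rule y2)
      show "?N \<subseteq> cimg (ch j)" by (rule Nc)
      show "smooth_on (in_chart (ch j) \<phi>) ?N" by (rule smooth_on_subset[OF potentialsD(1)[OF \<phi> jI] Nc])
      show "Re (sesq (\<omega> (ch j) y2) V V) = 1" by (rule gV)
      show "dzdir V (in_chart (ch j) \<phi>) y2 = of_real \<rho>" by (rule dV)
      show "0 < \<rho>" by (rule \<rho>)
    next
      fix y assume "y \<in> ?N"
      then have yc: "y \<in> cimg (ch j)" using Nc by auto
      then show "pos_def (perturb chi \<phi> (ch j) y)" by (rule potentialsD(2)[OF \<phi> jI])
    next
      fix y V U assume "y \<in> ?N"
      then have yc: "y \<in> cimg (ch j)" using Nc by auto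
      then show "sesq (perturb chi \<phi> (ch j) y) V U = sesq (chi (ch j) y) V U + chess (in_chart (ch j) \<phi>) y V U"
        by (rule potentialsD(3)[OF \<phi> jI])
    next
      fix y \<epsilon> assume "y \<in> ?N" and fr: "frame (perturb chi \<phi> (ch j) y) \<epsilon>"
      then have yc: "y \<in> cimg (ch j)" using Nc by auto
      have "wedge 2 (2 * (CARD('n) - 1)) (form11 (\<omega> (ch j) y)) (wedge_power2 (form11 (perturb chi \<phi> (ch j) y)) (CARD('n) - 1)) v =
        complex_of_real (exp (in_chart (ch j) F y)) * wedge_power2 (form11 (perturb chi \<phi> (ch j) y)) CARD('n) v" for v
        using eq ch(1)[OF jI] yc unfolding donaldson_eq_def by blast
      from donaldson_trace[OF fr this]
      show "(\<Sum>k\<in>UNIV. sesq (\<omega> (ch j) y) (\<epsilon> k) (\<epsilon> k)) = of_real (real CARD('n) * exp (in_chart (ch j) F y))" by simp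
    next
      fix y assume "y \<in> ?N"
      then show "m \<le> in_chart (ch j) \<phi> y" using tpos[OF j(1), of y] r(1)[OF jI] by auto
    next
      fix y assume y: "y \<in> ?N"
      then have "N j y V \<le> mx * G j y V" by (intro all[OF j(1)]) auto
      then show "norm (dzdir V (in_chart (ch j) \<phi>) y) ^ 2 * exp (- lam * (in_chart (ch j) \<phi> y - m + 1) + 1 / (in_chart (ch j) \<phi> y - m + 1))
       \<le> \<rho>^2 * exp (- lam * (in_chart (ch j) \<phi> y2 - m + 1) + 1 / (in_chart (ch j) \<phi> y2 - m + 1)) * Re (sesq (\<omega> (ch j) y) V V)"
        unfolding \<rho>E[symmetric] N_def G_def E_def val t_def .
    qed
    then have "\<rho>^2 \<le> b j * t^3" by (simp add: val t_def)
    also have "\<dots> \<le> B * t^3" using est(2)[OF jI] t by (intro mult_right_mono) auto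
    finally have "mx \<le> B * t^3 * E t" unfolding \<rho>E[symmetric] by (rule mult_right_mono) (simp add: E_def)
    \<comment> \<open>The summand 1 in the definition of \<open>t\<close> keeps
      \<open>exp (1 / t)\<close> below \<open>exp 1\<close>.\<close>
    also have "E t \<le> exp (- lam * t) * exp 1"
      unfolding E_def exp_add using t by (intro mult_left_mono) auto
    then have "B * t^3 * E t \<le> B * t^3 * (exp (- lam * t) * exp 1)" using B t by (intro mult_left_mono) auto
    also have "\<dots> = B * (t^3 * exp (- lam * t)) * exp 1" by simp
    also have "\<dots> \<le> B * (27 / lam^3) * exp 1"
      using cube_exp_le[OF lam, of t] t B by (intro mult_right_mono mult_left_mono) auto
    finally show ?thesis .
  qed
  obtain k where k: "k \<in> ?J" "p \<in> patch k" using p(1) by (auto simp: comp_def)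
  have kI: "k \<in> I" using k JI by auto
  note pk = patchD[OF kI k(2)]
  define y where "y = cmap (ch k) p"
  have yc: "y \<in> cimg (ch k)" using cinv_cmap(2)[OF M ch(1)[OF kI] pk(1)] by (simp add: y_def)
  define w where "w = grad_sq \<omega> \<phi> (ch k) y"
  obtain V where V: "dzdir V (in_chart (ch k) \<phi>) y = of_real w" "Re (sesq (\<omega> (ch k) y) V V) = w"
    using grad_sq_extremal(2)[of \<omega> "ch k", OF \<omega>_pos[OF kI yc] dif[OF kI yc]] unfolding w_def by blast
  have w0: "0 \<le> w" using pos_def_nonneg[OF \<omega>_pos[OF kI yc], of V] V(2) by simp
  have vp: "in_chart (ch k) \<phi> y = \<phi> p" unfolding y_def by (rule in_chart_cmap[OF M ch(1)[OF kI] pk(1)])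
  define s where "s = \<phi> p - m + 1"
  have s: "1 \<le> s" using m[OF p(1)] by (simp add: s_def)
  have "N k y V \<le> mx * G k y V" using pk(2) by (intro all[OF k(1)]) (auto simp: y_def)
  then have "w * w * E s \<le> mx * w" using V w0 by (simp add: N_def G_def vp s_def power2_eq_square)
  then have ww: "(w * E s) * w \<le> mx * w" by (simp only: mult_ac)
  have "w * E s \<le> mx"
  proof (cases "w = 0")
    case True
    then show ?thesis using mx0 by simp
  next
    case False
    then have "0 < w" using w0 by simp
    with ww show ?thesis by (rule mult_right_le_imp_le)
  qed
  then have "w * E s * exp (lam * s) \<le> mx * exp (lam * s)" by (rule mult_right_mono) simp
  moreover have "w \<le> w * E s * exp (lam * s)"
  proof -
    have "1 \<le> exp (1 / s)" using s by simp
    also have "\<dots> = E s * exp (lam * s)" by (simp add: E_def exp_add[symmetric])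
    finally show ?thesis using w0 by (simp add: mult.assoc mult_le_cancel_left1)
  qed
  ultimately have "w \<le> mx * exp (lam * s)" by linarith
  also have "\<dots> \<le> B * (27 / lam^3) * exp 1 * exp (lam * s)" using mx_bound by (intro mult_right_mono) auto
  finally have "w \<le> B * (27 / lam^3) * exp 1 * exp (lam * s)" .
  moreover have "grad_sq \<omega> \<phi> c (cmap c p) \<le> w"
    unfolding w_def y_def by (rule grad_sq_chart_le[OF M \<omega> s\<phi> p(2,3) ch(1)[OF kI] pk(1)])
  ultimately show ?thesis unfolding s_def by linarith
qed

text \<open>The complex Hessian of a potential is bounded below by \<open>- chi\<close>, since
  adding \<open>chi\<close> makes it positive. Hence one \<open>K\<close> serves all
  potentials.\<close>

lemma patch_bounds:
  assumes i: "i \<in> I"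
  shows "\<exists>Rb Cg K. 0 < Rb \<and> 0 < Cg \<and> 0 \<le> K \<and>
    (\<forall>y\<in>cball (center i) (8 * r i). \<forall>V. Re (sesq (\<omega> (ch i) y) V V) \<le> Cg * norm V ^ 2) \<and>
    (\<forall>y\<in>cball (center i) (8 * r i). \<forall>V. Re (sesq (\<omega> (ch i) y) V V) = 1 \<longrightarrow> norm V \<le> Rb) \<and>
    (\<forall>\<phi>\<in>potentials A chi. trace_hess_ge (\<omega> (ch i)) K (in_chart (ch i) \<phi>) (cball (center i) (8 * r i)))"
proof -
  define K0 where "K0 = cball (center i) (8 * r i)"
  have Kc: "K0 \<subseteq> cimg (ch i)" unfolding K0_def by (rule cball_cimg[OF i]) simp
  have comp: "compact K0" by (simp add: K0_def)
  have cg: "continuous_on K0 (\<lambda>y. \<omega> (ch i) y $ k $ l)" for k l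
    by (rule continuous_on_subset[OF smooth_on_imp_continuous_on[OF metric_smooth(1)[OF i]] Kc])
  have cc: "continuous_on K0 (\<lambda>y. chi (ch i) y $ k $ l)" for k l
    by (rule continuous_on_subset[OF smooth_on_imp_continuous_on[OF metric_smooth(2)[OF i]] Kc])
  have pd: "pos_def (\<omega> (ch i) y)" if "y \<in> K0" for y using \<omega>_pos[OF i] Kc that by blast
  have "\<exists>c>0. \<forall>y\<in>K0. \<forall>V. c * norm V ^ 2 \<le> Re (sesq (\<omega> (ch i) y) V V)"
    by (rule sesq_lower_bound[OF comp cg pd])
  then obtain c where c: "0 < c" "\<forall>y\<in>K0. \<forall>V. c * norm V ^ 2 \<le> Re (sesq (\<omega> (ch i) y) V V)"
    by (elim exE conjE)
  obtain C where C: "0 < C" "\<forall>y\<in>K0. \<forall>V U. norm (sesq (\<omega> (ch i) y) V U) \<le> C * norm V * norm U"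
    using sesq_upper_bound[OF comp cg] by (elim exE conjE)
  obtain C' where C': "0 < C'" "\<forall>y\<in>K0. \<forall>V U. norm (sesq (chi (ch i) y) V U) \<le> C' * norm V * norm U"
    using sesq_upper_bound[OF comp cc] by (elim exE conjE)
  define Rb where "Rb = sqrt (1 / c)"
  have Rb: "0 < Rb" using c by (simp add: Rb_def)
  define K where "K = real CARD('n) * (C' * Rb^2)"
  have up: "Re (sesq (\<omega> (ch i) y) V V) \<le> C * norm V ^ 2" if "y \<in> K0" for y V
    using C(2)[rule_format, OF that, of V V] complex_Re_le_cmod[of "sesq (\<omega> (ch i) y) V V"]
    by (simp add: power2_eq_square mult.assoc)
  have nb: "norm V \<le> Rb" if "y \<in> K0" "Re (sesq (\<omega> (ch i) y) V V) = 1" for y V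
    using c(2)[rule_format, OF that(1), of V] that(2) c(1) unfolding Rb_def
    by (intro real_le_rsqrt) (simp add: field_simps)
  have tr: "trace_hess_ge (\<omega> (ch i)) K (in_chart (ch i) \<phi>) K0" if \<phi>: "\<phi> \<in> potentials A chi" for \<phi>
    unfolding trace_hess_ge_def
  proof (intro ballI allI impI)
    fix y e assume y: "y \<in> K0" and e: "frame (\<omega> (ch i) y) e"
    have yc: "y \<in> cimg (ch i)" using y Kc by auto
    have "- (C' * Rb^2) \<le> Re (chess (in_chart (ch i) \<phi>) y (e k) (e k))" for k
    proof -
      have "norm (e k) \<le> Rb" using e by (intro nb[OF y]) (simp add: frame_def)
      then have "C' * norm (e k) * norm (e k) \<le> C' * Rb^2"
        using C'(1) Rb unfolding power2_eq_square mult.assoc by (intro mult_left_mono mult_mono) auto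
      moreover have "Re (sesq (chi (ch i) y) (e k) (e k)) \<le> norm (sesq (chi (ch i) y) (e k) (e k))"
        by (rule complex_Re_le_cmod)
      moreover have "norm (sesq (chi (ch i) y) (e k) (e k)) \<le> C' * norm (e k) * norm (e k)" using C'(2) y by blast
      moreover have "0 \<le> Re (sesq (perturb chi \<phi> (ch i) y) (e k) (e k))"
        by (rule pos_def_nonneg[OF potentialsD(2)[OF \<phi> i yc]])
      ultimately show ?thesis unfolding potentialsD(3)[OF \<phi> i yc] plus_complex.sel by linarith
    qed
    then have "(\<Sum>k\<in>(UNIV::'n set). - (C' * Rb^2)) \<le> (\<Sum>k\<in>UNIV. Re (chess (in_chart (ch i) \<phi>) y (e k) (e k)))"
      by (intro sum_mono)
    then show "- K \<le> (\<Sum>k\<in>UNIV. Re (chess (in_chart (ch i) \<phi>) y (e k) (e k)))" by (simp add: K_def)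
  qed
  have "0 \<le> K" using C'(1) by (simp add: K_def)
  then show ?thesis using Rb C(1) up nb tr unfolding K0_def by blast
qed

text \<open>\<open>gap_propagation\<close> around \<open>y\<close> with radii
  \<open>\<delta>\<close>, \<open>2 * r i\<close> and \<open>3 * r i\<close>. The ball of radius
  \<open>2 * r i\<close> covers the patch; the one of radius \<open>3 * r i\<close> stays in the
  coordinate ball, hence in \<open>comp i0\<close>, where \<open>s\<close> bounds \<phi>. The
  constants do not depend on \<open>y\<close>.\<close>

lemma spread_in_patch:
  assumes i0: "i0 \<in> I" and i: "i \<in> cls i0" and \<delta>: "0 < \<delta>" "\<delta> < 3 * r i"
  shows "\<exists>\<theta>>0. \<exists>D. \<forall>\<phi>\<in>potentials A chi. \<forall>s d. \<forall>y\<in>ball (center i) (r i).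
     (\<forall>q\<in>comp i0. \<phi> q \<le> s) \<longrightarrow> D \<le> d \<longrightarrow> 0 \<le> d \<longrightarrow> (\<forall>x\<in>cball y \<delta>. in_chart (ch i) \<phi> x \<le> s - d) \<longrightarrow>
     (\<forall>q\<in>patch i. \<phi> q \<le> s - \<theta> * d)"
proof -
  have iI: "i \<in> I" using cls(1)[OF i0] i by auto
  note ri = r(1)[OF iI]
  obtain Rb Cg K where b: "0 < Rb" "0 < Cg" "0 \<le> K"
    and Cg: "\<forall>y\<in>cball (center i) (8 * r i). \<forall>V. Re (sesq (\<omega> (ch i) y) V V) \<le> Cg * norm V ^ 2"
    and Rb: "\<forall>y\<in>cball (center i) (8 * r i). \<forall>V. Re (sesq (\<omega> (ch i) y) V V) = 1 \<longrightarrow> norm V \<le> Rb"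
    and tr: "\<forall>\<phi>\<in>potentials A chi. trace_hess_ge (\<omega> (ch i)) K (in_chart (ch i) \<phi>) (cball (center i) (8 * r i))"
    using patch_bounds[OF iI] by (elim exE conjE)
  have r23: "2 * r i < 3 * r i" "0 \<le> 2 * r i" using ri by auto
  obtain \<theta> D where \<theta>: "0 < \<theta>" and D: "\<forall>(g :: complex^'n \<Rightarrow> complex^'n^'n) \<phi> z s d N.
    open N \<longrightarrow> cball z (3 * r i) \<subseteq> N \<longrightarrow> smooth_on \<phi> N \<longrightarrow> (\<forall>y\<in>cball z (3 * r i). pos_def (g y)) \<longrightarrow>
    (\<forall>y\<in>cball z (3 * r i). \<forall>V. Re (sesq (g y) V V) \<le> Cg * norm V ^ 2) \<longrightarrow>
    (\<forall>y\<in>cball z (3 * r i). \<forall>V. Re (sesq (g y) V V) = 1 \<longrightarrow> norm V \<le> Rb) \<longrightarrow>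
    trace_hess_ge g K \<phi> (cball z (3 * r i)) \<longrightarrow> D \<le> d \<longrightarrow> 0 \<le> d \<longrightarrow>
    (\<forall>y\<in>cball z (3 * r i). \<phi> y \<le> s) \<longrightarrow> (\<forall>y\<in>cball z \<delta>. \<phi> y \<le> s - d) \<longrightarrow>
    (\<forall>y\<in>cball z (2 * r i). \<phi> y \<le> s - \<theta> * d)" 
    using gap_propagation[OF \<delta> r23 b] by (elim exE conjE)
  show ?thesis
  proof (rule exI[of _ \<theta>], intro conjI, rule \<theta>, rule exI[of _ D], intro ballI allI impI)
    fix \<phi> s d y q
    assume \<phi>: "\<phi> \<in> potentials A chi" and y: "y \<in> ball (center i) (r i)" and s: "\<forall>q\<in>comp i0. \<phi> q \<le> s"
      and d: "D \<le> d" "0 \<le> d" "\<forall>x\<in>cball y \<delta>. in_chart (ch i) \<phi> x \<le> s - d" and q: "q \<in> patch i"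
    have sub: "cball y (3 * r i) \<subseteq> ball (center i) (8 * r i)"
    proof
      fix x assume "x \<in> cball y (3 * r i)"
      then show "x \<in> ball (center i) (8 * r i)" using y dist_triangle[of "center i" x y] ri by auto
    qed
    then have sub': "cball y (3 * r i) \<subseteq> cball (center i) (8 * r i)" using ball_subset_cball by blast
    have subc: "cball y (3 * r i) \<subseteq> cimg (ch i)" using sub' cball_cimg[OF iI, of "8 * r i"] by blast
    have "\<forall>x\<in>cball y (2 * r i). in_chart (ch i) \<phi> x \<le> s - \<theta> * d"
    proof (rule D[rule_format, where g = "\<omega> (ch i)" and N = "cimg (ch i)", THEN ballI])
      show "open (cimg (ch i))" by (rule open_cimg[OF iI])
      show "cball y (3 * r i) \<subseteq> cimg (ch i)" by (rule subc)
      show "smooth_on (in_chart (ch i) \<phi>) (cimg (ch i))" by (rule potentialsD(1)[OF \<phi> iI])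
      show "trace_hess_ge (\<omega> (ch i)) K (in_chart (ch i) \<phi>) (cball y (3 * r i))"
        using tr \<phi> sub' unfolding trace_hess_ge_def by blast
      show "D \<le> d" "0 \<le> d" by (rule d)+
    next
      fix x assume "x \<in> cball y (3 * r i)"
      then show "pos_def (\<omega> (ch i) x)" using subc \<omega>_pos[OF iI] by blast
    next
      fix x V assume "x \<in> cball y (3 * r i)"
      then show "Re (sesq (\<omega> (ch i) x) V V) \<le> Cg * norm V ^ 2" using Cg sub' by blast
    next
      fix x V assume "x \<in> cball y (3 * r i)" "Re (sesq (\<omega> (ch i) x) V V) = 1"
      then show "norm V \<le> Rb" using Rb sub' by blast
    next
      fix x assume "x \<in> cball y (3 * r i)"
      then have "cinv (ch i) x \<in> comp i0" using sub by (intro big_ball_comp[OF i0 i]) auto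
      then show "in_chart (ch i) \<phi> x \<le> s" using s by (simp add: in_chart_def)
    next
      fix x assume "x \<in> cball y \<delta>"
      then show "in_chart (ch i) \<phi> x \<le> s - d" using d(3) by blast
    qed
    moreover have "cmap (ch i) q \<in> cball y (2 * r i)"
      using patchD(2)[OF iI q] y dist_triangle[of y "cmap (ch i) q" "center i"] by (auto simp: dist_commute)
    ultimately have "in_chart (ch i) \<phi> (cmap (ch i) q) \<le> s - \<theta> * d" by blast
    then show "\<phi> q \<le> s - \<theta> * d" by (simp add: in_chart_def patchD(3)[OF iI q])
  qed
qed

section \<open>Chaining gaps through overlapping patches\<close>

definition spreads :: "'a \<Rightarrow> 'a set \<Rightarrow> 'a set \<Rightarrow> bool" where
  "spreads i0 P P' \<longleftrightarrow> (\<exists>\<theta>>0. \<exists>D. \<forall>\<phi>\<in>potentials A chi. \<forall>s d. (\<forall>q\<in>comp i0. \<phi> q \<le> s) \<longrightarrow> D \<le> d \<longrightarrow> 0 \<le> d \<longrightarrow>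
     (\<forall>q\<in>P. \<phi> q \<le> s - d) \<longrightarrow> (\<forall>q\<in>P'. \<phi> q \<le> s - \<theta> * d))"

lemma spreads_refl: "spreads i0 P P"
  unfolding spreads_def by (intro exI[of _ 1] conjI exI[of _ 0]) auto

text \<open>The first step shrinks the gap to \<open>\<theta> * d\<close>, so the second threshold
  has to be divided by \<open>\<theta>\<close>.\<close>

lemma spreads_trans:
  assumes "spreads i0 P P'" "spreads i0 P' P''"
  shows "spreads i0 P P''"
proof -
  obtain \<theta> D where \<theta>: "0 < \<theta>" and D: "\<And>\<phi> s d. \<phi> \<in> potentials A chi \<Longrightarrow> \<forall>q\<in>comp i0. \<phi> q \<le> s \<Longrightarrow> D \<le> d \<Longrightarrow> 0 \<le> d \<Longrightarrow>
     \<forall>q\<in>P. \<phi> q \<le> s - d \<Longrightarrow> \<forall>q\<in>P'. \<phi> q \<le> s - \<theta> * d"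
    using assms(1) unfolding spreads_def by metis
  obtain \<theta>' D' where \<theta>': "0 < \<theta>'" and D': "\<And>\<phi> s d. \<phi> \<in> potentials A chi \<Longrightarrow> \<forall>q\<in>comp i0. \<phi> q \<le> s \<Longrightarrow> D' \<le> d \<Longrightarrow> 0 \<le> d \<Longrightarrow>
     \<forall>q\<in>P'. \<phi> q \<le> s - d \<Longrightarrow> \<forall>q\<in>P''. \<phi> q \<le> s - \<theta>' * d"
    using assms(2) unfolding spreads_def by metis
  show ?thesis unfolding spreads_def
  proof (rule exI[of _ "\<theta>' * \<theta>"], intro conjI, use \<theta> \<theta>' in simp, rule exI[of _ "max D (D' / \<theta>)"], intro ballI allI impI)
    fix \<phi> s d q assume a: "\<phi> \<in> potentials A chi" "\<forall>q\<in>comp i0. \<phi> q \<le> s" "max D (D' / \<theta>) \<le> d" "0 \<le> d" "\<forall>q\<in>P. \<phi> q \<le> s - d" "q \<in> P''"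
    have 1: "\<forall>q\<in>P'. \<phi> q \<le> s - \<theta> * d" using a by (intro D) auto
    have "D' \<le> \<theta> * d" using a(3) \<theta> by (simp add: field_simps)
    then have "\<forall>q\<in>P''. \<phi> q \<le> s - \<theta>' * (\<theta> * d)" using a \<theta> 1 by (intro D') auto
    then show "\<phi> q \<le> s - \<theta>' * \<theta> * d" using a(6) by (simp add: mult.assoc)
  qed
qed

text \<open>The overlap contains a coordinate ball of the chart \<open>ch j\<close>, on which the
  gap of \<open>patch i\<close> holds; from there it spreads inside \<open>patch j\<close>.\<close>

lemma spreads_overlap:
  assumes i0: "i0 \<in> I" and i: "i \<in> cls i0" and ij: "(i, j) \<in> overlap"
  shows "spreads i0 (patch i) (patch j)"
proof -
  have I: "i \<in> I" "j \<in> I" using ij by (auto simp: overlap_def)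
  have j: "j \<in> cls i0" using i ij unfolding cls_def by (auto intro: rtrancl_into_rtrancl)
  obtain q where q: "q \<in> patch i" "q \<in> patch j" using ij by (auto simp: overlap_def)
  define y where "y = cmap (ch j) q"
  have y: "y \<in> ball (center j) (r j)" using patchD(2)[OF I(2) q(2)] by (simp add: y_def)
  define W where "W = cmap (ch j) ` (patch i \<inter> cdom (ch j))"
  have oW: "open W" unfolding W_def
    using openin_patch[OF I(1)] chart_open(1)[OF M ch(1)[OF I(2)]]
    by (intro open_cmap_image[OF M ch(1)[OF I(2)]] openin_Int) auto
  have yW: "y \<in> W" using q(1) patchD(1)[OF I(2) q(2)] by (simp add: W_def y_def)
  obtain \<delta>0 where \<delta>0: "0 < \<delta>0" "cball y \<delta>0 \<subseteq> W" using oW yW open_contains_cball by metis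
  define \<delta> where "\<delta> = min \<delta>0 (r j)"
  have \<delta>: "0 < \<delta>" "\<delta> < 3 * r j" "cball y \<delta> \<subseteq> W" using \<delta>0 r(1)[OF I(2)] by (auto simp: \<delta>_def)
  have inv: "cinv (ch j) x \<in> patch i" if "x \<in> cball y \<delta>" for x
  proof -
    have "x \<in> W" using that \<delta>(3) by auto
    then obtain p where p: "p \<in> patch i" "p \<in> cdom (ch j)" "x = cmap (ch j) p" unfolding W_def by blast
    then show ?thesis using cinv_cmap(1)[OF M ch(1)[OF I(2)] p(2)] by simp
  qed
  obtain \<theta> D where \<theta>: "0 < \<theta>" and D: "\<forall>\<phi>\<in>potentials A chi. \<forall>s d. \<forall>y\<in>ball (center j) (r j).
     (\<forall>q\<in>comp i0. \<phi> q \<le> s) \<longrightarrow> D \<le> d \<longrightarrow> 0 \<le> d \<longrightarrow> (\<forall>x\<in>cball y \<delta>. in_chart (ch j) \<phi> x \<le> s - d) \<longrightarrow>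
     (\<forall>q\<in>patch j. \<phi> q \<le> s - \<theta> * d)"
    using spread_in_patch[OF i0 j \<delta>(1,2)] by (elim exE conjE)
  show ?thesis unfolding spreads_def
  proof (rule exI[of _ \<theta>], intro conjI, rule \<theta>, rule exI[of _ D], intro ballI allI impI)
    fix \<phi> s d q assume a: "\<phi> \<in> potentials A chi" "\<forall>q\<in>comp i0. \<phi> q \<le> s" "D \<le> d" "0 \<le> d" "\<forall>q\<in>patch i. \<phi> q \<le> s - d" "q \<in> patch j"
    show "\<phi> q \<le> s - \<theta> * d"
      by (rule D[rule_format, OF a(1) y _ a(3,4) _ a(6)]) (use a(2,5) inv in \<open>auto simp: in_chart_def\<close>)
  qed
qed

lemma overlap_sym: "sym overlap"
  unfolding sym_def overlap_def by blast

lemma spreads_cls: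
  assumes i0: "i0 \<in> I" and i: "i \<in> cls i0" and j: "j \<in> cls i0"
  shows "spreads i0 (patch i) (patch j)"
proof -
  \<comment> \<open>Reversing the chain from \<open>i0\<close> to \<open>i\<close> yields a chain
    from \<open>i\<close> to \<open>j\<close> through \<open>i0\<close>.\<close>
  have "(i, i0) \<in> overlap\<^sup>*" using i sym_rtrancl[OF overlap_sym] unfolding cls_def sym_def by blast
  then have "(i, j) \<in> overlap\<^sup>*" using j unfolding cls_def by (auto intro: rtrancl_trans)
  then show ?thesis
  proof (induction rule: rtrancl_induct)
    case base
    show ?case by (rule spreads_refl)
  next
    case (step k l)
    have "k \<in> cls i0" using i step(1) unfolding cls_def by (auto intro: rtrancl_trans)
    from spreads_trans[OF step.IH spreads_overlap[OF i0 this step(2)]] show ?case .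
  qed
qed

text \<open>Although \<open>comp i0\<close> is a union of open patches, the finitely many closed
  coordinate balls also lie in it by \<open>big_ball_comp\<close>, and they cover it.\<close>

lemma comp_attains_max:
  assumes i0: "i0 \<in> I" and c: "\<And>i. i \<in> I \<Longrightarrow> continuous_on (cimg (ch i)) (in_chart (ch i) u)"
  shows "\<exists>q\<in>comp i0. \<forall>p\<in>comp i0. u p \<le> u q"
proof -
  let ?J = "cls i0"
  have fJ: "finite ?J" using cls(1)[OF i0] I(1) by (rule finite_subset)
  have "\<exists>q\<in>comp i0. \<forall>p\<in>patch i. u p \<le> u q" if i: "i \<in> ?J" for i
  proof -
    have iI: "i \<in> I" using i cls(1)[OF i0] by auto
    let ?K = "cball (center i) (r i)"
    have "?K \<subseteq> cimg (ch i)" using r(1)[OF iI] by (intro cball_cimg[OF iI]) auto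
    then have "continuous_on ?K (in_chart (ch i) u)" by (rule continuous_on_subset[OF c[OF iI]])
    moreover have "?K \<noteq> {}" "compact ?K" using r(1)[OF iI] by auto
    ultimately obtain y where y: "y \<in> ?K" "\<And>x. x \<in> ?K \<Longrightarrow> in_chart (ch i) u x \<le> in_chart (ch i) u y"
      using continuous_attains_sup by metis
    have "cinv (ch i) y \<in> comp i0" using y(1) r(1)[OF iI] by (intro big_ball_comp[OF i0 i]) auto
    moreover have "u p \<le> u (cinv (ch i) y)" if p: "p \<in> patch i" for p
    proof -
      have "cmap (ch i) p \<in> ?K" using patchD(2)[OF iI p] by auto
      from y(2)[OF this] show ?thesis by (simp add: in_chart_def patchD(3)[OF iI p])
    qed
    ultimately show ?thesis by blast
  qed
  then obtain Q where Q: "\<And>i. i \<in> ?J \<Longrightarrow> Q i \<in> comp i0" "\<And>i p. i \<in> ?J \<Longrightarrow> p \<in> patch i \<Longrightarrow> u p \<le> u (Q i)" by metis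
  have "Max ((\<lambda>i. u (Q i)) ` ?J) \<in> (\<lambda>i. u (Q i)) ` ?J" using fJ cls(2)[of i0] by (intro Max_in) auto
  then obtain k where k: "k \<in> ?J" "u (Q k) = Max ((\<lambda>i. u (Q i)) ` ?J)" by auto
  have "u p \<le> u (Q k)" if p: "p \<in> comp i0" for p
  proof -
    obtain i where i: "i \<in> ?J" "p \<in> patch i" using p by (auto simp: comp_def)
    have "u p \<le> u (Q i)" by (rule Q(2)[OF i])
    also have "\<dots> \<le> u (Q k)" unfolding k(2) using fJ i(1) by (intro Max_ge) auto
    finally show ?thesis .
  qed
  then show ?thesis using Q(1)[OF k(1)] by blast
qed

text \<open>If the maximum were too large, the gap near the minimum point would spread to the patch
  of \<open>q1\<close> and force \<phi> at \<open>q1\<close> strictly below its own value.\<close>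

lemma comp_oscillation_from:
  assumes i0: "i0 \<in> I" and i: "i \<in> cls i0" and j: "j \<in> cls i0" and lam: "0 < lam" and C: "0 \<le> C"
  shows "\<exists>D. \<forall>\<phi>\<in>potentials A chi. \<forall>q0 q1. q0 \<in> patch i \<longrightarrow> q1 \<in> patch j \<longrightarrow>
    (\<forall>q\<in>comp i0. \<phi> q0 \<le> \<phi> q \<and> \<phi> q \<le> \<phi> q1) \<longrightarrow>
    (\<forall>y\<in>cimg (ch i). cinv (ch i) y \<in> comp i0 \<longrightarrow> grad_sq \<omega> \<phi> (ch i) y \<le> C * exp (lam * (in_chart (ch i) \<phi> y - \<phi> q0 + 1))) \<longrightarrow>
    \<phi> q1 \<le> \<phi> q0 + D"
proof -
  have iI: "i \<in> I" using cls(1)[OF i0] i by auto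
  note ri = r(1)[OF iI]
  obtain Cg where b: "0 < Cg"
    and Cg: "\<forall>y\<in>cball (center i) (8 * r i). \<forall>V. Re (sesq (\<omega> (ch i) y) V V) \<le> Cg * norm V ^ 2"
    using patch_bounds[OF iI] by blast
  \<comment> \<open>The constant for \<open>exp_gradient_bound_near_min\<close>; the 2 comes from
    the halves in \<open>dzdir\<close>, and the 1 keeps \<open>L\<close> positive when
    \<open>C\<close> is 0.\<close>
  define L where "L = 2 * sqrt (C * exp lam * Cg) + 1"
  have L: "0 < L" using C b by (simp add: L_def add_nonneg_pos)
  \<comment> \<open>The radius of the small ball relative to \<open>r i\<close>: every point of that
    ball will be within \<open>1 / (lam * L)\<close> of the minimum point.\<close>
  define \<tau> where "\<tau> = min (1/2) (1 / (lam * L) / (2 * r i))"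
  have \<tau>: "0 < \<tau>" "\<tau> < 1" using lam L ri by (auto simp: \<tau>_def)
  have \<tau>r: "2 * (\<tau> * r i) \<le> 1 / (lam * L)"
  proof -
    have "\<tau> * (2 * r i) \<le> 1 / (lam * L) / (2 * r i) * (2 * r i)" using ri by (intro mult_right_mono) (auto simp: \<tau>_def)
    then show ?thesis using ri by simp
  qed
  define \<delta> where "\<delta> = \<tau> * r i"
  have \<delta>: "0 < \<delta>" "\<delta> < 3 * r i"
  proof -
    show "0 < \<delta>" using \<tau> ri by (simp add: \<delta>_def)
    have "\<delta> \<le> 1 * r i" unfolding \<delta>_def using \<tau> ri by (intro mult_right_mono) auto
    then show "\<delta> < 3 * r i" using ri by simp
  qed
  obtain \<theta> D where \<theta>: "0 < \<theta>" and D: "\<forall>\<phi>\<in>potentials A chi. \<forall>s d. \<forall>y\<in>ball (center i) (r i).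
     (\<forall>q\<in>comp i0. \<phi> q \<le> s) \<longrightarrow> D \<le> d \<longrightarrow> 0 \<le> d \<longrightarrow> (\<forall>x\<in>cball y \<delta>. in_chart (ch i) \<phi> x \<le> s - d) \<longrightarrow>
     (\<forall>q\<in>patch i. \<phi> q \<le> s - \<theta> * d)"
    using spread_in_patch[OF i0 i \<delta>] by (elim exE conjE)
  obtain \<theta>' D' where \<theta>': "0 < \<theta>'" and D': "\<forall>\<phi>\<in>potentials A chi. \<forall>s d. (\<forall>q\<in>comp i0. \<phi> q \<le> s) \<longrightarrow> D' \<le> d \<longrightarrow> 0 \<le> d \<longrightarrow>
     (\<forall>q\<in>patch i. \<phi> q \<le> s - d) \<longrightarrow> (\<forall>q\<in>patch j. \<phi> q \<le> s - \<theta>' * d)"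
    using spreads_cls[OF i0 i j] unfolding spreads_def by (elim exE conjE)
  \<comment> \<open>Large enough for both spreading steps; the second one receives the gap reduced
    by the factor \<open>\<theta>\<close>.\<close>
  define D0 where "D0 = \<bar>D\<bar> + \<bar>D' / \<theta>\<bar> + 1"
  have D0: "D \<le> D0" "D' / \<theta> \<le> D0" "0 < D0" unfolding D0_def by linarith+
  have D0': "D' \<le> \<theta> * D0" using D0(2) \<theta> by (simp add: field_simps)
  show ?thesis
  proof (rule exI[of _ "2 * ln 2 / lam + D0"], intro ballI allI impI, rule ccontr)
    fix \<phi> q0 q1
    assume \<phi>: "\<phi> \<in> potentials A chi" and q0: "q0 \<in> patch i" and q1: "q1 \<in> patch j"
      and mm: "\<forall>q\<in>comp i0. \<phi> q0 \<le> \<phi> q \<and> \<phi> q \<le> \<phi> q1"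
      and grad: "\<forall>y\<in>cimg (ch i). cinv (ch i) y \<in> comp i0 \<longrightarrow> grad_sq \<omega> \<phi> (ch i) y \<le> C * exp (lam * (in_chart (ch i) \<phi> y - \<phi> q0 + 1))"
      and contra: "\<not> \<phi> q1 \<le> \<phi> q0 + (2 * ln 2 / lam + D0)"
    let ?f = "in_chart (ch i) \<phi>" and ?B = "ball (center i) (r i)"
    have Bc: "?B \<subseteq> cimg (ch i)" using ri by (intro ball_cimg[OF iI]) auto
    have dif: "?f differentiable (at y)" if "y \<in> cimg (ch i)" for y
      by (rule smooth_on_imp_differentiable[OF potentialsD(1)[OF \<phi> iI] that])
    have Lb: "\<bar>dd a ?f y\<bar> \<le> L * norm a * exp (lam * (?f y - \<phi> q0) / 2)" if y: "y \<in> ?B" for a y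
    proof -
      have yc: "y \<in> cimg (ch i)" using y Bc by auto
      have "cinv (ch i) y \<in> comp i0" using y ri by (intro big_ball_comp[OF i0 i]) auto
      then have g: "grad_sq \<omega> \<phi> (ch i) y \<le> C * exp (lam * (?f y - \<phi> q0 + 1))" using grad yc by blast
      have "y \<in> cball (center i) (8 * r i)" using y ri by auto
      then have s: "Re (sesq (\<omega> (ch i) y) a a) \<le> Cg * norm a ^ 2" using Cg by blast
      have s0: "0 \<le> Re (sesq (\<omega> (ch i) y) a a)" by (rule pos_def_nonneg[OF \<omega>_pos[OF iI yc]])
      have "(dd a ?f y / 2)^2 \<le> norm (dzdir a ?f y) ^ 2" unfolding norm_dzdir_square by simp
      also have "\<dots> \<le> grad_sq \<omega> \<phi> (ch i) y * Re (sesq (\<omega> (ch i) y) a a)"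
        by (rule grad_sq_extremal(1)[of \<omega> "ch i", OF \<omega>_pos[OF iI yc] dif[OF yc]])
      also have "\<dots> \<le> (C * exp (lam * (?f y - \<phi> q0 + 1))) * (Cg * norm a ^ 2)"
        using g s s0 C by (intro mult_mono) auto
      also have "exp (lam * (?f y - \<phi> q0 + 1)) = exp lam * exp (lam * (?f y - \<phi> q0) / 2) ^ 2"
        by (simp add: power2_eq_square exp_add[symmetric] algebra_simps)
      also have "(C * (exp lam * exp (lam * (?f y - \<phi> q0) / 2) ^ 2)) * (Cg * norm a ^ 2)
         = (sqrt (C * exp lam * Cg) * norm a * exp (lam * (?f y - \<phi> q0) / 2))^2"
        using C b by (simp add: power_mult_distrib)
      finally have "\<bar>dd a ?f y / 2\<bar> \<le> \<bar>sqrt (C * exp lam * Cg) * norm a * exp (lam * (?f y - \<phi> q0) / 2)\<bar>"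
        by (simp only: abs_le_square_iff)
      also have "\<dots> = sqrt (C * exp lam * Cg) * norm a * exp (lam * (?f y - \<phi> q0) / 2)"
        using C b by (intro abs_of_nonneg mult_nonneg_nonneg) auto
      finally have "\<bar>dd a ?f y / 2\<bar> \<le> sqrt (C * exp lam * Cg) * norm a * exp (lam * (?f y - \<phi> q0) / 2)" .
      then have "\<bar>dd a ?f y\<bar> \<le> 2 * sqrt (C * exp lam * Cg) * norm a * exp (lam * (?f y - \<phi> q0) / 2)" by simp
      also have "\<dots> \<le> L * norm a * exp (lam * (?f y - \<phi> q0) / 2)"
        unfolding L_def by (intro mult_right_mono) auto
      finally show ?thesis .
    qed
    define x0 where "x0 = cmap (ch i) q0"
    have x0: "x0 \<in> ?B" "?f x0 = \<phi> q0" using patchD[OF iI q0] by (simp_all add: x0_def in_chart_def)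
    \<comment> \<open>The minimum point may be close to the edge of the coordinate ball, so the
      centre of the small ball is shifted inwards.\<close>
    define y0 where "y0 = x0 + \<tau> *\<^sub>R (center i - x0)"
    have e: "norm (center i - x0) < r i" using x0(1) by (simp add: dist_norm)
    have y0c: "center i - y0 = (1 - \<tau>) *\<^sub>R (center i - x0)" by (simp add: y0_def algebra_simps)
    have nb: "x \<in> ?B \<and> norm (x - x0) \<le> 1 / (lam * L)" if x: "x \<in> cball y0 \<delta>" for x
    proof
      have xy: "norm (y0 - x) \<le> \<tau> * r i" using x by (simp add: dist_norm \<delta>_def)
      have "norm (center i - x) \<le> norm (center i - y0) + norm (y0 - x)"
        using norm_triangle_ineq[of "center i - y0" "y0 - x"] by simp
      also have "\<dots> \<le> (1 - \<tau>) * norm (center i - x0) + \<tau> * r i" using xy \<tau> unfolding y0c by simp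
      finally have 1: "norm (center i - x) \<le> (1 - \<tau>) * norm (center i - x0) + \<tau> * r i" .
      have 3: "norm (y0 - x0) = \<tau> * norm (center i - x0)" using \<tau> by (simp add: y0_def)
      show "x \<in> ?B"
      proof -
        have "(1 - \<tau>) * norm (center i - x0) < (1 - \<tau>) * r i" using \<tau> e by (intro mult_strict_left_mono) auto
        then show ?thesis using 1 by (simp add: dist_norm algebra_simps)
      qed
      have "norm (x - x0) \<le> norm (x - y0) + norm (y0 - x0)" using norm_triangle_ineq[of "x - y0" "y0 - x0"] by simp
      also have "\<dots> \<le> \<tau> * r i + \<tau> * r i" unfolding 3 using xy e \<tau> by (intro add_mono mult_left_mono) (auto simp: norm_minus_commute)
      finally show "norm (x - x0) \<le> 1 / (lam * L)" using \<tau>r by simp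
    qed
    have near: "?f x \<le> \<phi> q0 + 2 * ln 2 / lam" if x: "x \<in> cball y0 \<delta>" for x
      by (rule exp_gradient_bound_near_min[OF _ x0(1) _ _ L Lb lam _ x0(2)]) (use nb[OF x] dif Bc in auto)
    define s where "s = \<phi> q1"
    define d where "d = s - (\<phi> q0 + 2 * ln 2 / lam)"
    have d: "D0 \<le> d" using contra by (simp add: d_def s_def)
    have y0B: "y0 \<in> ?B" using nb[of y0] \<delta>(1) by simp
    have "\<forall>q\<in>patch i. \<phi> q \<le> s - \<theta> * d"
      by (rule D[rule_format, OF \<phi> y0B, THEN ballI]) (use mm d D0 near in \<open>auto simp: s_def d_def\<close>)
    moreover have "D' \<le> \<theta> * d" using D0' d \<theta> by (meson mult_left_mono less_imp_le order_trans)
    ultimately have "\<phi> q1 \<le> s - \<theta>' * (\<theta> * d)"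
      using D'[rule_format, OF \<phi>, of s "\<theta> * d" q1] mm q1 d D0(3) \<theta> by (auto simp: s_def)
    moreover have "0 < \<theta>' * (\<theta> * d)" using \<theta> \<theta>' d D0(3) by simp
    ultimately show False by (simp add: s_def)
  qed
qed

section \<open>Bounds uniform in the potential\<close>

lemma comp_gradient_bound:
  assumes F: "smooth_fun A F"
    and cone: "positive11 A (\<lambda>c z. chi c z -
             ((real CARD('n) - 1) / (real CARD('n) * exp (in_chart c F z))) *\<^sub>R \<omega> c z)"
  shows "\<exists>lam>0. \<exists>C\<ge>0. \<forall>i0\<in>I. \<forall>\<phi>\<in>potentials A chi. donaldson_eq A \<omega> chi F \<phi> \<longrightarrow>
    (\<forall>m. (\<forall>q\<in>comp i0. m \<le> \<phi> q) \<longrightarrow> (\<forall>c\<in>A. \<forall>p\<in>cdom c. p \<in> comp i0 \<longrightarrow>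
       grad_sq \<omega> \<phi> c (cmap c p) \<le> C * exp (lam * (\<phi> p - m + 1))))"
proof -
  let ?est = "\<lambda>i. grad_estimate (\<omega> (ch i)) (chi (ch i)) (\<lambda>y. real CARD('n) * exp (in_chart (ch i) F y))
      (cimg (ch i)) (cball (center i) (r i))"
  have n: "0 < real CARD('n)" using finite_UNIV_card_ge_0[where 'a='n] by simp
  have "\<exists>l>0. \<forall>lam\<ge>l. \<exists>B. ?est i lam B" if i: "i \<in> I" for i
  proof (rule local_gradient_estimate)
    show "open (cimg (ch i))" by (rule open_cimg[OF i])
    show "compact (cball (center i) (r i))" by simp
    show "cball (center i) (r i) \<subseteq> cimg (ch i)" using r(1)[OF i] by (intro cball_cimg[OF i]) auto
    show "smooth_on (\<lambda>y. \<omega> (ch i) y $ k $ l) (cimg (ch i))" "smooth_on (\<lambda>y. chi (ch i) y $ k $ l) (cimg (ch i))" for k l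
      by (rule metric_smooth[OF i])+
    have "smooth_on (in_chart (ch i) F) (cimg (ch i))" using F ch(1)[OF i] by (auto simp: smooth_fun_def)
    then show "smooth_on (\<lambda>y. real CARD('n) * exp (in_chart (ch i) F y)) (cimg (ch i))"
      by (intro smooth_on_bounded_linear[OF open_cimg[OF i] bounded_linear_mult_right] smooth_on_exp[OF open_cimg[OF i]])
    fix y assume y: "y \<in> cimg (ch i)"
    show "pos_def (\<omega> (ch i) y)" by (rule \<omega>_pos[OF i y])
    show "0 < real CARD('n) * exp (in_chart (ch i) F y)" using n by simp
    show "pos_def (chi (ch i) y - ((real CARD('n) - 1) / (real CARD('n) * exp (in_chart (ch i) F y))) *\<^sub>R \<omega> (ch i) y)"
      using cone ch(1)[OF i] y unfolding positive11_def by blast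
  qed
  then have "\<forall>i\<in>I. \<exists>l>0. \<forall>lam\<ge>l. \<exists>B. ?est i lam B" by blast
  from bchoice[OF this] obtain l where l: "\<forall>i\<in>I. 0 < l i \<and> (\<forall>lam\<ge>l i. \<exists>B. ?est i lam B)" by (rule exE)
  \<comment> \<open>One exponent above all local thresholds, positive even when the sum is
    empty.\<close>
  define lam where "lam = 1 + (\<Sum>i\<in>I. l i)"
  have lpos: "0 < l i" if "i \<in> I" for i using l that by blast
  have lam: "0 < lam" unfolding lam_def by (intro add_pos_nonneg sum_nonneg) (auto intro: less_imp_le lpos)
  have lge: "l i \<le> lam" if "i \<in> I" for i
    using member_le_sum[of i I l] that lpos I(1) by (force simp: lam_def less_imp_le)
  have "\<forall>i\<in>I. \<exists>B. ?est i lam B" using l lge by blast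
  from bchoice[OF this] obtain b where b: "\<forall>i\<in>I. ?est i lam (b i)" by (rule exE)
  define B where "B = (\<Sum>i\<in>I. \<bar>b i\<bar>)"
  have B: "0 \<le> B" by (simp add: B_def sum_nonneg)
  have bB: "b i \<le> B" if "i \<in> I" for i
    using member_le_sum[of i I "\<lambda>i. \<bar>b i\<bar>"] that I(1) unfolding B_def by force
  show ?thesis
  proof (rule exI[of _ lam], intro conjI, rule lam, rule exI[of _ "B * (27 / lam^3) * exp 1"], intro conjI ballI allI impI)
    show "0 \<le> B * (27 / lam^3) * exp 1" using B lam by simp
    fix i0 \<phi> m c p
    assume a: "i0 \<in> I" "\<phi> \<in> potentials A chi" "donaldson_eq A \<omega> chi F \<phi>" "\<forall>q\<in>comp i0. m \<le> \<phi> q"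
      "c \<in> A" "p \<in> cdom c" "p \<in> comp i0"
    show "grad_sq \<omega> \<phi> c (cmap c p) \<le> B * (27 / lam^3) * exp 1 * exp (lam * (\<phi> p - m + 1))"
      by (rule comp_gradient_estimate[OF a(1,2,3) lam B b[rule_format] bB _ a(7,5,6)]) (use a(4) in blast)+
  qed
qed

lemma comp_attains_min:
  assumes "i0 \<in> I" "\<phi> \<in> potentials A chi"
  shows "\<exists>q\<in>comp i0. \<forall>p\<in>comp i0. \<phi> q \<le> \<phi> p"
proof -
  have "continuous_on (cimg (ch i)) (in_chart (ch i) (\<lambda>p. - \<phi> p))" if "i \<in> I" for i
    using smooth_on_imp_continuous_on[OF potentialsD(1)[OF assms(2) that]]
    unfolding in_chart_def by (rule continuous_on_minus)
  from comp_attains_max[OF assms(1) this] show ?thesis by auto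
qed

text \<open>The patches of the minimum and the maximum vary with \<phi>, but only finitely many
  index triples occur, so the oscillation is bounded independently of \<phi>. Inserted into the
  exponential estimate, this leaves a constant.\<close>

lemma uniform_gradient_bound:
  assumes F: "smooth_fun A F"
    and cone: "positive11 A (\<lambda>c z. chi c z -
             ((real CARD('n) - 1) / (real CARD('n) * exp (in_chart c F z))) *\<^sub>R \<omega> c z)"
  shows "\<exists>C\<ge>0. \<forall>\<phi>\<in>potentials A chi. donaldson_eq A \<omega> chi F \<phi> \<longrightarrow>
    (\<forall>c\<in>A. \<forall>p\<in>cdom c. grad_sq \<omega> \<phi> c (cmap c p) \<le> C)"
proof -
  obtain lam C where lam: "0 < lam" and C: "0 \<le> C" and grad: "\<forall>i0\<in>I. \<forall>\<phi>\<in>potentials A chi. donaldson_eq A \<omega> chi F \<phi> \<longrightarrow>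
    (\<forall>m. (\<forall>q\<in>comp i0. m \<le> \<phi> q) \<longrightarrow> (\<forall>c\<in>A. \<forall>p\<in>cdom c. p \<in> comp i0 \<longrightarrow>
       grad_sq \<omega> \<phi> c (cmap c p) \<le> C * exp (lam * (\<phi> p - m + 1))))"
    using comp_gradient_bound[OF F cone] by (elim exE conjE)
  let ?osc = "\<lambda>i0 i j D. \<forall>\<phi>\<in>potentials A chi. \<forall>q0 q1. q0 \<in> patch i \<longrightarrow> q1 \<in> patch j \<longrightarrow>
    (\<forall>q\<in>comp i0. \<phi> q0 \<le> \<phi> q \<and> \<phi> q \<le> \<phi> q1) \<longrightarrow>
    (\<forall>y\<in>cimg (ch i). cinv (ch i) y \<in> comp i0 \<longrightarrow> grad_sq \<omega> \<phi> (ch i) y \<le> C * exp (lam * (in_chart (ch i) \<phi> y - \<phi> q0 + 1))) \<longrightarrow>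
    \<phi> q1 \<le> \<phi> q0 + D"
  define T where "T = {(i0, i, j). i0 \<in> I \<and> i \<in> cls i0 \<and> j \<in> cls i0}"
  have "T \<subseteq> I \<times> I \<times> I" using cls(1) by (auto simp: T_def)
  then have fT: "finite T" using I(1) by (meson finite_SigmaI finite_subset)
  have "\<forall>t\<in>T. \<exists>D. ?osc (fst t) (fst (snd t)) (snd (snd t)) D"
    using comp_oscillation_from[OF _ _ _ lam C] by (auto simp: T_def)
  from bchoice[OF this] obtain D where D: "\<forall>t\<in>T. ?osc (fst t) (fst (snd t)) (snd (snd t)) (D t)" by (rule exE)
  define D0 where "D0 = (\<Sum>t\<in>T. \<bar>D t\<bar>)"
  have DD: "D t \<le> D0" if "t \<in> T" for t
    using member_le_sum[of t T "\<lambda>t. \<bar>D t\<bar>"] that fT unfolding D0_def by force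
  show ?thesis
  proof (rule exI[of _ "C * exp (lam * (D0 + 1))"], intro conjI ballI allI impI)
    show "0 \<le> C * exp (lam * (D0 + 1))" using C by simp
    fix \<phi> c p assume \<phi>: "\<phi> \<in> potentials A chi" and eq: "donaldson_eq A \<omega> chi F \<phi>" and c: "c \<in> A" "p \<in> cdom c"
    have "p \<in> topspace X" using chart_open(3)[OF M c(1)] c(2) by auto
    then obtain i0 where i0: "i0 \<in> I" "p \<in> patch i0" using ex_patch by blast
    have pc: "p \<in> comp i0" using i0 cls(2) by (auto simp: comp_def)
    obtain q0 where q0: "q0 \<in> comp i0" "\<forall>q\<in>comp i0. \<phi> q0 \<le> \<phi> q" using comp_attains_min[OF i0(1) \<phi>] by blast
    obtain q1 where q1: "q1 \<in> comp i0" "\<forall>q\<in>comp i0. \<phi> q \<le> \<phi> q1"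
      using comp_attains_max[OF i0(1) smooth_on_imp_continuous_on[OF potentialsD(1)[OF \<phi>]]] by blast
    obtain i where i: "i \<in> cls i0" "q0 \<in> patch i" using q0(1) by (auto simp: comp_def)
    obtain j where j: "j \<in> cls i0" "q1 \<in> patch j" using q1(1) by (auto simp: comp_def)
    have iI: "i \<in> I" using cls(1)[OF i0(1)] i by auto
    have g: "grad_sq \<omega> \<phi> c (cmap c p) \<le> C * exp (lam * (\<phi> p - \<phi> q0 + 1))"
      if "c \<in> A" "p \<in> cdom c" "p \<in> comp i0" for c p
      using grad i0(1) \<phi> eq q0(2) that by blast
    have t: "(i0, i, j) \<in> T" using i0 i j by (simp add: T_def)
    have "\<phi> q1 \<le> \<phi> q0 + D (i0, i, j)"
    proof (rule D[rule_format, OF t, unfolded fst_conv snd_conv, rule_format, OF \<phi> i(2) j(2)])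
      fix q assume "q \<in> comp i0"
      then show "\<phi> q0 \<le> \<phi> q \<and> \<phi> q \<le> \<phi> q1" using q0(2) q1(2) by blast
    next
      fix y assume y: "y \<in> cimg (ch i)" "cinv (ch i) y \<in> comp i0"
      then show "grad_sq \<omega> \<phi> (ch i) y \<le> C * exp (lam * (in_chart (ch i) \<phi> y - \<phi> q0 + 1))"
        using g[OF ch(1)[OF iI] cmap_cinv(1)[OF y(1)] y(2)] cmap_cinv(2)[OF y(1)] by (simp add: in_chart_def)
    qed
    then have "\<phi> p \<le> \<phi> q0 + D0" using q1(2) pc DD[OF t] by fastforce
    then have "C * exp (lam * (\<phi> p - \<phi> q0 + 1)) \<le> C * exp (lam * (D0 + 1))"
      using lam C by (intro mult_left_mono) auto
    then show "grad_sq \<omega> \<phi> c (cmap c p) \<le> C * exp (lam * (D0 + 1))" using g[OF c pc] by linarith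
  qed
qed

text \<open>The real infimum in the theorem is a genuine lower bound only for a set bounded below;
  here finitely many attained minima bound it.\<close>

lemma potential_bdd_below:
  assumes "\<phi> \<in> potentials A chi"
  shows "bdd_below (\<phi> ` topspace X)"
proof -
  have "\<forall>i\<in>I. \<exists>q\<in>comp i. \<forall>p\<in>comp i. \<phi> q \<le> \<phi> p" using comp_attains_min[OF _ assms] by blast
  then obtain q where q: "\<And>i p. i \<in> I \<Longrightarrow> p \<in> comp i \<Longrightarrow> \<phi> (q i) \<le> \<phi> p" by metis
  have "bdd_below (\<Union>i\<in>I. \<phi> ` comp i)"
    using I(1) q by (subst bdd_below_UN) (auto intro!: bdd_belowI2)
  moreover have "\<phi> ` topspace X \<subseteq> (\<Union>i\<in>I. \<phi> ` comp i)"
    using ex_patch cls(2) unfolding comp_def by blast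
  ultimately show ?thesis by (rule bdd_below_mono)
qed

end

theorem theorem1p1:
  fixes X :: "'a topology"
    and A :: "('a, 'n::finite) chart set"
    and \<omega> chi :: "('a, 'n) coeffs"
  assumes "compact_kaehler_manifold X A \<omega>"
    and "hermitian_metric A chi"
  shows "\<exists>lam>0::real. \<forall>F :: 'a \<Rightarrow> real.
           smooth_fun A F \<longrightarrow>
           positive11 A (\<lambda>c z. chi c z -
             ((real CARD('n) - 1) / (real CARD('n) * exp (in_chart c F z))) *\<^sub>R \<omega> c z) \<longrightarrow>
           (\<exists>C::real. \<forall>\<phi>\<in>potentials A chi.
              donaldson_eq A \<omega> chi F \<phi> \<longrightarrow>
              (\<forall>c\<in>A. \<forall>p\<in>cdom c.
                 grad_sq \<omega> \<phi> c (cmap c p) \<le> C * exp (lam * (\<phi> p - (INF q\<in>topspace X. \<phi> q)))))"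
proof -
  have M: "complex_manifold X A" "compact_space X" and \<omega>: "hermitian_metric A \<omega>"
    using assms(1) by (simp_all add: compact_kaehler_manifold_def)
  obtain I ch and r :: "'a \<Rightarrow> real" where cov: "finite I" "I \<subseteq> topspace X"
    "\<forall>i\<in>I. ch i \<in> A \<and> i \<in> cdom (ch i) \<and> 0 < r i \<and> cball (cmap (ch i) i) (8 * r i) \<subseteq> cimg (ch i)"
    "topspace X = (\<Union>i\<in>I. cinv (ch i) ` ball (cmap (ch i) i) (r i))"
    using finite_chart_cover[OF M] by (elim exE conjE)
  interpret kaehler_cover X A \<omega> chi I ch r
    by unfold_locales (use M(1) \<omega> assms(2) cov in blast)+
  show ?thesis
  \<comment> \<open>The exponent is fixed before \<open>F\<close> is introduced. This is possible
    because the gradient bound contains no exponential, and multiplying the nonnegative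
    \<open>C\<close> by an exponential that is at least 1 only weakens it.\<close>
  proof (rule exI[of _ 1], intro conjI allI impI)
    fix F assume F: "smooth_fun A F" and cone: "positive11 A (\<lambda>c z. chi c z -
             ((real CARD('n) - 1) / (real CARD('n) * exp (in_chart c F z))) *\<^sub>R \<omega> c z)"
    obtain C where C: "0 \<le> C" and g: "\<forall>\<phi>\<in>potentials A chi. donaldson_eq A \<omega> chi F \<phi> \<longrightarrow>
      (\<forall>c\<in>A. \<forall>p\<in>cdom c. grad_sq \<omega> \<phi> c (cmap c p) \<le> C)"
      using uniform_gradient_bound[OF F cone] by (elim exE conjE)
    show "\<exists>C::real. \<forall>\<phi>\<in>potentials A chi. donaldson_eq A \<omega> chi F \<phi> \<longrightarrow>
              (\<forall>c\<in>A. \<forall>p\<in>cdom c.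
                 grad_sq \<omega> \<phi> c (cmap c p) \<le> C * exp (1 * (\<phi> p - (INF q\<in>topspace X. \<phi> q))))"
    proof (rule exI[of _ C], intro ballI impI)
      fix \<phi> c p assume \<phi>: "\<phi> \<in> potentials A chi" and eq: "donaldson_eq A \<omega> chi F \<phi>" and c: "c \<in> A" "p \<in> cdom c"
      have "p \<in> topspace X" using chart_open(3)[OF M(1) c(1)] c(2) by auto
      then have "(INF q\<in>topspace X. \<phi> q) \<le> \<phi> p" by (rule cINF_lower[OF potential_bdd_below[OF \<phi>]])
      then have "C * 1 \<le> C * exp (1 * (\<phi> p - (INF q\<in>topspace X. \<phi> q)))" using C by (intro mult_left_mono) auto
      then show "grad_sq \<omega> \<phi> c (cmap c p) \<le> C * exp (1 * (\<phi> p - (INF q\<in>topspace X. \<phi> q)))"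
        using g \<phi> eq c by fastforce
    qed
  qed simp
qed

end
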